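(* Let $(R,\mathfrak m,k)$ be a commutative noetherian local ring. If $\Lambda=RQ/I$ is a string algebra over $R$, then $\Lambda$ is biserial as a semiperfect noetherian ring. Furthermore the following statements hold for any admissible non-trivial path $p$. (1) If $p$ has left arrow $b$ and right arrow $a$, then $\mathcal Jp\cap b\Lambda\subseteq p\mathcal J$ and $p\mathcal J\cap\Lambda a\subseteq\mathcal Jp$, where $\mathcal J=\mathrm{rad}(\Lambda)$. (2) The kernel of the projective cover of $\Lambda p$ is a direct sum of at most $2$ modules each of the form $\Lambda q$ where $q$ is an admissible path of minimal length such that $qp$ is inadmissible. (3) The kernel of the projective cover of $p\Lambda$ is a direct sum of at most $2$ modules each of the form $q\Lambda$ where $q$ is an admissible path of minimal length such that $pq$ is inadmissible.
   Context: Quivers: a finite quiver $Q=(Q_0,Q_1,h,t)$ has finite sets of vertices $Q_0$ and arrows $Q_1$, and head and tail maps $h,t:Q_1\to Q_0$. Each vertex $v$ has a trivial path $e_v$ (length $0$, head and tail $v$); a non-trivial path of length $n\ge1$ is $a_n\cdots a_1$ with arrows satisfying $t(a_{i+1})=h(a_i)$; its head is $h(a_n)$, its tail $t(a_1)$, its left arrow $a_n$ and its right arrow $a_1$. The path algebra $RQ$ is the free $R$-module on the paths, with the product of paths $p,q$ being the composition $pq$ if $t(p)=h(q)$ and $0$ otherwise. For a two-sided ideal $I\triangleleft RQ$, a path is inadmissible if it lies in $I$ and admissible otherwise (so saying that $qp$ is inadmissible refers to $qp$ as a path). For $\Lambda=RQ/I$, elements of $RQ$ are identified with their cosets when acting on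 $\Lambda$; $\Lambda p$ is a left $\Lambda$-module and $p\Lambda$ is a right $\Lambda$-module. For a module $M$, $\mathrm{rad}(M)$ is its Jacobson radical, and $\mathrm{rad}(\Lambda)$ is the Jacobson radical of the ring $\Lambda$; $M$ is local if it has a unique maximal submodule (then equal to $\mathrm{rad}(M)$). String algebra over $R$: an $R$-algebra $\Lambda=RQ/I$, with $Q$ a finite quiver and $I\triangleleft RQ$ a two-sided ideal, that is finitely generated as an $R$-module and such that each vertex is the head of at most $2$ arrows and the tail of at most $2$ arrows, and $I$ is: - arrow-radical: for every vertex $v$, $\Lambda e_v$ is a local left module with $\mathrm{rad}(\Lambda e_v)=\sum_{t(a)=v}\Lambda a$, and $e_v\Lambda$ is a local right module with $\mathrm{rad}(e_v\Lambda)=\sum_{h(a)=v}a\Lambda$ (sums over arrows $a$); - arrow-direct: for every arrow $a$, $\Lambda a\cap\sum\Lambda b=0$ with the sum over arrows $b\neq a$ with $t(b)=t(a)$, and $a\Lambda\cap\sum b\Lambda=0$ with the sum over arrows $b\ne a$ with $h(b)=h(a)$; - permissible: $a\notin I$ for every arrow $a$; - special: for every arrow $b$ there is at most one arrow $a$ with $t(a)=h(b)$ and $ab\notin I$, and at most one arrow $c$ with $h(c)=t(b)$ and $bc\notin I$. Biserial: a module is uniserial if its submodules form a chain under inclusion (so $0$ is uniserial). A module $M$ is biserial if it has uniserial submodules $L,N$ such that either $L+N=M$ or $L+N=\mathrm{rad}(M)$ is the unique maximal submodule of $M$, and either $L\cap N=0$ or $L\cap N=\mathrm{soc}(M)$ is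 the unique simple submodule of $M$. A ring is semiperfect if it is semisimple artinian modulo its Jacobson radical and idempotents lift modulo the radical. A noetherian semiperfect ring is biserial if every indecomposable projective module (left or right) is biserial. *)

theory Defs
  imports "HOL-Algebra.Algebra" "Graph_Theory.Digraph"
begin

section \<open>Modules over a not necessarily commutative ring\<close>

text \<open>
  The locale \<open>module\<close> of HOL-Algebra requires a commutative ring of scalars, so its axioms are
  repeated here over an arbitrary ring.  A right module over \<open>A\<close> is a left module over
  \<open>opposite_ring A\<close>, and every notion below is applied to right modules in this form.
  The predicate \<open>submodule\<close> of HOL-Algebra involves no commutativity and is used as it stands;
  a submodule \<open>N\<close> of \<open>M\<close> regarded as a module is \<open>M\<lparr>carrier := N\<rparr>\<close>.
\<close>

locale left_module = R?: ring A + M?: abelian_group M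
  for A :: "('a, 'c) ring_scheme" and M :: "('a, 'm) module" (structure) +
  assumes smult_closed: "\<lbrakk>a \<in> carrier A; x \<in> carrier M\<rbrakk> \<Longrightarrow> a \<odot>\<^bsub>M\<^esub> x \<in> carrier M"
    and smult_l_distr: "\<lbrakk>a \<in> carrier A; b \<in> carrier A; x \<in> carrier M\<rbrakk> \<Longrightarrow>
      (a \<oplus>\<^bsub>A\<^esub> b) \<odot>\<^bsub>M\<^esub> x = a \<odot>\<^bsub>M\<^esub> x \<oplus>\<^bsub>M\<^esub> b \<odot>\<^bsub>M\<^esub> x"
    and smult_r_distr: "\<lbrakk>a \<in> carrier A; x \<in> carrier M; y \<in> carrier M\<rbrakk> \<Longrightarrow>
      a \<odot>\<^bsub>M\<^esub> (x \<oplus>\<^bsub>M\<^esub> y) = a \<odot>\<^bsub>M\<^esub> x \<oplus>\<^bsub>M\<^esub> a \<odot>\<^bsub>M\<^esub> y"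
    and smult_assoc: "\<lbrakk>a \<in> carrier A; b \<in> carrier A; x \<in> carrier M\<rbrakk> \<Longrightarrow>
      (a \<otimes>\<^bsub>A\<^esub> b) \<odot>\<^bsub>M\<^esub> x = a \<odot>\<^bsub>M\<^esub> (b \<odot>\<^bsub>M\<^esub> x)"
    and smult_one: "x \<in> carrier M \<Longrightarrow> \<one>\<^bsub>A\<^esub> \<odot>\<^bsub>M\<^esub> x = x"

definition opposite_ring :: "('a, 'c) ring_scheme \<Rightarrow> ('a, 'c) ring_scheme" where
  "opposite_ring A = A\<lparr>monoid.mult := (\<lambda>x y. y \<otimes>\<^bsub>A\<^esub> x)\<rparr>"

definition regular_module :: "('a, 'c) ring_scheme \<Rightarrow> ('a, 'a) module" where
  "regular_module A = \<lparr>carrier = carrier A, monoid.mult = monoid.mult A, monoid.one = \<one>\<^bsub>A\<^esub>,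
     ring.zero = \<zero>\<^bsub>A\<^esub>, ring.add = ring.add A, smult = monoid.mult A\<rparr>"

text \<open>A left ideal \<open>H\<close> of \<open>A\<close> as a left module; for right ideals take \<open>opposite_ring A\<close>.\<close>

definition ideal_module :: "('a, 'c) ring_scheme \<Rightarrow> 'a set \<Rightarrow> ('a, 'a) module" where
  "ideal_module A H = (regular_module A)\<lparr>carrier := H\<rparr>"

definition module_hom ::
    "('a, 'c) ring_scheme \<Rightarrow> ('a, 'm) module \<Rightarrow> ('a, 'n) module \<Rightarrow> ('m \<Rightarrow> 'n) set" where
  "module_hom A M N = {f \<in> hom (add_monoid M) (add_monoid N).
     \<forall>a \<in> carrier A. \<forall>x \<in> carrier M. f (a \<odot>\<^bsub>M\<^esub> x) = a \<odot>\<^bsub>N\<^esub> f x}"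

definition isomorphic_modules ::
    "('a, 'c) ring_scheme \<Rightarrow> ('a, 'm) module \<Rightarrow> ('a, 'n) module \<Rightarrow> bool" where
  "isomorphic_modules A M N \<longleftrightarrow>
     (\<exists>f \<in> module_hom A M N. bij_betw f (carrier M) (carrier N))"

definition submodule_span :: "('a, 'c) ring_scheme \<Rightarrow> ('a, 'm) module \<Rightarrow> 'm set \<Rightarrow> 'm set" where
  "submodule_span A M S = \<Inter>{N. submodule N A M \<and> S \<subseteq> N}"

definition submodule_sum :: "('a, 'c) ring_scheme \<Rightarrow> ('a, 'm) module \<Rightarrow> 'm set set \<Rightarrow> 'm set" where
  "submodule_sum A M F = submodule_span A M (\<Union>F)"

definition internal_direct_sum ::
    "('a, 'c) ring_scheme \<Rightarrow> ('a, 'm) module \<Rightarrow> 'm set set \<Rightarrow> bool" where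
  "internal_direct_sum A M F \<longleftrightarrow>
     (\<forall>N \<in> F. submodule N A M) \<and> submodule_sum A M F = carrier M \<and>
     (\<forall>N \<in> F. N \<inter> submodule_sum A M (F - {N}) = {\<zero>\<^bsub>M\<^esub>})"

definition direct_sum_of_at_most ::
    "('a, 'c) ring_scheme \<Rightarrow> nat \<Rightarrow> ('a, 'n) module set \<Rightarrow> ('a, 'm) module \<Rightarrow> bool" where
  "direct_sum_of_at_most A n \<C> M \<longleftrightarrow>
     (\<exists>F. finite F \<and> card F \<le> n \<and> internal_direct_sum A M F \<and>
        (\<forall>N \<in> F. \<exists>C \<in> \<C>. isomorphic_modules A (M\<lparr>carrier := N\<rparr>) C))"

definition maximal_submodule :: "'m set \<Rightarrow> ('a, 'c) ring_scheme \<Rightarrow> ('a, 'm) module \<Rightarrow> bool" where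
  "maximal_submodule N A M \<longleftrightarrow> submodule N A M \<and> N \<noteq> carrier M \<and>
     (\<forall>K. submodule K A M \<and> N \<subseteq> K \<longrightarrow> K = N \<or> K = carrier M)"

definition simple_submodule :: "'m set \<Rightarrow> ('a, 'c) ring_scheme \<Rightarrow> ('a, 'm) module \<Rightarrow> bool" where
  "simple_submodule N A M \<longleftrightarrow> submodule N A M \<and> N \<noteq> {\<zero>\<^bsub>M\<^esub>} \<and>
     (\<forall>K. submodule K A M \<and> K \<subseteq> N \<longrightarrow> K = {\<zero>\<^bsub>M\<^esub>} \<or> K = N)"

text \<open>With this convention the radical of a module without maximal submodules is the module.\<close>

definition module_radical :: "('a, 'c) ring_scheme \<Rightarrow> ('a, 'm) module \<Rightarrow> 'm set" where
  "module_radical A M = carrier M \<inter> \<Inter>{N. maximal_submodule N A M}"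

definition module_socle :: "('a, 'c) ring_scheme \<Rightarrow> ('a, 'm) module \<Rightarrow> 'm set" where
  "module_socle A M = submodule_sum A M {N. simple_submodule N A M}"

definition local_module :: "('a, 'c) ring_scheme \<Rightarrow> ('a, 'm) module \<Rightarrow> bool" where
  "local_module A M \<longleftrightarrow> (\<exists>!N. maximal_submodule N A M)"

definition uniserial_module :: "('a, 'c) ring_scheme \<Rightarrow> ('a, 'm) module \<Rightarrow> bool" where
  "uniserial_module A M \<longleftrightarrow>
     (\<forall>K L. submodule K A M \<and> submodule L A M \<longrightarrow> K \<subseteq> L \<or> L \<subseteq> K)"

definition biserial_module :: "('a, 'c) ring_scheme \<Rightarrow> ('a, 'm) module \<Rightarrow> bool" where
  "biserial_module A M \<longleftrightarrow>
     (\<exists>L N. submodule L A M \<and> submodule N A M \<and>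
        uniserial_module A (M\<lparr>carrier := L\<rparr>) \<and> uniserial_module A (M\<lparr>carrier := N\<rparr>) \<and>
        (L <+>\<^bsub>M\<^esub> N = carrier M \<or>
         L <+>\<^bsub>M\<^esub> N = module_radical A M \<and>
           (\<forall>K. maximal_submodule K A M \<longleftrightarrow> K = module_radical A M)) \<and>
        (L \<inter> N = {\<zero>\<^bsub>M\<^esub>} \<or>
         L \<inter> N = module_socle A M \<and>
           (\<forall>K. simple_submodule K A M \<longleftrightarrow> K = module_socle A M)))"

definition finitely_generated_module :: "('a, 'c) ring_scheme \<Rightarrow> ('a, 'm) module \<Rightarrow> bool" where
  "finitely_generated_module A M \<longleftrightarrow>
     left_module A M \<and> (\<exists>S \<subseteq> carrier M. finite S \<and> submodule_span A M S = carrier M)"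

definition noetherian_module :: "('a, 'c) ring_scheme \<Rightarrow> ('a, 'm) module \<Rightarrow> bool" where
  "noetherian_module A M \<longleftrightarrow> left_module A M \<and>
     (\<forall>N. submodule N A M \<longrightarrow> finitely_generated_module A (M\<lparr>carrier := N\<rparr>))"

definition artinian_module :: "('a, 'c) ring_scheme \<Rightarrow> ('a, 'm) module \<Rightarrow> bool" where
  "artinian_module A M \<longleftrightarrow> left_module A M \<and>
     (\<forall>N :: nat \<Rightarrow> 'm set. (\<forall>i. submodule (N i) A M \<and> N (Suc i) \<subseteq> N i) \<longrightarrow>
        (\<exists>n. \<forall>i \<ge> n. N i = N n))"

definition semisimple_module :: "('a, 'c) ring_scheme \<Rightarrow> ('a, 'm) module \<Rightarrow> bool" where
  "semisimple_module A M \<longleftrightarrow> left_module A M \<and> module_socle A M = carrier M"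

definition indecomposable_module :: "('a, 'c) ring_scheme \<Rightarrow> ('a, 'm) module \<Rightarrow> bool" where
  "indecomposable_module A M \<longleftrightarrow> left_module A M \<and> carrier M \<noteq> {\<zero>\<^bsub>M\<^esub>} \<and>
     (\<forall>K L. submodule K A M \<and> submodule L A M \<and>
        K <+>\<^bsub>M\<^esub> L = carrier M \<and> K \<inter> L = {\<zero>\<^bsub>M\<^esub>} \<longrightarrow> K = {\<zero>\<^bsub>M\<^esub>} \<or> L = {\<zero>\<^bsub>M\<^esub>})"

text \<open>
  Projectivity is the lifting property along surjections \<open>g: M \<rightarrow> N\<close>.  A definition cannot quantify
  over types, so the elements of \<open>N\<close> and \<open>M\<close> are taken in \<open>'m\<close> and \<open>'m \<Rightarrow> 'a\<close>.  This loses
  nothing: \<open>N\<close> can then be \<open>P\<close> itself and \<open>M\<close> the free module of finitely supported functions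
  on \<open>carrier P\<close>, so \<open>P\<close> is a direct summand of a free module and lifts along all surjections,
  whatever the types of their elements.
\<close>

definition projective_module :: "('a, 'c) ring_scheme \<Rightarrow> ('a, 'm) module \<Rightarrow> bool" where
  "projective_module A P \<longleftrightarrow> left_module A P \<and>
     (\<forall>(M :: ('a, 'm \<Rightarrow> 'a) module) (N :: ('a, 'm) module) g f.
        left_module A M \<and> left_module A N \<and>
        g \<in> module_hom A M N \<and> g ` carrier M = carrier N \<and> f \<in> module_hom A P N \<longrightarrow>
        (\<exists>h \<in> module_hom A P M. \<forall>x \<in> carrier P. g (h x) = f x))"

definition superfluous_submodule :: "'m set \<Rightarrow> ('a, 'c) ring_scheme \<Rightarrow> ('a, 'm) module \<Rightarrow> bool" where
  "superfluous_submodule K A M \<longleftrightarrow> submodule K A M \<and>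
     (\<forall>N. submodule N A M \<and> K <+>\<^bsub>M\<^esub> N = carrier M \<longrightarrow> N = carrier M)"

definition projective_cover ::
    "('a, 'c) ring_scheme \<Rightarrow> ('a, 'm) module \<Rightarrow> ('m \<Rightarrow> 'n) \<Rightarrow> ('a, 'n) module \<Rightarrow> bool" where
  "projective_cover A P \<pi> M \<longleftrightarrow> projective_module A P \<and> left_module A M \<and>
     \<pi> \<in> module_hom A P M \<and> \<pi> ` carrier P = carrier M \<and>
     superfluous_submodule (a_kernel P M \<pi>) A P"


section \<open>Rings\<close>

definition noetherian_local_ring :: "('r, 'c) ring_scheme \<Rightarrow> 'r set \<Rightarrow> bool" where
  "noetherian_local_ring R \<mm> \<longleftrightarrow> cring R \<and> noetherian_ring R \<and>
     (\<forall>M. maximalideal M R \<longleftrightarrow> M = \<mm>)"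

definition jacobson_radical :: "('a, 'c) ring_scheme \<Rightarrow> 'a set" where
  "jacobson_radical A = module_radical A (regular_module A)"

text \<open>
  The locale \<open>noetherian_ring\<close> of HOL-Algebra constrains two-sided ideals only, which is too weak
  for noncommutative rings.
\<close>

definition two_sided_noetherian :: "('a, 'c) ring_scheme \<Rightarrow> bool" where
  "two_sided_noetherian A \<longleftrightarrow> ring A \<and> noetherian_module A (regular_module A) \<and>
     noetherian_module (opposite_ring A) (regular_module (opposite_ring A))"

definition semisimple_artinian_ring :: "('a, 'c) ring_scheme \<Rightarrow> bool" where
  "semisimple_artinian_ring A \<longleftrightarrow> ring A \<and> semisimple_module A (regular_module A) \<and>
     artinian_module A (regular_module A) \<and>
     artinian_module (opposite_ring A) (regular_module (opposite_ring A))"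

definition semiperfect_ring :: "('a, 'c) ring_scheme \<Rightarrow> bool" where
  "semiperfect_ring A \<longleftrightarrow> ring A \<and> semisimple_artinian_ring (A Quot jacobson_radical A) \<and>
     (\<forall>x \<in> carrier A. x \<otimes>\<^bsub>A\<^esub> x \<ominus>\<^bsub>A\<^esub> x \<in> jacobson_radical A \<longrightarrow>
        (\<exists>e \<in> carrier A. e \<otimes>\<^bsub>A\<^esub> e = e \<and> e \<ominus>\<^bsub>A\<^esub> x \<in> jacobson_radical A))"

text \<open>
  The first argument fixes the type of the elements of the projective modules considered; it is
  meant to be used with a type variable, so that it ranges over all types.
\<close>

definition biserial_ring :: "'m itself \<Rightarrow> ('a, 'c) ring_scheme \<Rightarrow> bool" where
  "biserial_ring ty A \<longleftrightarrow> two_sided_noetherian A \<and> semiperfect_ring A \<and>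
     (\<forall>P :: ('a, 'm) module. projective_module A P \<and> indecomposable_module A P \<longrightarrow>
        biserial_module A P) \<and>
     (\<forall>P :: ('a, 'm) module. projective_module (opposite_ring A) P \<and>
        indecomposable_module (opposite_ring A) P \<longrightarrow> biserial_module (opposite_ring A) P)"


section \<open>Path algebras\<close>

text \<open>
  A finite quiver is a \<open>fin_digraph\<close>.  The path \<open>a\<^sub>n\<cdots>a\<^sub>1\<close> is \<open>Arrows [a\<^sub>n, \<dots>, a\<^sub>1]\<close>, so that the left
  arrow is the first element of the list and the right arrow the last; \<open>Arrows []\<close> is
  not a path.  A path \<open>p\<close> is nontrivial iff \<open>arrows p \<noteq> []\<close>.
\<close>

datatype ('v, 'e) quiver_path = Triv 'v | Arrows (arrows: "'e list")
  where "arrows (Triv v) = []"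

definition paths :: "('v, 'e) pre_digraph \<Rightarrow> ('v, 'e) quiver_path set" where
  "paths Q = Triv ` verts Q \<union>
     {Arrows as | as. as \<noteq> [] \<and> set as \<subseteq> arcs Q \<and> successively (\<lambda>b a. tail Q b = head Q a) as}"

fun path_head :: "('v, 'e) pre_digraph \<Rightarrow> ('v, 'e) quiver_path \<Rightarrow> 'v" where
  "path_head Q (Triv v) = v"
| "path_head Q (Arrows as) = head Q (hd as)"

fun path_tail :: "('v, 'e) pre_digraph \<Rightarrow> ('v, 'e) quiver_path \<Rightarrow> 'v" where
  "path_tail Q (Triv v) = v"
| "path_tail Q (Arrows as) = tail Q (last as)"

abbreviation path_length :: "('v, 'e) quiver_path \<Rightarrow> nat" where
  "path_length p \<equiv> length (arrows p)"

definition left_arrow :: "('v, 'e) quiver_path \<Rightarrow> 'e" where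
  "left_arrow p = List.hd (arrows p)"

definition right_arrow :: "('v, 'e) quiver_path \<Rightarrow> 'e" where
  "right_arrow p = List.last (arrows p)"

text \<open>Only meaningful when the tail of \<open>p\<close> is the head of \<open>q\<close>.\<close>

fun path_comp :: "('v, 'e) quiver_path \<Rightarrow> ('v, 'e) quiver_path \<Rightarrow> ('v, 'e) quiver_path" where
  "path_comp (Triv v) q = q"
| "path_comp (Arrows as) (Triv v) = Arrows as"
| "path_comp (Arrows as) (Arrows bs) = Arrows (as @ bs)"

text \<open>
  Elements of the path algebra are finitely supported coefficient functions on paths.  A path has
  only finitely many factorizations, so the sum defining the product is finite.
\<close>

definition path_algebra ::
    "('r, 'c) ring_scheme \<Rightarrow> ('v, 'e) pre_digraph \<Rightarrow> ('r, ('v, 'e) quiver_path \<Rightarrow> 'r) module" where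
  "path_algebra R Q =
     \<lparr>carrier = {f. (\<forall>p \<in> paths Q. f p \<in> carrier R) \<and> (\<forall>p. p \<notin> paths Q \<longrightarrow> f p = \<zero>\<^bsub>R\<^esub>) \<and>
        finite {p. f p \<noteq> \<zero>\<^bsub>R\<^esub>}},
      monoid.mult = (\<lambda>f g r. finsum R (\<lambda>(p, q). f p \<otimes>\<^bsub>R\<^esub> g q)
        {(p, q). p \<in> paths Q \<and> q \<in> paths Q \<and> path_tail Q p = path_head Q q \<and> path_comp p q = r}),
      monoid.one = (\<lambda>p. if p \<in> Triv ` verts Q then \<one>\<^bsub>R\<^esub> else \<zero>\<^bsub>R\<^esub>),
      ring.zero = (\<lambda>p. \<zero>\<^bsub>R\<^esub>),
      ring.add = (\<lambda>f g p. f p \<oplus>\<^bsub>R\<^esub> g p),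
      smult = (\<lambda>c f p. c \<otimes>\<^bsub>R\<^esub> f p)\<rparr>"

definition path_elt :: "('r, 'c) ring_scheme \<Rightarrow> ('v, 'e) quiver_path \<Rightarrow> ('v, 'e) quiver_path \<Rightarrow> 'r"
  where "path_elt R p = (\<lambda>q. if q = p then \<one>\<^bsub>R\<^esub> else \<zero>\<^bsub>R\<^esub>)"

definition quotient_algebra :: "('r, 'a) module \<Rightarrow> 'a set \<Rightarrow> ('r, 'a set) module" where
  "quotient_algebra A I = \<lparr>carrier = carrier (A Quot I), monoid.mult = monoid.mult (A Quot I),
     monoid.one = monoid.one (A Quot I), ring.zero = ring.zero (A Quot I),
     ring.add = ring.add (A Quot I), smult = (\<lambda>c H. \<Union>x \<in> H. I +>\<^bsub>A\<^esub> (c \<odot>\<^bsub>A\<^esub> x))\<rparr>"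

definition path_quotient :: "('r, 'c) ring_scheme \<Rightarrow> ('v, 'e) pre_digraph \<Rightarrow>
    (('v, 'e) quiver_path \<Rightarrow> 'r) set \<Rightarrow> ('r, (('v, 'e) quiver_path \<Rightarrow> 'r) set) module" where
  "path_quotient R Q I = quotient_algebra (path_algebra R Q) I"

definition path_coset :: "('r, 'c) ring_scheme \<Rightarrow> ('v, 'e) pre_digraph \<Rightarrow>
    (('v, 'e) quiver_path \<Rightarrow> 'r) set \<Rightarrow> ('v, 'e) quiver_path \<Rightarrow> (('v, 'e) quiver_path \<Rightarrow> 'r) set"
  where "path_coset R Q I p = I +>\<^bsub>path_algebra R Q\<^esub> path_elt R p"

definition admissible_path :: "('r, 'c) ring_scheme \<Rightarrow> ('v, 'e) pre_digraph \<Rightarrow>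
    (('v, 'e) quiver_path \<Rightarrow> 'r) set \<Rightarrow> ('v, 'e) quiver_path \<Rightarrow> bool" where
  "admissible_path R Q I p \<longleftrightarrow> p \<in> paths Q \<and> path_elt R p \<notin> I"

definition inadmissible_path :: "('r, 'c) ring_scheme \<Rightarrow> ('v, 'e) pre_digraph \<Rightarrow>
    (('v, 'e) quiver_path \<Rightarrow> 'r) set \<Rightarrow> ('v, 'e) quiver_path \<Rightarrow> bool" where
  "inadmissible_path R Q I p \<longleftrightarrow> p \<in> paths Q \<and> path_elt R p \<in> I"

text \<open>The left ideal \<open>\<Lambda>p\<close> and the right ideal \<open>p\<Lambda>\<close>, where \<open>\<Lambda> = path_quotient R Q I\<close>.\<close>

definition left_path_ideal :: "('r, 'c) ring_scheme \<Rightarrow> ('v, 'e) pre_digraph \<Rightarrow>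
    (('v, 'e) quiver_path \<Rightarrow> 'r) set \<Rightarrow> ('v, 'e) quiver_path \<Rightarrow> (('v, 'e) quiver_path \<Rightarrow> 'r) set set"
  where "left_path_ideal R Q I p =
    carrier (path_quotient R Q I) #>\<^bsub>path_quotient R Q I\<^esub> path_coset R Q I p"

definition right_path_ideal :: "('r, 'c) ring_scheme \<Rightarrow> ('v, 'e) pre_digraph \<Rightarrow>
    (('v, 'e) quiver_path \<Rightarrow> 'r) set \<Rightarrow> ('v, 'e) quiver_path \<Rightarrow> (('v, 'e) quiver_path \<Rightarrow> 'r) set set"
  where "right_path_ideal R Q I p =
    path_coset R Q I p <#\<^bsub>path_quotient R Q I\<^esub> carrier (path_quotient R Q I)"

text \<open>
  An admissible \<open>q\<close> of minimal length such that \<open>qp\<close> is inadmissible.  Lengths are compared along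
  \<open>q\<close>: no shorter right factor \<open>q'\<close> of \<open>q\<close> has \<open>q'p\<close> inadmissible.  They must not be compared among
  all such \<open>q\<close>: up to two arrows start at the head of \<open>p\<close>, and the minimal \<open>q\<close> with these right
  arrows may have different lengths.
\<close>

definition minimal_left_annihilating_path :: "('r, 'c) ring_scheme \<Rightarrow> ('v, 'e) pre_digraph \<Rightarrow>
    (('v, 'e) quiver_path \<Rightarrow> 'r) set \<Rightarrow> ('v, 'e) quiver_path \<Rightarrow> ('v, 'e) quiver_path \<Rightarrow> bool" where
  "minimal_left_annihilating_path R Q I p q \<longleftrightarrow>
     admissible_path R Q I q \<and> path_tail Q q = path_head Q p \<and>
     inadmissible_path R Q I (path_comp q p) \<and>
     (\<forall>r \<in> paths Q. \<forall>q' \<in> paths Q.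
        path_tail Q r = path_head Q q' \<and> path_comp r q' = q \<and> path_length q' < path_length q \<longrightarrow>
        \<not> inadmissible_path R Q I (path_comp q' p))"

definition minimal_right_annihilating_path :: "('r, 'c) ring_scheme \<Rightarrow> ('v, 'e) pre_digraph \<Rightarrow>
    (('v, 'e) quiver_path \<Rightarrow> 'r) set \<Rightarrow> ('v, 'e) quiver_path \<Rightarrow> ('v, 'e) quiver_path \<Rightarrow> bool" where
  "minimal_right_annihilating_path R Q I p q \<longleftrightarrow>
     admissible_path R Q I q \<and> path_tail Q p = path_head Q q \<and>
     inadmissible_path R Q I (path_comp p q) \<and>
     (\<forall>q' \<in> paths Q. \<forall>r \<in> paths Q.
        path_tail Q q' = path_head Q r \<and> path_comp q' r = q \<and> path_length q' < path_length q \<longrightarrow>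
        \<not> inadmissible_path R Q I (path_comp p q'))"


section \<open>String algebras\<close>

definition arrow_radical :: "('r, 'c) ring_scheme \<Rightarrow> ('v, 'e) pre_digraph \<Rightarrow>
    (('v, 'e) quiver_path \<Rightarrow> 'r) set \<Rightarrow> bool" where
  "arrow_radical R Q I \<longleftrightarrow>
     (let \<Lambda> = path_quotient R Q I; \<Lambda>op = opposite_ring \<Lambda>
      in \<forall>v \<in> verts Q.
        local_module \<Lambda> (ideal_module \<Lambda> (left_path_ideal R Q I (Triv v))) \<and>
        module_radical \<Lambda> (ideal_module \<Lambda> (left_path_ideal R Q I (Triv v))) =
          submodule_sum \<Lambda> (regular_module \<Lambda>)
            {left_path_ideal R Q I (Arrows [a]) | a. a \<in> arcs Q \<and> tail Q a = v} \<and>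
        local_module \<Lambda>op (ideal_module \<Lambda>op (right_path_ideal R Q I (Triv v))) \<and>
        module_radical \<Lambda>op (ideal_module \<Lambda>op (right_path_ideal R Q I (Triv v))) =
          submodule_sum \<Lambda>op (regular_module \<Lambda>op)
            {right_path_ideal R Q I (Arrows [a]) | a. a \<in> arcs Q \<and> head Q a = v})"

definition arrow_direct :: "('r, 'c) ring_scheme \<Rightarrow> ('v, 'e) pre_digraph \<Rightarrow>
    (('v, 'e) quiver_path \<Rightarrow> 'r) set \<Rightarrow> bool" where
  "arrow_direct R Q I \<longleftrightarrow>
     (let \<Lambda> = path_quotient R Q I; \<Lambda>op = opposite_ring \<Lambda>
      in \<forall>a \<in> arcs Q.
        left_path_ideal R Q I (Arrows [a]) \<inter> submodule_sum \<Lambda> (regular_module \<Lambda>)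
          {left_path_ideal R Q I (Arrows [b]) | b. b \<in> arcs Q \<and> b \<noteq> a \<and> tail Q b = tail Q a}
          = {\<zero>\<^bsub>\<Lambda>\<^esub>} \<and>
        right_path_ideal R Q I (Arrows [a]) \<inter> submodule_sum \<Lambda>op (regular_module \<Lambda>op)
          {right_path_ideal R Q I (Arrows [b]) | b. b \<in> arcs Q \<and> b \<noteq> a \<and> head Q b = head Q a}
          = {\<zero>\<^bsub>\<Lambda>\<^esub>})"

definition permissible :: "('r, 'c) ring_scheme \<Rightarrow> ('v, 'e) pre_digraph \<Rightarrow>
    (('v, 'e) quiver_path \<Rightarrow> 'r) set \<Rightarrow> bool" where
  "permissible R Q I \<longleftrightarrow> (\<forall>a \<in> arcs Q. path_elt R (Arrows [a]) \<notin> I)"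

definition special :: "('r, 'c) ring_scheme \<Rightarrow> ('v, 'e) pre_digraph \<Rightarrow>
    (('v, 'e) quiver_path \<Rightarrow> 'r) set \<Rightarrow> bool" where
  "special R Q I \<longleftrightarrow> (\<forall>b \<in> arcs Q.
     (\<exists>\<^sub>\<le>\<^sub>1 a. a \<in> arcs Q \<and> tail Q a = head Q b \<and> path_elt R (Arrows [a, b]) \<notin> I) \<and>
     (\<exists>\<^sub>\<le>\<^sub>1 c. c \<in> arcs Q \<and> head Q c = tail Q b \<and> path_elt R (Arrows [b, c]) \<notin> I))"

definition string_algebra :: "('r, 'c) ring_scheme \<Rightarrow> ('v, 'e) pre_digraph \<Rightarrow>
    (('v, 'e) quiver_path \<Rightarrow> 'r) set \<Rightarrow> bool" where
  "string_algebra R Q I \<longleftrightarrow> cring R \<and> fin_digraph Q \<and> ideal I (path_algebra R Q) \<and>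
     finitely_generated_module R (path_quotient R Q I) \<and>
     (\<forall>v \<in> verts Q. in_degree Q v \<le> 2 \<and> out_degree Q v \<le> 2) \<and>
     arrow_radical R Q I \<and> arrow_direct R Q I \<and> permissible R Q I \<and> special R Q I"

end

theory Submission
  imports Defs
begin

text \<open>
  The ideal \<open>J\<close> spanned by the nontrivial paths is the Jacobson radical of \<open>\<Lambda>\<close>, and \<open>\<Lambda>e\<^sub>v = Re\<^sub>v + Je\<^sub>v\<close>; so an
  element outside \<open>J\<close> can be multiplied to some \<open>e\<^sub>v\<close>, and \<open>\<Lambda>/J\<close> is a finite product of copies of the residue
  field.  Specialness makes the nonzero paths with right arrow \<open>a\<close> a single sequence
  \<open>x\<^sub>0 = a, x\<^sub>1, x\<^sub>2, \<dots>\<close> with \<open>Jx\<^sub>n = \<Lambda>x\<^sub>n\<^sub>+\<^sub>1\<close>, and a Krull type argument, in which finite generation over \<open>R\<close>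
  is essential, gives \<open>\<Inter>\<Lambda>x\<^sub>n = 0\<close>.  Hence the submodules of \<open>\<Lambda>a\<close> are \<open>0\<close> and the \<open>\<Lambda>x\<^sub>n\<close>, and \<open>Je\<^sub>v\<close> is a direct sum
  of at most two such uniserial modules.
  
  A nonzero projective module has, by Nakayama's lemma, a dual basis coordinate with a value outside \<open>J\<close>,
  which splits off a summand \<open>\<Lambda>e\<^sub>v\<close>; so the indecomposable projectives are the \<open>\<Lambda>e\<^sub>v\<close>, and these are also the
  projective covers of the \<open>\<Lambda>p\<close>.  In the annihilator of \<open>p\<close> inside \<open>Je\<^sub>v = \<Lambda>b \<oplus> \<Lambda>c\<close>, specialness forces \<open>bp = 0\<close> or
  \<open>cp = 0\<close>, so the annihilator is the sum of its intersections with \<open>\<Lambda>b\<close> and \<open>\<Lambda>c\<close>, each \<open>0\<close> or some \<open>\<Lambda>q\<close>.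
\<close>

section \<open>Modules over noncommutative rings\<close>

text \<open>The ground ring need not be artinian or complete, so \<open>J\<close> need not be
  nilpotent and a sequence \<open>x n\<close> need not reach zero; the algebra is not commutative
  either, so Krull's intersection theorem does not apply as it stands. The substitute asks whether
  some nonunit scalar moves \<open>x 0\<close> out of the intersection. If one does, the
  intersection lies in a set divisible by that scalar, and the chain condition makes the set zero.
  If none does, the terms of the chain live in a vector space of finite dimension over the residue
  field. For the same reason idempotents are not lifted by a limit process but by explicit sums of
  the \<open>e v\<close>.

  Everything is carried out in a ring with a distinguished central subset, where words replace
  paths. The algebra and its opposite are two instances of the same axioms, so each statement on
  right modules is a statement on left modules read in the other instance. Locality is therefore
  first brought into a form that favours neither side.

  Projective modules may be arbitrarily large. Each element has only finitely many nonzero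
  coordinates, so Nakayama's lemma is applied to one element at a time.\<close>

lemma mem_set_add_iff: "x \<in> N <+>\<^bsub>M\<^esub> K \<longleftrightarrow> (\<exists>n \<in> N. \<exists>k \<in> K. x = n \<oplus>\<^bsub>M\<^esub> k)"
  by (simp add: set_add_def set_mult_def)

lemma opposite_ring_simps [simp]:
  "carrier (opposite_ring A) = carrier A" "\<one>\<^bsub>opposite_ring A\<^esub> = \<one>\<^bsub>A\<^esub>"
  "\<zero>\<^bsub>opposite_ring A\<^esub> = \<zero>\<^bsub>A\<^esub>" "x \<oplus>\<^bsub>opposite_ring A\<^esub> y = x \<oplus>\<^bsub>A\<^esub> y"
  "x \<otimes>\<^bsub>opposite_ring A\<^esub> y = y \<otimes>\<^bsub>A\<^esub> x" "add_monoid (opposite_ring A) = add_monoid A"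
  "opposite_ring (opposite_ring A) = A"
  by (simp_all add: opposite_ring_def)

lemma opposite_ring_add [simp]: "ring.add (opposite_ring A) = ring.add A"
  by (simp add: opposite_ring_def)

lemma a_inv_opposite_ring [simp]: "a_inv (opposite_ring A) = a_inv A"
  by (simp add: a_inv_def)

lemma finsum_opposite_ring [simp]: "finsum (opposite_ring A) = finsum A"
  by (simp add: finsum_def fun_eq_iff)

lemma ring_opposite_ring: "ring A \<Longrightarrow> ring (opposite_ring A)"
proof -
  assume "ring A"
  then interpret ring A .
  show ?thesis
    by (intro ringI abelian_groupI monoidI)
      (auto simp: m_assoc l_distr r_distr a_assoc intro: a_comm l_neg exI[of _ "\<ominus>\<^bsub>A\<^esub> _"]
        bexI[of _ "\<ominus>\<^bsub>A\<^esub> _"])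
qed

section \<open>Submodules of a left module\<close>

context left_module
begin

lemma smult_l_null [simp]: "x \<in> carrier M \<Longrightarrow> \<zero>\<^bsub>A\<^esub> \<odot> x = \<zero>"
proof -
  assume x: "x \<in> carrier M"
  then have c: "\<zero>\<^bsub>A\<^esub> \<odot> x \<in> carrier M" by (simp add: smult_closed)
  have "\<zero>\<^bsub>A\<^esub> \<odot> x \<oplus> \<zero>\<^bsub>A\<^esub> \<odot> x = \<zero>\<^bsub>A\<^esub> \<odot> x"
    using smult_l_distr[of "\<zero>\<^bsub>A\<^esub>" "\<zero>\<^bsub>A\<^esub>" x] x by simp
  then show ?thesis
    using M.add.l_cancel_one[OF c c] by simp
qed

lemma smult_r_null [simp]: "a \<in> carrier A \<Longrightarrow> a \<odot> \<zero> = \<zero>"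
proof -
  assume a: "a \<in> carrier A"
  then have c: "a \<odot> \<zero> \<in> carrier M" by (simp add: smult_closed)
  have "a \<odot> \<zero> \<oplus> a \<odot> \<zero> = a \<odot> \<zero>"
    using smult_r_distr[of a "\<zero>" "\<zero>"] a by simp
  then show ?thesis
    using M.add.l_cancel_one[OF c c] by simp
qed

lemma smult_l_minus: "a \<in> carrier A \<Longrightarrow> x \<in> carrier M \<Longrightarrow> (\<ominus>\<^bsub>A\<^esub> a) \<odot> x = \<ominus> (a \<odot> x)"
proof -
  assume a: "a \<in> carrier A" "x \<in> carrier M"
  have "(\<ominus>\<^bsub>A\<^esub> a) \<odot> x \<oplus> a \<odot> x = \<zero>"
    using a by (simp add: smult_l_distr[symmetric] R.l_neg)
  then show ?thesis
    using a by (simp add: M.minus_equality smult_closed)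
qed

lemma smult_l_diff:
  "a \<in> carrier A \<Longrightarrow> b \<in> carrier A \<Longrightarrow> x \<in> carrier M \<Longrightarrow> (a \<ominus>\<^bsub>A\<^esub> b) \<odot> x = a \<odot> x \<ominus> b \<odot> x"
  by (simp add: R.minus_eq M.minus_eq smult_l_distr smult_l_minus)

text \<open>Additive inverses are multiples by minus one, so closure under them drops out of the
  criterion.\<close>

lemma submodule_iff:
  "submodule N A M \<longleftrightarrow> N \<subseteq> carrier M \<and> \<zero> \<in> N \<and> (\<forall>x \<in> N. \<forall>y \<in> N. x \<oplus> y \<in> N) \<and>
     (\<forall>a \<in> carrier A. \<forall>x \<in> N. a \<odot> x \<in> N)"
proof
  assume "submodule N A M"
  then interpret submodule N A M .
  show "N \<subseteq> carrier M \<and> \<zero> \<in> N \<and> (\<forall>x \<in> N. \<forall>y \<in> N. x \<oplus> y \<in> N) \<and>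
     (\<forall>a \<in> carrier A. \<forall>x \<in> N. a \<odot> x \<in> N)"
    using subset one_closed m_closed smult_closed by auto
next
  assume N: "N \<subseteq> carrier M \<and> \<zero> \<in> N \<and> (\<forall>x \<in> N. \<forall>y \<in> N. x \<oplus> y \<in> N) \<and>
     (\<forall>a \<in> carrier A. \<forall>x \<in> N. a \<odot> x \<in> N)"
  have "\<ominus> x \<in> N" if "x \<in> N" for x
    using N that smult_l_minus[of "\<one>\<^bsub>A\<^esub>" x] smult_one[of x]
    by (metis R.add.inv_closed R.one_closed subset_iff)
  then show "submodule N A M"
    using N by (auto intro!: submodule.intro subgroup.intro simp: submodule_axioms_def
        a_inv_def[symmetric])
qed

lemma submoduleD:
  assumes "submodule N A M"
  shows "N \<subseteq> carrier M" "\<zero> \<in> N" "\<And>x y. x \<in> N \<Longrightarrow> y \<in> N \<Longrightarrow> x \<oplus> y \<in> N"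
    "\<And>a x. a \<in> carrier A \<Longrightarrow> x \<in> N \<Longrightarrow> a \<odot> x \<in> N" "\<And>x. x \<in> N \<Longrightarrow> \<ominus> x \<in> N"
    "\<And>x y. x \<in> N \<Longrightarrow> y \<in> N \<Longrightarrow> x \<ominus> y \<in> N"
proof -
  show *: "N \<subseteq> carrier M" "\<zero> \<in> N" "\<And>x y. x \<in> N \<Longrightarrow> y \<in> N \<Longrightarrow> x \<oplus> y \<in> N"
    "\<And>a x. a \<in> carrier A \<Longrightarrow> x \<in> N \<Longrightarrow> a \<odot> x \<in> N"
    using assms submodule_iff by auto
  show **: "\<ominus> x \<in> N" if "x \<in> N" for x
    using * that smult_l_minus[of "\<one>\<^bsub>A\<^esub>" x] smult_one[of x]
    by (metis R.add.inv_closed R.one_closed subset_iff)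
  show "\<And>x y. x \<in> N \<Longrightarrow> y \<in> N \<Longrightarrow> x \<ominus> y \<in> N"
    using * ** by (simp add: M.minus_eq)
qed

lemma left_module_restrict:
  assumes "submodule N A M"
  shows "left_module A (M\<lparr>carrier := N\<rparr>)"
proof -
  note N = submoduleD[OF assms]
  have m: "x \<in> N \<Longrightarrow> x \<in> carrier M" for x using N(1) by auto
  have "abelian_group (M\<lparr>carrier := N\<rparr>)"
    by (rule abelian_groupI)
      (auto simp: N(2,3) m M.a_assoc intro!: M.a_comm bexI[OF _ N(5)] M.l_neg)
  then show ?thesis
    using R.ring_axioms
    by (auto simp: left_module_def left_module_axioms_def N(4) m smult_l_distr smult_r_distr
        smult_assoc smult_one)
qed

text \<open>With this, every question about an \<open>ideal_module\<close> or a restricted carrier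
  is settled in the ambient module.\<close>

lemma submodule_restrict_iff:
  assumes "submodule N A M"
  shows "submodule K A (M\<lparr>carrier := N\<rparr>) \<longleftrightarrow> submodule K A M \<and> K \<subseteq> N"
proof -
  interpret N: left_module A "M\<lparr>carrier := N\<rparr>" by (rule left_module_restrict[OF assms])
  show ?thesis
    using submoduleD(1)[OF assms] by (auto simp: submodule_iff N.submodule_iff)
qed

lemma submodule_zero: "submodule {\<zero>} A M"
  by (simp add: submodule_iff)

lemma submodule_carrier: "submodule (carrier M) A M"
  by (simp add: submodule_iff smult_closed)

lemma submodule_Inter: "F \<noteq> {} \<Longrightarrow> (\<And>N. N \<in> F \<Longrightarrow> submodule N A M) \<Longrightarrow> submodule (\<Inter>F) A M"
  unfolding submodule_iff by blast

lemma submodule_Int: "submodule N A M \<Longrightarrow> submodule K A M \<Longrightarrow> submodule (N \<inter> K) A M"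
  unfolding submodule_iff by blast

lemma submodule_set_add:
  assumes "submodule N A M" "submodule K A M"
  shows "submodule (N <+>\<^bsub>M\<^esub> K) A M"
proof -
  note N = submoduleD[OF assms(1)] and K = submoduleD[OF assms(2)]
  have m: "x \<in> N \<Longrightarrow> x \<in> carrier M" "x \<in> K \<Longrightarrow> x \<in> carrier M" for x using N(1) K(1) by auto
  have "\<exists>n' \<in> N. \<exists>k' \<in> K. (n1 \<oplus> k1) \<oplus> (n2 \<oplus> k2) = n' \<oplus> k'"
    if "n1 \<in> N" "k1 \<in> K" "n2 \<in> N" "k2 \<in> K" for n1 k1 n2 k2
    by (rule bexI[of _ "n1 \<oplus> n2"], rule bexI[of _ "k1 \<oplus> k2"])
      (use that in \<open>auto simp: m M.a_ac N K\<close>)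
  moreover have "\<exists>n' \<in> N. \<exists>k' \<in> K. a \<odot> (n \<oplus> k) = n' \<oplus> k'"
    if "a \<in> carrier A" "n \<in> N" "k \<in> K" for a n k
    using that by (metis K(4) N(4) m smult_r_distr)
  moreover have "\<exists>n' \<in> N. \<exists>k' \<in> K. \<zero> = n' \<oplus> k'"
    using N(2) K(2) by (metis M.l_zero M.zero_closed)
  moreover have "N <+>\<^bsub>M\<^esub> K \<subseteq> carrier M"
    using m by (auto simp: set_add_defs)
  ultimately show ?thesis
    unfolding submodule_iff set_add_defs by auto
qed

lemma set_add_upper:
  assumes "submodule N A M" "submodule K A M"
  shows "N \<subseteq> N <+>\<^bsub>M\<^esub> K" "K \<subseteq> N <+>\<^bsub>M\<^esub> K"
proof -
  note N = submoduleD[OF assms(1)] and K = submoduleD[OF assms(2)]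
  have "x \<in> N <+>\<^bsub>M\<^esub> K" if "x \<in> N" for x
    unfolding set_add_defs using that N(1) K(2) M.r_zero[of x] by fastforce
  then show "N \<subseteq> N <+>\<^bsub>M\<^esub> K" by blast
  have "x \<in> N <+>\<^bsub>M\<^esub> K" if "x \<in> K" for x
    unfolding set_add_defs using that K(1) N(2) M.l_zero[of x] by fastforce
  then show "K \<subseteq> N <+>\<^bsub>M\<^esub> K" by blast
qed

lemma set_add_least:
  assumes "submodule L A M" "N \<subseteq> L" "K \<subseteq> L"
  shows "N <+>\<^bsub>M\<^esub> K \<subseteq> L"
  using submoduleD(3)[OF assms(1)] assms(2,3) by (auto simp: set_add_defs)

lemma submodule_span_submodule: "S \<subseteq> carrier M \<Longrightarrow> submodule (submodule_span A M S) A M"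
  unfolding submodule_span_def by (rule submodule_Inter) (use submodule_carrier in auto)

lemma submodule_span_superset: "S \<subseteq> submodule_span A M S"
  by (auto simp: submodule_span_def)

lemma submodule_span_least: "submodule N A M \<Longrightarrow> S \<subseteq> N \<Longrightarrow> submodule_span A M S \<subseteq> N"
  by (auto simp: submodule_span_def)

definition cyclic :: "'m \<Rightarrow> 'm set" where
  "cyclic x = {a \<odot> x | a. a \<in> carrier A}"

lemma cyclic_submodule: "x \<in> carrier M \<Longrightarrow> submodule (cyclic x) A M"
  unfolding submodule_iff cyclic_def
proof (intro conjI ballI)
  assume x: "x \<in> carrier M"
  show "{a \<odot> x |a. a \<in> carrier A} \<subseteq> carrier M" using x smult_closed by auto
  show "\<zero> \<in> {a \<odot> x |a. a \<in> carrier A}" using smult_l_null[OF x] by force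
  show "y \<oplus> z \<in> {a \<odot> x |a. a \<in> carrier A}"
    if "y \<in> {a \<odot> x |a. a \<in> carrier A}" "z \<in> {a \<odot> x |a. a \<in> carrier A}" for y z
  proof -
    from that obtain a b where "a \<in> carrier A" "b \<in> carrier A" "y \<oplus> z = (a \<oplus>\<^bsub>A\<^esub> b) \<odot> x"
      using smult_l_distr[OF _ _ x] by auto
    then show ?thesis by blast
  qed
  show "b \<odot> y \<in> {a \<odot> x |a. a \<in> carrier A}"
    if "b \<in> carrier A" "y \<in> {a \<odot> x |a. a \<in> carrier A}" for b y
  proof -
    from that obtain a where "a \<in> carrier A" "b \<odot> y = (b \<otimes>\<^bsub>A\<^esub> a) \<odot> x"
      using smult_assoc[OF _ _ x] by auto
    then show ?thesis using that(1) by blast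
  qed
qed

lemma cyclic_self: "x \<in> carrier M \<Longrightarrow> x \<in> cyclic x"
  unfolding cyclic_def using smult_one by (metis (mono_tags, lifting) R.one_closed mem_Collect_eq)

lemma cyclic_least: "submodule N A M \<Longrightarrow> x \<in> N \<Longrightarrow> cyclic x \<subseteq> N"
  by (auto simp: cyclic_def submoduleD(4))

text \<open>Zero summands are dropped because each summand will have to be isomorphic to a member of
  a prescribed class, and the zero module need not be one.\<close>

lemma internal_direct_sum_pair:
  assumes N: "submodule N1 A M" "submodule N2 A M" and i: "N1 \<inter> N2 = {\<zero>}" and s: "N1 <+>\<^bsub>M\<^esub> N2 = carrier M"
  shows "internal_direct_sum A M ({N1, N2} - {{\<zero>}})"
proof -
  let ?F = "{N1, N2} - {{\<zero>}}"
  have U: "\<Union>?F \<subseteq> carrier M" using N[THEN submoduleD(1)] by auto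
  have 0: "\<zero> \<in> submodule_span A M S" if "S \<subseteq> carrier M" for S
    using submoduleD(2)[OF submodule_span_submodule[OF that]] .
  have "N1 \<subseteq> submodule_span A M (\<Union>?F)" "N2 \<subseteq> submodule_span A M (\<Union>?F)"
    using submodule_span_superset[of "\<Union>?F"] 0[OF U] by blast+
  then have "submodule_sum A M ?F = carrier M"
    using set_add_least[OF submodule_span_submodule[OF U]] s submodule_span_submodule[OF U]
    unfolding submodule_sum_def by (metis submoduleD(1) subset_antisym)
  moreover have "N \<inter> submodule_sum A M (?F - {N}) = {\<zero>}" if "N \<in> ?F" for N
  proof -
    \<comment> \<open>Equal summands would coincide with their intersection and so be zero, and then
      the family would be empty.\<close>
    have "N1 \<noteq> N2" using that i by auto
    then have "\<exists>N'. submodule N' A M \<and> N \<inter> N' = {\<zero>} \<and> \<Union>(?F - {N}) \<subseteq> N'"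
      using that N i by (cases "N = N1") (auto simp: Int_commute)
    then obtain N' where N': "submodule N' A M" "N \<inter> N' = {\<zero>}" "\<Union>(?F - {N}) \<subseteq> N'"
      by blast
    have "\<zero> \<in> submodule_span A M (\<Union>(?F - {N}))"
      by (rule 0) (use U in blast)
    moreover have "\<zero> \<in> N" using N' by auto
    ultimately show ?thesis
      using submodule_span_least[OF N'(1,3)] N'(2) unfolding submodule_sum_def by blast
  qed
  ultimately show ?thesis
    using N unfolding internal_direct_sum_def by auto
qed

lemma direct_sum_of_at_most_2I:
  assumes "submodule N1 A M" "submodule N2 A M" "N1 \<inter> N2 = {\<zero>}" "N1 <+>\<^bsub>M\<^esub> N2 = carrier M"
    and "N1 \<noteq> {\<zero>} \<Longrightarrow> \<exists>C \<in> \<C>. isomorphic_modules A (M\<lparr>carrier := N1\<rparr>) C"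
    and "N2 \<noteq> {\<zero>} \<Longrightarrow> \<exists>C \<in> \<C>. isomorphic_modules A (M\<lparr>carrier := N2\<rparr>) C"
  shows "direct_sum_of_at_most A 2 \<C> M"
proof -
  have "card ({N1, N2} - {{\<zero>}}) \<le> card {N1, N2}" by (rule card_mono) auto
  also have "\<dots> \<le> 2" by (cases "N1 = N2") auto
  finally show ?thesis
    using internal_direct_sum_pair[OF assms(1-4)] assms(5,6)
    unfolding direct_sum_of_at_most_def by (intro exI[of _ "{N1, N2} - {{\<zero>}}"]) auto
qed

end

lemma left_module_regular: "ring A \<Longrightarrow> left_module A (regular_module A)"
proof -
  assume "ring A"
  then interpret ring A .
  have "abelian_group (regular_module A)"
    by (rule abelian_groupI) (auto simp: regular_module_def a_assoc intro!: a_comm bexI[of _ "\<ominus>\<^bsub>A\<^esub> _"] l_neg)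
  then show ?thesis
    using ring_axioms
    by (auto simp: left_module_def left_module_axioms_def regular_module_def l_distr r_distr m_assoc)
qed

lemma regular_module_simps [simp]:
  "carrier (regular_module A) = carrier A" "\<zero>\<^bsub>regular_module A\<^esub> = \<zero>\<^bsub>A\<^esub>"
  "x \<oplus>\<^bsub>regular_module A\<^esub> y = x \<oplus>\<^bsub>A\<^esub> y" "x \<odot>\<^bsub>regular_module A\<^esub> y = x \<otimes>\<^bsub>A\<^esub> y"
  by (simp_all add: regular_module_def)

lemma ideal_module_simps [simp]:
  "carrier (ideal_module A H) = H" "\<zero>\<^bsub>ideal_module A H\<^esub> = \<zero>\<^bsub>A\<^esub>"
  "x \<oplus>\<^bsub>ideal_module A H\<^esub> y = x \<oplus>\<^bsub>A\<^esub> y" "x \<odot>\<^bsub>ideal_module A H\<^esub> y = x \<otimes>\<^bsub>A\<^esub> y"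
  by (simp_all add: regular_module_def ideal_module_def)

section \<open>Ascending chain condition on submodules\<close>

definition acc_module :: "('a, 'c) ring_scheme \<Rightarrow> ('a, 'm) module \<Rightarrow> bool" where
  "acc_module A M \<longleftrightarrow> (\<forall>N :: nat \<Rightarrow> 'm set. (\<forall>i. submodule (N i) A M \<and> N i \<subseteq> N (Suc i)) \<longrightarrow>
     (\<exists>n. \<forall>i \<ge> n. N i = N n))"

lemma acc_moduleD:
  assumes "acc_module A M" "\<And>i. submodule (N i) A M" "\<And>i. N i \<subseteq> N (Suc i)"
  shows "\<exists>n :: nat. \<forall>i \<ge> n. N i = N n"
proof -
  from assms(1) have "(\<forall>i. submodule (N i) A M \<and> N i \<subseteq> N (Suc i)) \<longrightarrow> (\<exists>n. \<forall>i \<ge> n. N i = N n)"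
    unfolding acc_module_def by (rule spec)
  with assms(2,3) show ?thesis by simp
qed

text \<open>Takes the place of Zorn's lemma: the maximal ideals and the maximal cyclic submodules
  needed later are all chosen inside a noetherian module.\<close>

lemma acc_module_maximal:
  assumes acc: "acc_module A M" and F: "F \<noteq> {}" "\<And>N. N \<in> F \<Longrightarrow> submodule N A M"
  obtains K where "K \<in> F" "\<And>N. N \<in> F \<Longrightarrow> K \<subseteq> N \<Longrightarrow> N = K"
proof -
  have "wf {(N, K). N \<in> F \<and> K \<in> F \<and> K \<subset> N}"
    unfolding wf_iff_no_infinite_down_chain
  proof
    assume "\<exists>f. \<forall>i. (f (Suc i), f i) \<in> {(N, K). N \<in> F \<and> K \<in> F \<and> K \<subset> N}"
    then obtain f where f: "\<And>i. f i \<in> F" "\<And>i. f i \<subset> f (Suc i)" by blast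
    have "\<exists>n. \<forall>i \<ge> n. f i = f n"
      by (rule acc_moduleD[OF acc]) (use F(2) f in auto)
    then obtain n where "\<And>i. i \<ge> n \<Longrightarrow> f i = f n" by blast
    from this[of "Suc n"] show False using f(2)[of n] by simp
  qed
  moreover obtain L where "L \<in> F" using F(1) by blast
  ultimately obtain K where "K \<in> F" "\<And>N. (N, K) \<in> {(N, K). N \<in> F \<and> K \<in> F \<and> K \<subset> N} \<Longrightarrow> N \<notin> F"
    by (rule wfE_min) blast
  then show ?thesis using that by blast
qed

text \<open>A finitely generated submodule of \<open>N\<close> that is maximal among those absorbs
  every further element of \<open>N\<close>.\<close>

lemma (in left_module) acc_module_imp_noetherian:
  assumes acc: "acc_module A M"
  shows "noetherian_module A M"
  unfolding noetherian_module_def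
proof (intro conjI allI impI)
  show "left_module A M" by (rule left_module_axioms)
  fix N assume N: "submodule N A M"
  interpret N: left_module A "M\<lparr>carrier := N\<rparr>" by (rule left_module_restrict[OF N])
  let ?F = "{submodule_span A M S | S. finite S \<and> S \<subseteq> N}"
  have NM: "N \<subseteq> carrier M" using submoduleD(1)[OF N] .
  have sub: "submodule (submodule_span A M S) A M" if "S \<subseteq> N" for S
    using submodule_span_submodule that NM by blast
  obtain K where K: "K \<in> ?F" "\<And>L. L \<in> ?F \<Longrightarrow> K \<subseteq> L \<Longrightarrow> L = K"
  proof (rule acc_module_maximal[OF acc, of ?F])
    show "?F \<noteq> {}" by blast
  qed (use sub in auto)
  then obtain S where S: "finite S" "S \<subseteq> N" "K = submodule_span A M S" by blast
  have KN: "K \<subseteq> N" using submodule_span_least[OF N S(2)] S(3) by simp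
  have "N \<subseteq> K"
  proof
    fix x assume x: "x \<in> N"
    have "insert x S \<subseteq> submodule_span A M (insert x S)" by (rule submodule_span_superset)
    then have "K \<subseteq> submodule_span A M (insert x S)" "x \<in> submodule_span A M (insert x S)"
      using submodule_span_least[OF sub[of "insert x S"], of S] S x by auto
    moreover have "submodule_span A M (insert x S) \<in> ?F"
    proof -
      have "finite (insert x S)" "insert x S \<subseteq> N" using S x by auto
      then show ?thesis by blast
    qed
    ultimately show "x \<in> K" using K(2) by blast
  qed
  have "N \<subseteq> L" if "submodule L A M" "S \<subseteq> L" for L
    using submodule_span_least[OF that] \<open>N \<subseteq> K\<close> S(3) by simp
  then have "submodule_span A (M\<lparr>carrier := N\<rparr>) S = N"
    using N S(2) unfolding submodule_span_def submodule_restrict_iff[OF N] by auto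
  then show "finitely_generated_module A (M\<lparr>carrier := N\<rparr>)"
    using N.left_module_axioms S(1,2) unfolding finitely_generated_module_def by auto
qed

text \<open>Induction on the generators, as for an extension of modules. Two nested submodules agree
  if they have the same intersection with the span \<open>?T\<close> of the old generators and the
  same left ideal of coefficients at the new generator modulo \<open>?T\<close>. Both kinds of data
  stabilise along the chain, the first by induction and the second by \<open>A\<close>.\<close>

lemma (in left_module) acc_module_fg:
  assumes A: "acc_module A (regular_module A)" and S: "finite S" "S \<subseteq> carrier M"
    and N: "\<And>i. submodule (N i) A M" "\<And>i. N i \<subseteq> N (Suc i)" "\<And>i. N i \<subseteq> submodule_span A M S"
  shows "\<exists>n. \<forall>i \<ge> n. N i = N n"
  using S N
proof (induction S arbitrary: N rule: finite_induct)
  case empty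
  have "submodule_span A M {} \<subseteq> {\<zero>}" by (rule submodule_span_least[OF submodule_zero]) simp
  then have "N i = {\<zero>}" for i
    using empty(4)[of i] submoduleD(2)[OF empty(2)[of i]] by blast
  then show ?case by blast
next
  case (insert s S)
  let ?T = "submodule_span A M S"
  interpret RA: left_module A "regular_module A" by (rule left_module_regular[OF R.ring_axioms])
  have s: "s \<in> carrier M" and ST: "S \<subseteq> carrier M" using insert.prems(1) by auto
  have T: "submodule ?T A M" by (rule submodule_span_submodule[OF ST])
  have mono: "N i \<subseteq> N j" if "i \<le> j" for i j
    using lift_Suc_mono_le[of N, OF insert.prems(3) that] .
  have "\<exists>n. \<forall>i \<ge> n. N i \<inter> ?T = N n \<inter> ?T"
    by (rule insert.IH) (use ST insert.prems(3) submodule_Int[OF insert.prems(2) T] in auto)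
  then obtain n1 where n1: "\<And>i. i \<ge> n1 \<Longrightarrow> N i \<inter> ?T = N n1 \<inter> ?T" by blast
  define a where "a i = {r \<in> carrier A. \<exists>t \<in> ?T. r \<odot> s \<oplus> t \<in> N i}" for i
  have T': "x \<in> ?T \<Longrightarrow> x \<in> carrier M" for x using submoduleD(1)[OF T] by auto
  have "submodule (a i) A (regular_module A)" for i
    unfolding RA.submodule_iff
  proof (simp, intro conjI ballI)
    note Ni = submoduleD[OF insert.prems(2)[of i]] and T2 = submoduleD[OF T]
    show "a i \<subseteq> carrier A" by (auto simp: a_def)
    show "\<zero>\<^bsub>A\<^esub> \<in> a i" using Ni(2) T2(2) s by (auto simp: a_def intro!: bexI[of _ "\<zero>"])
    show "x \<oplus>\<^bsub>A\<^esub> y \<in> a i" if "x \<in> a i" "y \<in> a i" for x y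
    proof -
      from that obtain t u where t: "x \<in> carrier A" "t \<in> ?T" "x \<odot> s \<oplus> t \<in> N i"
        "y \<in> carrier A" "u \<in> ?T" "y \<odot> s \<oplus> u \<in> N i" by (auto simp: a_def)
      have "(x \<odot> s \<oplus> t) \<oplus> (y \<odot> s \<oplus> u) = (x \<oplus>\<^bsub>A\<^esub> y) \<odot> s \<oplus> (t \<oplus> u)"
        using t s T' by (simp add: smult_l_distr smult_closed M.a_ac)
      then show ?thesis
        using t T2(3)[OF t(2,5)] Ni(3)[OF t(3,6)] by (auto simp: a_def)
    qed
    show "b \<otimes>\<^bsub>A\<^esub> x \<in> a i" if "b \<in> carrier A" "x \<in> a i" for b x
    proof -
      from that obtain t where t: "x \<in> carrier A" "t \<in> ?T" "x \<odot> s \<oplus> t \<in> N i" by (auto simp: a_def)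
      have "b \<odot> (x \<odot> s \<oplus> t) = (b \<otimes>\<^bsub>A\<^esub> x) \<odot> s \<oplus> b \<odot> t"
        using t s T' that by (simp add: smult_r_distr smult_assoc smult_closed)
      then show ?thesis
        using that t T2(4)[OF that(1) t(2)] Ni(4)[OF that(1) t(3)] by (auto simp: a_def)
    qed
  qed
  moreover have "a i \<subseteq> a (Suc i)" for i using insert.prems(3)[of i] by (auto simp: a_def)
  ultimately obtain n2 where n2: "\<And>i. i \<ge> n2 \<Longrightarrow> a i = a n2"
    using acc_moduleD[OF A, of a] by blast
  have "N i = N (max n1 n2)" if "i \<ge> max n1 n2" for i
  proof
    show "N (max n1 n2) \<subseteq> N i" by (rule mono[OF that])
    show "N i \<subseteq> N (max n1 n2)"
    proof
      fix x assume x: "x \<in> N i"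
      have sp: "submodule_span A M (insert s S) \<subseteq> cyclic s <+>\<^bsub>M\<^esub> ?T"
      proof (rule submodule_span_least[OF submodule_set_add[OF cyclic_submodule[OF s] T]])
        show "insert s S \<subseteq> cyclic s <+>\<^bsub>M\<^esub> ?T"
          using set_add_upper[OF cyclic_submodule[OF s] T] cyclic_self[OF s]
            submodule_span_superset[of S] by blast
      qed
      have "x \<in> cyclic s <+>\<^bsub>M\<^esub> ?T" using insert.prems(4)[of i] x sp by blast
      then obtain n t where "n \<in> cyclic s" and t: "t \<in> ?T" "x = n \<oplus> t"
        unfolding mem_set_add_iff by blast
      then obtain r where "r \<in> carrier A" "n = r \<odot> s"
        unfolding cyclic_def by blast
      with t have r: "r \<in> carrier A" "t \<in> ?T" "x = r \<odot> s \<oplus> t" by auto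
      then have "r \<in> a i" using x by (auto simp: a_def)
      then have "r \<in> a (max n1 n2)" using n2[of i] n2[of "max n1 n2"] that by auto
      then obtain u where u: "u \<in> ?T" "r \<odot> s \<oplus> u \<in> N (max n1 n2)" by (auto simp: a_def)
      let ?y = "r \<odot> s \<oplus> u"
      have yi: "?y \<in> N i" using u(2) mono[OF that] by auto
      have rs: "r \<odot> s \<in> carrier M" using r(1) s by (rule smult_closed)
      \<comment> \<open>The multiples of \<open>s\<close> cancel, so the difference falls into
        \<open>?T\<close>, where the chain is already constant.\<close>
      have "x \<ominus> ?y = t \<ominus> u"
      proof -
        have c: "r \<odot> s \<in> carrier M" "t \<in> carrier M" "u \<in> carrier M" using rs r u T' by auto
        have "x \<ominus> ?y = (t \<oplus> r \<odot> s) \<oplus> (\<ominus> (r \<odot> s) \<oplus> \<ominus> u)"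
          unfolding r(3) using c by (simp add: M.minus_eq M.minus_add M.a_comm)
        also have "\<dots> = t \<oplus> (r \<odot> s \<oplus> (\<ominus> (r \<odot> s) \<oplus> \<ominus> u))" using c by (simp add: M.a_assoc)
        also have "\<dots> = t \<ominus> u" using c by (simp add: M.r_neg2 M.minus_eq)
        finally show ?thesis .
      qed
      then have "x \<ominus> ?y \<in> N i \<inter> ?T"
        using submoduleD(6)[OF insert.prems(2) x yi] submoduleD(6)[OF T r(2) u(1)] by simp
      then have "x \<ominus> ?y \<in> N (max n1 n2)"
        using n1[of i] n1[of "max n1 n2"] that by auto
      then have "(x \<ominus> ?y) \<oplus> ?y \<in> N (max n1 n2)"
        using submoduleD(3)[OF insert.prems(2)] u(2) by blast
      moreover have "(x \<ominus> ?y) \<oplus> ?y = x"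
      proof -
        have "x \<in> carrier M" "?y \<in> carrier M"
          using submoduleD(1)[OF insert.prems(2)] x yi by auto
        then show ?thesis by (simp add: M.minus_eq M.a_assoc M.l_neg)
      qed
      ultimately show "x \<in> N (max n1 n2)" by simp
    qed
  qed
  then show ?case by blast
qed

lemma (in left_module) acc_module_of_finitely_generated:
  assumes "acc_module A (regular_module A)" "finitely_generated_module A M"
  shows "acc_module A M"
proof -
  obtain S where S: "finite S" "S \<subseteq> carrier M" "submodule_span A M S = carrier M"
    using assms(2) unfolding finitely_generated_module_def by blast
  show ?thesis
    unfolding acc_module_def
  proof (intro allI impI)
    fix N :: "nat \<Rightarrow> _" assume N: "\<forall>i. submodule (N i) A M \<and> N i \<subseteq> N (Suc i)"
    show "\<exists>n. \<forall>i \<ge> n. N i = N n"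
      by (rule acc_module_fg[OF assms(1) S(1,2)]) (use N S(3) submoduleD(1) in auto)
  qed
qed

section \<open>Quiver algebras over central scalars\<close>

definition arrow_word :: "('a, 'c) ring_scheme \<Rightarrow> ('e \<Rightarrow> 'a) \<Rightarrow> 'e list \<Rightarrow> 'a" where
  "arrow_word A arr as = foldr (\<lambda>a x. arr a \<otimes>\<^bsub>A\<^esub> x) as \<one>\<^bsub>A\<^esub>"

text \<open>These are the submodules over the ground ring, expressed through its image
  \<open>Z\<close> so that the ground ring itself disappears from the statements.\<close>

definition scalar_submodule :: "('a, 'c) ring_scheme \<Rightarrow> 'a set \<Rightarrow> 'a set \<Rightarrow> bool" where
  "scalar_submodule A Z N \<longleftrightarrow> N \<subseteq> carrier A \<and> \<zero>\<^bsub>A\<^esub> \<in> N \<and> (\<forall>x \<in> N. \<forall>y \<in> N. x \<oplus>\<^bsub>A\<^esub> y \<in> N) \<and>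
     (\<forall>z \<in> Z. \<forall>x \<in> N. z \<otimes>\<^bsub>A\<^esub> x \<in> N)"

text \<open>Only a span over \<open>Z\<close>; that it absorbs multiplication on both sides is
  proved in \<open>J_lmult\<close> and \<open>J_rmult\<close>. The form as an intersection makes
  \<open>J_least\<close> an induction principle on words.\<close>

definition arrow_ideal ::
    "('a, 'c) ring_scheme \<Rightarrow> 'e set \<Rightarrow> ('e \<Rightarrow> 'a) \<Rightarrow> 'a set \<Rightarrow> 'a set" where
  "arrow_ideal A E arr Z = \<Inter>{N. scalar_submodule A Z N \<and>
     (\<forall>as. as \<noteq> [] \<and> set as \<subseteq> E \<longrightarrow> arrow_word A arr as \<in> N)}"

lemma mem_r_coset_iff: "y \<in> H #>\<^bsub>A\<^esub> x \<longleftrightarrow> (\<exists>h \<in> H. y = h \<otimes>\<^bsub>A\<^esub> x)"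
  by (auto simp: r_coset_def)

lemma mem_l_coset_iff: "y \<in> x <#\<^bsub>A\<^esub> H \<longleftrightarrow> (\<exists>h \<in> H. y = x \<otimes>\<^bsub>A\<^esub> h)"
  by (auto simp: l_coset_def)

lemma r_coset_opposite_ring [simp]: "H #>\<^bsub>opposite_ring A\<^esub> x = x <#\<^bsub>A\<^esub> H"
  by (auto simp: mem_r_coset_iff mem_l_coset_iff)

lemma l_coset_opposite_ring [simp]: "x <#\<^bsub>opposite_ring A\<^esub> H = H #>\<^bsub>A\<^esub> x"
  by (auto simp: mem_r_coset_iff mem_l_coset_iff)

text \<open>
  The set \<open>Z\<close> is the image of the ground ring.  A word is a list of arrows with the left arrow first; the
  product of a word that is not a path is zero.  The axioms are invariant under passing to the opposite
  ring and exchanging \<open>h\<close> and \<open>t\<close>, so statements about right modules follow from those about left modules.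
\<close>

locale quiver_algebra = ring A for A :: "('a, 'c) ring_scheme" (structure) +
  fixes V :: "'v set" and E :: "'e set" and h t :: "'e \<Rightarrow> 'v"
    and e :: "'v \<Rightarrow> 'a" and arr :: "'e \<Rightarrow> 'a" and Z :: "'a set"
  assumes finite_V: "finite V" and finite_E: "finite E"
    and h_V: "a \<in> E \<Longrightarrow> h a \<in> V" and t_V: "a \<in> E \<Longrightarrow> t a \<in> V"
    and e_closed: "v \<in> V \<Longrightarrow> e v \<in> carrier A"
    and e_mult: "v \<in> V \<Longrightarrow> w \<in> V \<Longrightarrow> e v \<otimes> e w = (if v = w then e v else \<zero>)"
    and e_sum: "(\<Oplus>v\<in>V. e v) = \<one>"
    and arr_closed: "a \<in> E \<Longrightarrow> arr a \<in> carrier A"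
    and e_arr: "a \<in> E \<Longrightarrow> e (h a) \<otimes> arr a = arr a"
    and arr_e: "a \<in> E \<Longrightarrow> arr a \<otimes> e (t a) = arr a"
    and Z_carrier: "Z \<subseteq> carrier A" and Z_one: "\<one> \<in> Z" and Z_minus_one: "\<ominus> \<one> \<in> Z"
    and Z_add: "x \<in> Z \<Longrightarrow> y \<in> Z \<Longrightarrow> x \<oplus> y \<in> Z"
    and Z_mult: "x \<in> Z \<Longrightarrow> y \<in> Z \<Longrightarrow> x \<otimes> y \<in> Z"
    and Z_central: "z \<in> Z \<Longrightarrow> x \<in> carrier A \<Longrightarrow> z \<otimes> x = x \<otimes> z"
    and Z_acc: "(\<And>i. scalar_submodule A Z (C i)) \<Longrightarrow> (\<And>i. C i \<subseteq> C (Suc i)) \<Longrightarrow>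
      \<exists>n :: nat. \<forall>i \<ge> n. C i = C n"
    and span: "scalar_submodule A Z N \<Longrightarrow> (\<And>v. v \<in> V \<Longrightarrow> e v \<in> N) \<Longrightarrow>
      (\<And>as. as \<noteq> [] \<Longrightarrow> set as \<subseteq> E \<Longrightarrow> arrow_word A arr as \<in> N) \<Longrightarrow> carrier A \<subseteq> N"
begin

abbreviation "zsub \<equiv> scalar_submodule A Z"
abbreviation "word \<equiv> arrow_word A arr"
abbreviation "J \<equiv> arrow_ideal A E arr Z"
abbreviation "left_ideal N \<equiv> submodule N A (regular_module A)"

sublocale reg: left_module A "regular_module A"
  by (rule left_module_regular[OF ring_axioms])

lemma left_ideal_iff:
  "left_ideal N \<longleftrightarrow> N \<subseteq> carrier A \<and> \<zero> \<in> N \<and> (\<forall>x \<in> N. \<forall>y \<in> N. x \<oplus> y \<in> N) \<and>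
     (\<forall>a \<in> carrier A. \<forall>x \<in> N. a \<otimes> x \<in> N)"
  by (simp add: reg.submodule_iff)

lemma Z_closed [simp]: "z \<in> Z \<Longrightarrow> z \<in> carrier A"
  using Z_carrier by auto

lemma Z_lcomm: "z \<in> Z \<Longrightarrow> x \<in> carrier A \<Longrightarrow> y \<in> carrier A \<Longrightarrow> x \<otimes> (z \<otimes> y) = z \<otimes> (x \<otimes> y)"
  by (metis Z_central Z_closed m_assoc)

lemma Z_zero: "\<zero> \<in> Z"
  using Z_add[OF Z_one Z_minus_one] by (simp add: r_neg)

lemma zsubD:
  assumes "zsub N"
  shows "N \<subseteq> carrier A" "\<zero> \<in> N" "\<And>x y. x \<in> N \<Longrightarrow> y \<in> N \<Longrightarrow> x \<oplus> y \<in> N"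
    "\<And>z x. z \<in> Z \<Longrightarrow> x \<in> N \<Longrightarrow> z \<otimes> x \<in> N" "\<And>x. x \<in> N \<Longrightarrow> \<ominus> x \<in> N"
proof -
  show *: "N \<subseteq> carrier A" "\<zero> \<in> N" "\<And>x y. x \<in> N \<Longrightarrow> y \<in> N \<Longrightarrow> x \<oplus> y \<in> N"
    "\<And>z x. z \<in> Z \<Longrightarrow> x \<in> N \<Longrightarrow> z \<otimes> x \<in> N"
    using assms unfolding scalar_submodule_def by auto
  show "\<ominus> x \<in> N" if "x \<in> N" for x
  proof -
    have "x \<in> carrier A" using *(1) that by auto
    then have "\<ominus> \<one> \<otimes> x = \<ominus> x" by (simp add: l_minus)
    then show ?thesis using *(4)[OF Z_minus_one that] by simp
  qed
qed

lemma left_ideal_zsub: "left_ideal N \<Longrightarrow> zsub N"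
  unfolding left_ideal_iff scalar_submodule_def by auto

lemma acc_regular: "acc_module A (regular_module A)"
  unfolding acc_module_def
proof (intro allI impI)
  fix N :: "nat \<Rightarrow> 'a set"
  assume "\<forall>i. left_ideal (N i) \<and> N i \<subseteq> N (Suc i)"
  then show "\<exists>n. \<forall>i \<ge> n. N i = N n"
    by (intro Z_acc) (auto intro: left_ideal_zsub)
qed

lemma word_Nil [simp]: "word [] = \<one>" and word_Cons [simp]: "word (a # as) = arr a \<otimes> word as"
  by (simp_all add: arrow_word_def)

lemma word_closed [simp]: "set as \<subseteq> E \<Longrightarrow> word as \<in> carrier A"
  by (induction as) (auto simp: arr_closed)

lemma word_append: "set as \<subseteq> E \<Longrightarrow> set bs \<subseteq> E \<Longrightarrow> word (as @ bs) = word as \<otimes> word bs"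
  by (induction as) (auto simp: arr_closed m_assoc)

lemma e_word:
  assumes "as \<noteq> []" "set as \<subseteq> E"
  shows "e (h (hd as)) \<otimes> word as = word as"
  using assms by (cases as) (auto simp: m_assoc[symmetric] arr_closed e_closed h_V e_arr)

lemma word_e:
  assumes "as \<noteq> []" "set as \<subseteq> E"
  shows "word as \<otimes> e (t (last as)) = word as"
  using assms
proof (induction as rule: rev_induct)
  case (snoc a as)
  then show ?case
    by (simp add: word_append m_assoc arr_closed e_closed t_V arr_e)
qed simp

lemma e_word_other:
  assumes "as \<noteq> []" "set as \<subseteq> E" "v \<in> V" "v \<noteq> h (hd as)"
  shows "e v \<otimes> word as = \<zero>"
proof -
  have "h (hd as) \<in> V" using assms h_V by (cases as) auto
  moreover have "e v \<otimes> word as = (e v \<otimes> e (h (hd as))) \<otimes> word as"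
    using e_word[OF assms(1,2)] assms calculation by (simp add: m_assoc e_closed)
  ultimately show ?thesis using assms by (simp add: e_mult)
qed

lemma word_e_other:
  assumes "as \<noteq> []" "set as \<subseteq> E" "v \<in> V" "v \<noteq> t (last as)"
  shows "word as \<otimes> e v = \<zero>"
proof -
  have "t (last as) \<in> V" using assms t_V last_in_set by blast
  moreover have "word as \<otimes> e v = word as \<otimes> (e (t (last as)) \<otimes> e v)"
    using word_e[OF assms(1,2)] assms calculation by (simp add: m_assoc[symmetric] e_closed)
  ultimately show ?thesis using assms by (simp add: e_mult)
qed

lemma sum_e_mult: "x \<in> carrier A \<Longrightarrow> (\<Oplus>v\<in>V. e v \<otimes> x) = x"
  using finsum_ldistr[OF finite_V, of x e] e_sum e_closed by auto

lemma sum_mult_e: "x \<in> carrier A \<Longrightarrow> (\<Oplus>v\<in>V. x \<otimes> e v) = x"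
  using finsum_rdistr[OF finite_V, of x e] e_sum e_closed by auto

lemma zsub_finsum:
  assumes N: "zsub N" and f: "\<And>i. i \<in> S \<Longrightarrow> f i \<in> N"
  shows "(\<Oplus>i\<in>S. f i) \<in> N"
  using f
proof (induction S rule: infinite_finite_induct)
  case (insert i S)
  then have "f i \<in> carrier A" "f \<in> S \<rightarrow> carrier A" using zsubD(1)[OF N] by auto
  then show ?case using insert zsubD(3)[OF N] by simp
qed (auto simp: zsubD(2)[OF N])

lemma zsub_carrier: "zsub (carrier A)"
  by (simp add: scalar_submodule_def)

lemma zsub_J: "zsub J"
  using zsub_carrier unfolding arrow_ideal_def scalar_submodule_def by (auto 0 3)

lemma word_in_J: "as \<noteq> [] \<Longrightarrow> set as \<subseteq> E \<Longrightarrow> word as \<in> J"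
  by (auto simp: arrow_ideal_def)

lemma arr_in_J: "a \<in> E \<Longrightarrow> arr a \<in> J"
  using word_in_J[of "[a]"] by (simp add: arr_closed)

lemma J_least:
  "zsub N \<Longrightarrow> (\<And>as. as \<noteq> [] \<Longrightarrow> set as \<subseteq> E \<Longrightarrow> word as \<in> N) \<Longrightarrow> J \<subseteq> N"
  unfolding arrow_ideal_def by blast

lemma J_carrier: "J \<subseteq> carrier A"
  using zsubD(1)[OF zsub_J] .

lemma J_closed [simp]: "j \<in> J \<Longrightarrow> j \<in> carrier A"
  using J_carrier by auto

text \<open>Centrality of \<open>Z\<close> keeps preimages under one-sided multiplication closed
  under scalars. Such preimages are the sets to which the induction principles \<open>span\<close>
  and \<open>J_least\<close> are applied.\<close>

lemma zsub_left_quotient: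
  assumes "zsub N" "x \<in> carrier A"
  shows "zsub {y \<in> carrier A. x \<otimes> y \<in> N}"
  unfolding scalar_submodule_def
proof (intro conjI ballI)
  note N = zsubD[OF assms(1)]
  show "{y \<in> carrier A. x \<otimes> y \<in> N} \<subseteq> carrier A" by auto
  show "\<zero> \<in> {y \<in> carrier A. x \<otimes> y \<in> N}" using assms N by auto
  show "y \<oplus> y' \<in> {y \<in> carrier A. x \<otimes> y \<in> N}"
    if "y \<in> {y \<in> carrier A. x \<otimes> y \<in> N}" "y' \<in> {y \<in> carrier A. x \<otimes> y \<in> N}" for y y'
    using that assms N(3) by (auto simp: r_distr)
  show "z \<otimes> y \<in> {y \<in> carrier A. x \<otimes> y \<in> N}"
    if "z \<in> Z" "y \<in> {y \<in> carrier A. x \<otimes> y \<in> N}" for z y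
  proof -
    have "x \<otimes> (z \<otimes> y) = z \<otimes> (x \<otimes> y)"
      using that assms by (intro Z_lcomm) auto
    then show ?thesis using that N(4) by auto
  qed
qed

lemma zsub_right_quotient:
  assumes "zsub N" "x \<in> carrier A"
  shows "zsub {y \<in> carrier A. y \<otimes> x \<in> N}"
  using assms(2) zsubD[OF assms(1)] unfolding scalar_submodule_def by (auto simp: l_distr m_assoc)

text \<open>Two nested inductions: for a fixed word the left factor runs through the spanning
  elements, then the word is replaced by an element of \<open>J\<close>. A vertex either fixes a
  word or kills it, and the product of two words is a word.\<close>

lemma J_lmult:
  assumes "x \<in> carrier A" "j \<in> J"
  shows "x \<otimes> j \<in> J"
proof -
  have w: "carrier A \<subseteq> {y \<in> carrier A. y \<otimes> word as \<in> J}" if as: "as \<noteq> []" "set as \<subseteq> E" for as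
  proof (rule span[OF zsub_right_quotient[OF zsub_J]])
    show "word as \<in> carrier A" using as by simp
    show "e v \<in> {y \<in> carrier A. y \<otimes> word as \<in> J}" if "v \<in> V" for v
      using e_word[OF as] e_word_other[OF as that] word_in_J[OF as] zsubD(2)[OF zsub_J] that e_closed
      by (cases "v = h (hd as)") auto
    show "word bs \<in> {y \<in> carrier A. y \<otimes> word as \<in> J}" if "bs \<noteq> []" "set bs \<subseteq> E" for bs
      using word_in_J[of "bs @ as"] that as by (simp add: word_append)
  qed
  have "J \<subseteq> {y \<in> carrier A. x \<otimes> y \<in> J}"
    using w assms(1) by (intro J_least zsub_left_quotient zsub_J) auto
  then show ?thesis using assms by auto
qed

lemma J_rmult:
  assumes "x \<in> carrier A" "j \<in> J"
  shows "j \<otimes> x \<in> J"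
proof -
  have w: "carrier A \<subseteq> {y \<in> carrier A. word as \<otimes> y \<in> J}" if as: "as \<noteq> []" "set as \<subseteq> E" for as
  proof (rule span[OF zsub_left_quotient[OF zsub_J]])
    show "word as \<in> carrier A" using as by simp
    show "e v \<in> {y \<in> carrier A. word as \<otimes> y \<in> J}" if "v \<in> V" for v
      using word_e[OF as] word_e_other[OF as that] word_in_J[OF as] zsubD(2)[OF zsub_J] that e_closed
      by (cases "v = t (last as)") auto
    show "word bs \<in> {y \<in> carrier A. word as \<otimes> y \<in> J}" if "bs \<noteq> []" "set bs \<subseteq> E" for bs
      using word_in_J[of "as @ bs"] that as by (simp add: word_append)
  qed
  have "J \<subseteq> {y \<in> carrier A. y \<otimes> x \<in> J}"
    using w assms(1) by (intro J_least zsub_right_quotient zsub_J) auto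
  then show ?thesis using assms by auto
qed

lemma J_minus: "j \<in> J \<Longrightarrow> \<ominus> j \<in> J"
  using zsubD(5)[OF zsub_J] .

lemma J_left_ideal: "left_ideal J"
  using zsubD[OF zsub_J] J_lmult unfolding left_ideal_iff by auto

text \<open>Against \<open>e v\<close> every other vertex vanishes and every nonempty word lands in
  \<open>J\<close>, so only a scalar multiple of \<open>e v\<close> survives. The point is that one
  scalar serves on both sides; \<open>scalar_part_unit\<close> depends on this.\<close>

lemma scalar_part:
  assumes "x \<in> carrier A" "v \<in> V"
  shows "\<exists>z \<in> Z. (\<exists>j \<in> J. x \<otimes> e v = z \<otimes> e v \<oplus> j) \<and> (\<exists>j \<in> J. e v \<otimes> x = z \<otimes> e v \<oplus> j)"
proof -
  note ev = e_closed[OF assms(2)]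
  let ?N = "{x \<in> carrier A. \<exists>z \<in> Z. (\<exists>j \<in> J. x \<otimes> e v = z \<otimes> e v \<oplus> j) \<and> (\<exists>j \<in> J. e v \<otimes> x = z \<otimes> e v \<oplus> j)}"
  have "carrier A \<subseteq> ?N"
  proof (rule span)
    show "zsub ?N"
      unfolding scalar_submodule_def
    proof (intro conjI ballI)
      show "?N \<subseteq> carrier A" by auto
      show "\<zero> \<in> ?N" using ev Z_zero zsubD(2)[OF zsub_J] by (auto intro!: bexI[of _ \<zero>])
      show "x \<oplus> y \<in> ?N" if "x \<in> ?N" "y \<in> ?N" for x y
      proof -
        from that obtain z j k z' j' k' where x: "x \<in> carrier A" "z \<in> Z" "j \<in> J" "k \<in> J"
          "x \<otimes> e v = z \<otimes> e v \<oplus> j" "e v \<otimes> x = z \<otimes> e v \<oplus> k"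
          and y: "y \<in> carrier A" "z' \<in> Z" "j' \<in> J" "k' \<in> J"
          "y \<otimes> e v = z' \<otimes> e v \<oplus> j'" "e v \<otimes> y = z' \<otimes> e v \<oplus> k'" by blast
        have "(x \<oplus> y) \<otimes> e v = (z \<oplus> z') \<otimes> e v \<oplus> (j \<oplus> j')"
          "e v \<otimes> (x \<oplus> y) = (z \<oplus> z') \<otimes> e v \<oplus> (k \<oplus> k')"
          using x y ev by (simp_all add: l_distr r_distr a_ac)
        then show ?thesis using x y Z_add zsubD(3)[OF zsub_J] by blast
      qed
      show "y \<otimes> x \<in> ?N" if "y \<in> Z" "x \<in> ?N" for x y
      proof -
        from that obtain z j k where x: "x \<in> carrier A" "z \<in> Z" "j \<in> J" "k \<in> J"
          "x \<otimes> e v = z \<otimes> e v \<oplus> j" "e v \<otimes> x = z \<otimes> e v \<oplus> k" by blast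
        have "(y \<otimes> x) \<otimes> e v = (y \<otimes> z) \<otimes> e v \<oplus> (y \<otimes> j)"
          using x that ev by (simp add: m_assoc r_distr)
        moreover have "e v \<otimes> (y \<otimes> x) = y \<otimes> (e v \<otimes> x)"
          using x that ev by (intro Z_lcomm) auto
        then have "e v \<otimes> (y \<otimes> x) = (y \<otimes> z) \<otimes> e v \<oplus> (y \<otimes> k)"
          using x that ev by (simp add: m_assoc r_distr)
        moreover have "y \<otimes> j \<in> J" "y \<otimes> k \<in> J" "y \<otimes> z \<in> Z" "y \<otimes> x \<in> carrier A"
          using x that Z_mult zsubD(4)[OF zsub_J] by auto
        ultimately show ?thesis by blast
      qed
    qed
    show "e w \<in> ?N" if "w \<in> V" for w
    proof (cases "w = v")
      case True
      have "e v \<otimes> e v = \<one> \<otimes> e v \<oplus> \<zero>" using assms ev by (simp add: e_mult)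
      then show ?thesis using True ev Z_one zsubD(2)[OF zsub_J] by blast
    next
      case False
      have "e w \<otimes> e v = \<zero> \<otimes> e v \<oplus> \<zero>" "e v \<otimes> e w = \<zero> \<otimes> e v \<oplus> \<zero>"
        using assms ev that False by (auto simp add: e_mult)
      then show ?thesis using e_closed[OF that] Z_zero zsubD(2)[OF zsub_J] by blast
    qed
    show "word as \<in> ?N" if as: "as \<noteq> []" "set as \<subseteq> E" for as
    proof -
      have "word as \<otimes> e v = \<zero> \<otimes> e v \<oplus> word as \<otimes> e v" "e v \<otimes> word as = \<zero> \<otimes> e v \<oplus> e v \<otimes> word as"
        using ev as by simp_all
      moreover have "word as \<otimes> e v \<in> J" "e v \<otimes> word as \<in> J"
        using word_in_J[OF as] J_lmult J_rmult ev by auto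
      ultimately show ?thesis using as Z_zero by (blast intro: word_closed)
    qed
  qed
  then show ?thesis using assms(1) by blast
qed

section \<open>Passage to the opposite algebra\<close>

lemma arrow_word_opposite:
  "set as \<subseteq> E \<Longrightarrow> arrow_word (opposite_ring A) arr as = word (rev as)"
proof (induction as)
  case (Cons a as)
  then have "arrow_word (opposite_ring A) arr (a # as) = word (rev as) \<otimes> arr a"
    by (simp add: arrow_word_def)
  also have "\<dots> = word (rev (a # as))"
    using Cons.prems by (simp add: word_append arr_closed)
  finally show ?case .
qed (simp add: arrow_word_def)

lemma scalar_submodule_opposite: "scalar_submodule (opposite_ring A) Z N \<longleftrightarrow> zsub N"
proof -
  have "(\<forall>z \<in> Z. \<forall>x \<in> N. x \<otimes> z \<in> N) \<longleftrightarrow> (\<forall>z \<in> Z. \<forall>x \<in> N. z \<otimes> x \<in> N)" if "N \<subseteq> carrier A"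
    using that Z_central by (metis subsetD)
  then show ?thesis unfolding scalar_submodule_def by auto
qed

lemma arrow_ideal_opposite: "arrow_ideal (opposite_ring A) E arr Z = J"
proof -
  have "(\<forall>as. as \<noteq> [] \<and> set as \<subseteq> E \<longrightarrow> arrow_word (opposite_ring A) arr as \<in> N) \<longleftrightarrow>
    (\<forall>as. as \<noteq> [] \<and> set as \<subseteq> E \<longrightarrow> word as \<in> N)" for N
    using arrow_word_opposite by (metis rev_is_Nil_conv rev_rev_ident set_rev)
  then show ?thesis unfolding arrow_ideal_def scalar_submodule_opposite by simp
qed

lemma quiver_algebra_opposite: "quiver_algebra (opposite_ring A) V E t h e arr Z"
proof (intro quiver_algebra.intro quiver_algebra_axioms.intro)
  show "ring (opposite_ring A)" by (rule ring_opposite_ring[OF ring_axioms])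
  fix N assume N: "scalar_submodule (opposite_ring A) Z N" "\<And>v. v \<in> V \<Longrightarrow> e v \<in> N"
    "\<And>as. as \<noteq> [] \<Longrightarrow> set as \<subseteq> E \<Longrightarrow> arrow_word (opposite_ring A) arr as \<in> N"
  have "word as \<in> N" if "as \<noteq> []" "set as \<subseteq> E" for as
    using N(3)[of "rev as"] arrow_word_opposite[of "rev as"] that by simp
  then show "carrier (opposite_ring A) \<subseteq> N"
    using span[of N] N(1,2) by (simp add: scalar_submodule_opposite)
next
  fix C :: "nat \<Rightarrow> 'a set"
  assume "\<And>i. scalar_submodule (opposite_ring A) Z (C i)" "\<And>i. C i \<subseteq> C (Suc i)"
  then show "\<exists>n. \<forall>i \<ge> n. C i = C n" using Z_acc[of C] by (simp add: scalar_submodule_opposite)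
qed (auto simp: finite_V finite_E h_V t_V e_closed e_mult e_sum arr_closed e_arr arr_e Z_one Z_minus_one
    Z_add Z_mult intro: Z_central[symmetric])

lemma cyclic_reg: "reg.cyclic x = carrier A #> x"
  by (auto simp: reg.cyclic_def mem_r_coset_iff)

lemma principal_left_ideal: "x \<in> carrier A \<Longrightarrow> left_ideal (carrier A #> x)"
  using reg.cyclic_submodule by (simp add: cyclic_reg)

lemma principal_self: "x \<in> carrier A \<Longrightarrow> x \<in> carrier A #> x"
  using reg.cyclic_self by (simp add: cyclic_reg)

lemma principal_least: "left_ideal N \<Longrightarrow> x \<in> N \<Longrightarrow> carrier A #> x \<subseteq> N"
  using reg.cyclic_least by (simp add: cyclic_reg)

end

text \<open>Locality without reference to modules: the vertices survive modulo \<open>J\<close>,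
  elements of \<open>\<one> + J\<close> are units, and scalars outside \<open>J\<close> are
  invertible. Each condition is unchanged by passing to the opposite ring.\<close>

locale local_quiver_algebra = quiver_algebra A V E h t e arr Z
  for A :: "('a, 'c) ring_scheme" (structure) and V :: "'v set" and E :: "'e set"
    and h t e arr Z +
  assumes e_notin_J: "v \<in> V \<Longrightarrow> e v \<notin> J"
    and one_plus_J: "j \<in> J \<Longrightarrow> \<exists>u \<in> carrier A. u \<otimes> (\<one> \<oplus> j) = \<one> \<and> (\<one> \<oplus> j) \<otimes> u = \<one>"
    and Z_local: "z \<in> Z \<Longrightarrow> z \<in> J \<or> (\<exists>z' \<in> Z. z \<otimes> z' = \<one>)"
begin

lemma local_quiver_algebra_opposite: "local_quiver_algebra (opposite_ring A) V E t h e arr Z"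
proof (intro local_quiver_algebra.intro quiver_algebra_opposite local_quiver_algebra_axioms.intro,
    unfold arrow_ideal_opposite opposite_ring_simps)
  show "e v \<notin> J" if "v \<in> V" for v using e_notin_J[OF that] .
  show "\<exists>u \<in> carrier A. (\<one> \<oplus> j) \<otimes> u = \<one> \<and> u \<otimes> (\<one> \<oplus> j) = \<one>" if "j \<in> J" for j
    using one_plus_J[OF that] by blast
  show "z \<in> J \<or> (\<exists>z' \<in> Z. z' \<otimes> z = \<one>)" if "z \<in> Z" for z
    using Z_local[OF that] Z_central[OF that] by (metis Z_closed)
qed

lemma unit_scalar_part:
  assumes x: "x \<in> carrier A" and v: "v \<in> V" and n: "x \<otimes> e v \<notin> J"
  obtains z y j k where "z \<in> Z" "y \<in> Z" "y \<otimes> z = \<one>" "j \<in> J" "k \<in> J"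
    "x \<otimes> e v = z \<otimes> e v \<oplus> j" "e v \<otimes> x = z \<otimes> e v \<oplus> k"
proof -
  obtain z j k where z: "z \<in> Z" "j \<in> J" "k \<in> J" "x \<otimes> e v = z \<otimes> e v \<oplus> j" "e v \<otimes> x = z \<otimes> e v \<oplus> k"
    using scalar_part[OF x v] by blast
  have "z \<notin> J"
  proof
    assume "z \<in> J"
    then have "z \<otimes> e v \<oplus> j \<in> J" using J_rmult[OF e_closed[OF v]] z(2) zsubD(3)[OF zsub_J] by blast
    then show False using n z(4) by simp
  qed
  then obtain y where "y \<in> Z" "z \<otimes> y = \<one>" using Z_local[OF z(1)] by blast
  then show ?thesis using that z Z_central[OF z(1), of y] by simp
qed

text \<open>Outside \<open>J\<close> the scalar part \<open>z\<close> is a unit. Scaling by its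
  inverse leaves \<open>e v\<close> up to a correction in \<open>J\<close>, which is removed by
  inverting an element of \<open>\<one> + J\<close>.\<close>

lemma unit_left:
  assumes x: "x \<in> carrier A" and v: "v \<in> V" and n: "x \<otimes> e v \<notin> J"
  shows "\<exists>y \<in> carrier A. y \<otimes> (x \<otimes> e v) = e v"
proof -
  note ev = e_closed[OF v]
  obtain z y j where z: "z \<in> Z" "y \<in> Z" "y \<otimes> z = \<one>" "j \<in> J" "x \<otimes> e v = z \<otimes> e v \<oplus> j"
    using unit_scalar_part[OF assms] by metis
  have j: "y \<otimes> j \<in> J" using zsubD(4)[OF zsub_J] z by blast
  obtain u where u: "u \<in> carrier A" "u \<otimes> (\<one> \<oplus> y \<otimes> j) = \<one>" using one_plus_J[OF j] by blast
  have s: "y \<otimes> (x \<otimes> e v) = e v \<oplus> y \<otimes> j"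
    unfolding z(5) using z(1-4) ev by (simp add: r_distr m_assoc[symmetric])
  \<comment> \<open>A second factor \<open>e v\<close> on the right turns
    \<open>e v \<oplus> y \<otimes> j\<close> into
    \<open>(\<one> \<oplus> y \<otimes> j) \<otimes> e v\<close>, so that a unit stands in
    front.\<close>
  have "y \<otimes> (x \<otimes> e v) = (y \<otimes> (x \<otimes> e v)) \<otimes> e v"
    using x ev v z(2) by (simp add: m_assoc e_mult)
  also have "\<dots> = (\<one> \<oplus> y \<otimes> j) \<otimes> e v" unfolding s using ev v j J_closed[OF j] by (simp add: l_distr e_mult)
  finally have "u \<otimes> (y \<otimes> (x \<otimes> e v)) = e v"
    using u ev J_closed[OF j] by (simp add: m_assoc[symmetric])
  then have "(u \<otimes> y) \<otimes> (x \<otimes> e v) = e v" using u z x ev by (simp add: m_assoc)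
  then show ?thesis using u z by (metis Z_closed m_closed)
qed

lemma unit_right:
  assumes "x \<in> carrier A" "v \<in> V" "e v \<otimes> x \<notin> J"
  shows "\<exists>y \<in> carrier A. (e v \<otimes> x) \<otimes> y = e v"
  using local_quiver_algebra.unit_left[OF local_quiver_algebra_opposite, of x v] assms
  by (simp add: arrow_ideal_opposite)

text \<open>\<open>\<one> - j\<close> annihilates \<open>x\<close> and is a unit. Only the cyclic
  submodule of \<open>x\<close> is involved, so no finiteness of \<open>M\<close> enters.\<close>

lemma nakayama_element:
  assumes M: "left_module A M" and x: "x \<in> carrier M" and j: "j \<in> J" "x = j \<odot>\<^bsub>M\<^esub> x"
  shows "x = \<zero>\<^bsub>M\<^esub>"
proof -
  interpret M: left_module A M by (rule M)
  obtain u where u: "u \<in> carrier A" "u \<otimes> (\<one> \<oplus> \<ominus> j) = \<one>" using one_plus_J[OF J_minus[OF j(1)]] by blast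
  have jx: "j \<odot>\<^bsub>M\<^esub> x \<in> carrier M" using M.smult_closed[OF J_closed[OF j(1)] x] .
  have "(\<one> \<oplus> \<ominus> j) \<odot>\<^bsub>M\<^esub> x = x \<oplus>\<^bsub>M\<^esub> \<ominus>\<^bsub>M\<^esub> (j \<odot>\<^bsub>M\<^esub> x)"
    using j x by (simp add: M.smult_l_distr M.smult_l_minus M.smult_one)
  also have "\<dots> = \<zero>\<^bsub>M\<^esub>" using j(2)[symmetric] M.M.r_neg[OF x] by simp
  finally have "(\<one> \<oplus> \<ominus> j) \<odot>\<^bsub>M\<^esub> x = \<zero>\<^bsub>M\<^esub>" .
  then have "u \<odot>\<^bsub>M\<^esub> ((\<one> \<oplus> \<ominus> j) \<odot>\<^bsub>M\<^esub> x) = \<zero>\<^bsub>M\<^esub>" using u by simp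
  moreover have "u \<odot>\<^bsub>M\<^esub> ((\<one> \<oplus> \<ominus> j) \<odot>\<^bsub>M\<^esub> x) = x"
    using u x j J_closed by (simp add: M.smult_assoc[symmetric] M.smult_one)
  ultimately show ?thesis by simp
qed

lemma nakayama_regular: "x \<in> carrier A \<Longrightarrow> j \<in> J \<Longrightarrow> x = j \<otimes> x \<Longrightarrow> x = \<zero>"
  using nakayama_element[OF reg.left_module_axioms, of x j] by simp

lemma mem_J_coset_self: "x \<in> carrier A \<Longrightarrow> x \<in> J #> x \<Longrightarrow> x = \<zero>"
  using nakayama_regular by (auto simp: mem_r_coset_iff)

end

section \<open>Chains of principal left ideals\<close>

context quiver_algebra
begin

lemma left_idealD:
  assumes "left_ideal N"
  shows "N \<subseteq> carrier A" "\<zero> \<in> N" "\<And>x y. x \<in> N \<Longrightarrow> y \<in> N \<Longrightarrow> x \<oplus> y \<in> N"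
    "\<And>a x. a \<in> carrier A \<Longrightarrow> x \<in> N \<Longrightarrow> a \<otimes> x \<in> N" "\<And>x. x \<in> N \<Longrightarrow> \<ominus> x \<in> N"
    "\<And>x y. x \<in> N \<Longrightarrow> y \<in> N \<Longrightarrow> x \<ominus> y \<in> N"
  using zsubD[OF left_ideal_zsub[OF assms]] assms by (auto simp: left_ideal_iff minus_eq)

lemma r_cosetI: "a \<in> H \<Longrightarrow> a \<otimes> x \<in> H #> x"
  by (auto simp: mem_r_coset_iff)

lemma Z_pow: "z \<in> Z \<Longrightarrow> z [^] (n :: nat) \<in> Z"
  by (induction n) (auto simp: Z_one Z_mult)

lemma Z_pow_Suc_mult:
  assumes "z \<in> Z" "y \<in> carrier A"
  shows "z [^] Suc k \<otimes> y = z \<otimes> (z [^] k \<otimes> y)"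
  using Z_central[OF Z_pow[OF assms(1), of k], of z] Z_pow[OF assms(1), of k] assms
  by (simp add: m_assoc[symmetric])

end

text \<open>Abstracts the sequence of words that begin, on the right, with a fixed arrow. Because
  \<open>e (v n)\<close> fixes \<open>x n\<close>, the coefficient \<open>a\<close> of a multiple of
  \<open>x n\<close> may be replaced by \<open>a \<otimes> e (v n)\<close>, to which
  \<open>unit_left\<close> applies.\<close>

locale radical_chain = local_quiver_algebra A V E h t e arr Z
  for A :: "('a, 'c) ring_scheme" (structure) and V :: "'v set" and E :: "'e set"
    and h t e arr Z +
  fixes x :: "nat \<Rightarrow> 'a" and v :: "nat \<Rightarrow> 'v"
  assumes x_closed: "\<And>n. x n \<in> carrier A" and v_V: "\<And>n. v n \<in> V"
    and e_x: "\<And>n. e (v n) \<otimes> x n = x n"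
    and J_x: "\<And>n. J #> x n = carrier A #> x (Suc n)"
begin

abbreviation "P n \<equiv> carrier A #> x n"
abbreviation "U \<equiv> \<Inter>n. P n"

lemma P_left_ideal: "left_ideal (P n)"
  by (rule principal_left_ideal[OF x_closed])

lemma P_Suc: "P (Suc n) \<subseteq> P n"
proof -
  have "y \<in> P n" if "y \<in> J #> x n" for y
    using that J_closed by (auto simp: mem_r_coset_iff)
  then show ?thesis using J_x[of n] by auto
qed

lemma P_antimono: "m \<le> n \<Longrightarrow> P n \<subseteq> P m"
  by (rule lift_Suc_antimono_le[of "\<lambda>n. P n"]) (rule P_Suc)

lemma P_carrier: "P n \<subseteq> carrier A"
  using left_idealD(1)[OF P_left_ideal] .

lemma U_left_ideal: "left_ideal U"
  by (rule reg.submodule_Inter) (use P_left_ideal in auto)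

text \<open>The coefficient at \<open>x n\<close> of an element outside \<open>P (Suc n)\<close>
  lies outside \<open>J\<close>, hence can be multiplied to \<open>e (v n)\<close>.\<close>

lemma generator_mem:
  assumes y: "y \<in> P n" "y \<notin> P (Suc n)"
  shows "x n \<in> carrier A #> y"
proof -
  obtain a where a: "a \<in> carrier A" "y = a \<otimes> x n" using y(1) by (auto simp: mem_r_coset_iff)
  have ev: "e (v n) \<in> carrier A" using e_closed v_V by auto
  have yx: "y = (a \<otimes> e (v n)) \<otimes> x n" using a ev e_x x_closed by (simp add: m_assoc)
  have "a \<otimes> e (v n) \<notin> J"
    using y(2) yx unfolding J_x[symmetric] mem_r_coset_iff by blast
  then obtain b where b: "b \<in> carrier A" "b \<otimes> (a \<otimes> e (v n)) = e (v n)"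
    using unit_left[OF a(1) v_V] by blast
  have "b \<otimes> y = (b \<otimes> (a \<otimes> e (v n))) \<otimes> x n"
    using yx b(1) a(1) ev x_closed by (simp add: m_assoc)
  then have "b \<otimes> y = x n" using b e_x by simp
  then show ?thesis using r_cosetI[OF b(1), of y] by simp
qed

text \<open>If \<open>P n\<close> is the last term that contains \<open>N\<close>, then
  \<open>N\<close> has an element outside \<open>P (Suc n)\<close>, and this element recovers the
  generator \<open>x n\<close>. Such an \<open>n\<close> exists because \<open>N\<close> lies in
  \<open>P 0\<close>.\<close>

lemma below_U_or_term:
  assumes N: "left_ideal N" "N \<subseteq> P 0"
  shows "N \<subseteq> U \<or> (\<exists>n. N = P n)"
proof (cases "N \<subseteq> U")
  case False
  then obtain m where m: "\<not> N \<subseteq> P m" by auto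
  define k where "k = (LEAST m. \<not> N \<subseteq> P m)"
  have k: "\<not> N \<subseteq> P k" unfolding k_def by (rule LeastI[of _ m]) (rule m)
  then obtain n where n: "k = Suc n" using N(2) by (cases k) auto
  have "N \<subseteq> P n" using not_less_Least[of n "\<lambda>m. \<not> N \<subseteq> P m"] unfolding k_def[symmetric] n by auto
  moreover obtain y where "y \<in> N" "y \<notin> P (Suc n)" using k n by auto
  ultimately have "x n \<in> N"
    using generator_mem[of y n] principal_least[OF N(1), of y] by blast
  then have "N = P n" using \<open>N \<subseteq> P n\<close> principal_least[OF N(1)] by blast
  then show ?thesis by blast
qed simp

section \<open>The intersection of the chain\<close>

lemma eq_zero_of_mem_Suc: "x n \<in> P (Suc n) \<Longrightarrow> x n = \<zero>"
  using mem_J_coset_self[OF x_closed] J_x by simp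

lemma U_zero_of_zero: "x n = \<zero> \<Longrightarrow> U = {\<zero>}"
proof -
  assume "x n = \<zero>"
  then have "P n = {\<zero>}" using zero_closed by (auto simp: r_coset_def)
  then show "U = {\<zero>}" using left_idealD(2)[OF U_left_ideal] by blast
qed

text \<open>Among the nonzero elements take \<open>w\<close> with \<open>A w\<close> maximal and
  divide, \<open>w = z w'\<close>. Maximality gives \<open>A w' = A w\<close>, hence
  \<open>w' = a z w'\<close> with \<open>a z\<close> in \<open>J\<close>, and Nakayama's lemma makes
  \<open>w'\<close> zero.\<close>

lemma divisible_zero:
  assumes W: "W \<subseteq> carrier A" and z: "z \<in> Z" "z \<in> J" and d: "\<And>y. y \<in> W \<Longrightarrow> \<exists>y' \<in> W. y = z \<otimes> y'"
  shows "W \<subseteq> {\<zero>}"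
proof (rule ccontr)
  assume "\<not> W \<subseteq> {\<zero>}"
  let ?F = "{carrier A #> w | w. w \<in> W \<and> w \<noteq> \<zero>}"
  obtain K where K: "K \<in> ?F" "\<And>N. N \<in> ?F \<Longrightarrow> K \<subseteq> N \<Longrightarrow> N = K"
  proof (rule acc_module_maximal[OF acc_regular, of ?F])
    obtain w where "w \<in> W" "w \<noteq> \<zero>" using \<open>\<not> W \<subseteq> {\<zero>}\<close> by auto
    then show "?F \<noteq> {}" by auto
    show "left_ideal N" if "N \<in> ?F" for N using that W principal_left_ideal by auto
  qed blast
  then obtain w where w: "w \<in> W" "w \<noteq> \<zero>" "K = carrier A #> w" by blast
  obtain w' where w': "w' \<in> W" "w = z \<otimes> w'" using d[OF w(1)] by blast
  have c: "w' \<in> carrier A" "w \<in> carrier A" using W w w' by auto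
  have "w' \<noteq> \<zero>" using w w' z by auto
  moreover have "carrier A #> w \<subseteq> carrier A #> w'"
    using principal_least[OF principal_left_ideal[OF c(1)]] z w'(2) r_cosetI[of z "carrier A" w'] by simp
  ultimately have "carrier A #> w' = carrier A #> w" using K(2) w w' by blast
  then obtain a where a: "a \<in> carrier A" "w' = a \<otimes> w"
    using principal_self[OF c(1)] by (auto simp: mem_r_coset_iff)
  then have "w' = (a \<otimes> z) \<otimes> w'" using w'(2) c z by (simp add: m_assoc)
  then have "w' = \<zero>" using nakayama_regular[OF c(1)] J_lmult[OF a(1) z(2)] by blast
  then show False using \<open>w' \<noteq> \<zero>\<close> by simp
qed

text \<open>
  If \<open>zx\<^sub>0\<close> is not in \<open>U\<close> then \<open>zAx\<^sub>0\<close> is a term of the chain, and \<open>U\<close> lies in the intersection \<open>W\<close> of the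
  \<open>z\<^sup>kAx\<^sub>0\<close>.  The annihilators of the powers of \<open>z\<close> in \<open>Ax\<^sub>0\<close> stabilise, which gives \<open>W = zW\<close>.
\<close>

lemma U_zero_divisible:
  assumes z: "z \<in> Z" "z \<in> J" and zx: "z \<otimes> x 0 \<notin> U"
  shows "U = {\<zero>}"
proof -
  have zc: "z \<in> carrier A" using z by simp
  have pc: "z [^] (n::nat) \<in> carrier A" for n using Z_pow[OF z(1)] by simp
  have "z \<otimes> x 0 \<in> P 0" using zc by (auto simp: mem_r_coset_iff)
  then have "carrier A #> (z \<otimes> x 0) \<subseteq> P 0" by (rule principal_least[OF P_left_ideal])
  moreover have zx0: "z \<otimes> x 0 \<in> carrier A" using zc x_closed by simp
  ultimately obtain n where n: "carrier A #> (z \<otimes> x 0) = P n"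
    using below_U_or_term[OF principal_left_ideal[OF zx0]] principal_self[OF zx0] zx by blast
  \<comment> \<open>Applying \<open>J\<close> to the inclusion of \<open>P n\<close> in
    \<open>z P 0\<close> raises both indices by one, since \<open>z\<close> is central.\<close>
  have shift: "P (m + n) \<subseteq> (\<otimes>) z ` P m" for m
  proof (induction m)
    case 0
    have "a \<otimes> (z \<otimes> x 0) \<in> (\<otimes>) z ` P 0" if "a \<in> carrier A" for a
      using that Z_lcomm[OF z(1) that x_closed] r_cosetI[OF that, of "x 0"] by simp
    then have "carrier A #> (z \<otimes> x 0) \<subseteq> (\<otimes>) z ` P 0"
      unfolding r_coset_def[of _ _ "z \<otimes> x 0"] by blast
    then show ?case using n by simp
  next
    case (Suc m)
    have "j \<otimes> x (m + n) \<in> (\<otimes>) z ` P (Suc m)" if j: "j \<in> J" for j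
    proof -
      have "x (m + n) \<in> (\<otimes>) z ` P m" using Suc principal_self[OF x_closed] by blast
      then obtain a where a: "a \<in> carrier A" "x (m + n) = z \<otimes> (a \<otimes> x m)"
        by (auto simp: mem_r_coset_iff)
      have "j \<otimes> x (m + n) = z \<otimes> ((j \<otimes> a) \<otimes> x m)"
        unfolding a(2) using Z_lcomm[OF z(1), of j "a \<otimes> x m"] a(1) j x_closed by (simp add: m_assoc)
      moreover have "(j \<otimes> a) \<otimes> x m \<in> P (Suc m)"
        using J_rmult[OF a(1) j] unfolding J_x[symmetric] by (auto simp: mem_r_coset_iff)
      ultimately show ?thesis by blast
    qed
    then have "J #> x (m + n) \<subseteq> (\<otimes>) z ` P (Suc m)"
      unfolding r_coset_def[of _ J] by blast
    then show ?case using J_x by simp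
  qed
  define W where "W = (\<Inter>k :: nat. (\<otimes>) (z [^] k) ` P 0)"
  \<comment> \<open>Each application of \<open>shift\<close> trades \<open>n\<close> indices for one
    factor \<open>z\<close>.\<close>
  have PW: "P (k * n) \<subseteq> (\<otimes>) (z [^] k) ` P 0" for k :: nat
  proof (induction k)
    case 0
    have "y \<in> (\<otimes>) (z [^] (0 :: nat)) ` P 0" if "y \<in> P 0" for y
      by (rule image_eqI[OF _ that]) (use that P_carrier[of 0] in auto)
    then show ?case by (simp add: subset_iff)
  next
    case (Suc k)
    have "P (k * n + n) \<subseteq> (\<otimes>) z ` P (k * n)" by (rule shift)
    also have "\<dots> \<subseteq> (\<otimes>) z ` ((\<otimes>) (z [^] k) ` P 0)" using Suc by blast
    also have "\<dots> \<subseteq> (\<otimes>) (z [^] Suc k) ` P 0"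
    proof
      fix y assume "y \<in> (\<otimes>) z ` ((\<otimes>) (z [^] k) ` P 0)"
      then obtain p where p: "p \<in> P 0" "y = z \<otimes> (z [^] k \<otimes> p)" by blast
      have "y = (z [^] Suc k) \<otimes> p"
        using p P_carrier[of 0] Z_pow_Suc_mult[OF z(1), of p k] by auto
      then show "y \<in> (\<otimes>) (z [^] Suc k) ` P 0" using p by blast
    qed
    finally show ?case by (simp add: add.commute)
  qed
  then have UW: "U \<subseteq> W" unfolding W_def by blast
  have WC: "W \<subseteq> carrier A"
  proof -
    have "W \<subseteq> (\<otimes>) (z [^] (0::nat)) ` P 0" unfolding W_def by blast
    also have "\<dots> \<subseteq> carrier A" using P_carrier[of 0] by auto
    finally show ?thesis .
  qed
  define K where "K k = {y \<in> P 0. z [^] k \<otimes> y = \<zero>}" for k :: nat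
  have "left_ideal (K k)" for k
  proof -
    note D = left_idealD[OF P_left_ideal[of 0]]
    have c: "y \<in> carrier A" if "y \<in> P 0" for y using that P_carrier by blast
    show ?thesis
      unfolding left_ideal_iff
    proof (intro conjI ballI)
      show "K k \<subseteq> carrier A" unfolding K_def using c by blast
      show "\<zero> \<in> K k" unfolding K_def using D(2) pc by simp
      show "y \<oplus> y' \<in> K k" if "y \<in> K k" "y' \<in> K k" for y y'
        using that D(3) c pc by (simp add: K_def r_distr)
      show "b \<otimes> y \<in> K k" if "b \<in> carrier A" "y \<in> K k" for b y
        using that D(4) c Z_lcomm[OF Z_pow[OF z(1), of k], of b y] by (simp add: K_def)
    qed
  qed
  moreover have "K k \<subseteq> K (Suc k)" for k
  proof
    fix y assume y: "y \<in> K k"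
    then have "z [^] Suc k \<otimes> y = z \<otimes> (z [^] k \<otimes> y)"
      using P_carrier[of 0] by (intro Z_pow_Suc_mult[OF z(1)]) (auto simp: K_def)
    then show "y \<in> K (Suc k)" using y zc by (auto simp: K_def)
  qed
  ultimately have "\<exists>n. \<forall>i \<ge> n. K i = K n" by (rule acc_moduleD[OF acc_regular])
  then obtain n where n: "\<And>i. i \<ge> n \<Longrightarrow> K i = K n" by blast
  have "\<exists>y' \<in> W. y = z \<otimes> y'" if y: "y \<in> W" for y
  proof -
    have "\<exists>a. a \<in> P 0 \<and> y = z [^] k \<otimes> a" for k :: nat
    proof -
      have "y \<in> (\<otimes>) (z [^] k) ` P 0" using y unfolding W_def by (rule INT_D) simp
      then show ?thesis by blast
    qed
    then have "\<exists>a. \<forall>k :: nat. a k \<in> P 0 \<and> y = z [^] k \<otimes> a k" by (intro choice allI)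
    then obtain a where a: "\<And>k. a k \<in> P 0" "\<And>k :: nat. y = z [^] k \<otimes> a k" by blast
    have ac: "a k \<in> carrier A" for k using a(1) P_carrier by blast
    \<comment> \<open>The exponent is one less than in
      \<open>y = z [^] Suc n \<otimes> a (Suc n)\<close>, whence \<open>y = z \<otimes> y'\<close>.
      Taking \<open>n\<close> past the stabilisation of the annihilators makes \<open>y'\<close>
      itself infinitely divisible.\<close>
    define y' where "y' = z [^] n \<otimes> a (Suc n)"
    have yy: "y = z \<otimes> y'"
      using a(2)[of "Suc n"] Z_pow_Suc_mult[OF z(1) ac, of n "Suc n"] unfolding y'_def by simp
    \<comment> \<open>The difference \<open>?d\<close> of the two candidates is killed by
      \<open>z [^] Suc n\<close>, because both yield \<open>y\<close>; by the choice of
      \<open>n\<close> it is already killed by \<open>z [^] n\<close>.\<close>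
    have big: "y' = z [^] m \<otimes> a (Suc m)" if m: "m \<ge> n" for m
    proof -
      let ?d = "a (Suc n) \<ominus> z [^] (m - n) \<otimes> a (Suc m)"
      have zm: "z [^] (m - n) \<otimes> a (Suc m) \<in> P 0"
        using left_idealD(4)[OF P_left_ideal pc a(1)] .
      have d0: "?d \<in> P 0" by (rule left_idealD(6)[OF P_left_ideal a(1) zm])
      have e: "z [^] k \<otimes> ?d = z [^] k \<otimes> a (Suc n) \<ominus> z [^] (k + (m - n)) \<otimes> a (Suc m)" for k :: nat
        using ac pc zc by (simp add: minus_eq r_distr r_minus m_assoc[symmetric] nat_pow_mult)
      have "Suc n + (m - n) = Suc m" using m by simp
      then have "z [^] Suc n \<otimes> ?d = y \<ominus> y"
        using e[of "Suc n"] a(2)[of "Suc n", symmetric] a(2)[of "Suc m", symmetric] by simp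
      moreover have "y \<in> carrier A" using y WC by blast
      ultimately have "?d \<in> K (Suc n)" using d0 unfolding K_def by (simp add: minus_eq r_neg)
      then have "?d \<in> K n" using n[of "Suc n"] by simp
      then have "z [^] n \<otimes> a (Suc n) \<ominus> z [^] (n + (m - n)) \<otimes> a (Suc m) = \<zero>"
        using e[of n] by (simp add: K_def)
      then show ?thesis
        using m ac pc unfolding y'_def by (simp add: r_right_minus_eq)
    qed
    have "y' \<in> (\<otimes>) (z [^] k) ` P 0" for k :: nat
    proof (cases "k \<le> n")
      case True
      have "y' = z [^] k \<otimes> (z [^] (n - k) \<otimes> a (Suc n))"
        unfolding y'_def using True ac pc zc by (simp add: m_assoc[symmetric] nat_pow_mult)
      moreover have "z [^] (n - k) \<otimes> a (Suc n) \<in> P 0"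
        using left_idealD(4)[OF P_left_ideal pc a(1)] .
      ultimately show ?thesis by blast
    next
      case False
      then show ?thesis using big[of k] a(1) by auto
    qed
    then have "y' \<in> W" unfolding W_def by blast
    then show ?thesis using yy by blast
  qed
  then have "W \<subseteq> {\<zero>}" by (rule divisible_zero[OF WC z])
  then show ?thesis using UW left_idealD(2)[OF U_left_ideal] by blast
qed

text \<open>The span of \<open>x 0\<close> up to \<open>x (n - 1)\<close>: the term
  \<open>x n\<close>, which generates \<open>P n\<close>, is the first one left out.\<close>

primrec scalar_span :: "nat \<Rightarrow> 'a set" where
  "scalar_span 0 = {\<zero>}"
| "scalar_span (Suc n) = {g \<oplus> z \<otimes> x n | g z. g \<in> scalar_span n \<and> z \<in> Z}"

lemma scalar_span_zsub: "zsub (scalar_span n)"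
proof (induction n)
  case 0
  then show ?case by (simp add: scalar_submodule_def)
next
  case (Suc n)
  note S = zsubD[OF Suc]
  show ?case
    unfolding scalar_submodule_def
  proof (intro conjI ballI)
    show "scalar_span (Suc n) \<subseteq> carrier A" using S(1) x_closed by auto
    have "\<zero> = \<zero> \<oplus> \<zero> \<otimes> x n" using x_closed by simp
    then show "\<zero> \<in> scalar_span (Suc n)" using S(2) Z_zero by auto
    show "a \<oplus> b \<in> scalar_span (Suc n)"
      if ab: "a \<in> scalar_span (Suc n)" "b \<in> scalar_span (Suc n)" for a b
    proof -
      obtain g z k y where g: "g \<in> scalar_span n" "z \<in> Z" "a = g \<oplus> z \<otimes> x n"
        "k \<in> scalar_span n" "y \<in> Z" "b = k \<oplus> y \<otimes> x n" using ab by auto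
      have "a \<oplus> b = (g \<oplus> k) \<oplus> (z \<oplus> y) \<otimes> x n"
        using g S(1) x_closed by (simp add: l_distr a_ac subset_iff)
      moreover have "g \<oplus> k \<in> scalar_span n" "z \<oplus> y \<in> Z" using g S(3) Z_add by auto
      ultimately show ?thesis by auto
    qed
    show "y \<otimes> a \<in> scalar_span (Suc n)" if ya: "y \<in> Z" "a \<in> scalar_span (Suc n)" for y a
    proof -
      obtain g z where g: "g \<in> scalar_span n" "z \<in> Z" "a = g \<oplus> z \<otimes> x n" using ya by auto
      have "y \<otimes> a = y \<otimes> g \<oplus> (y \<otimes> z) \<otimes> x n"
        using g S(1) x_closed ya by (simp add: r_distr m_assoc subset_iff)
      moreover have "y \<otimes> g \<in> scalar_span n" "y \<otimes> z \<in> Z" using g S(4) Z_mult ya by auto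
      ultimately show ?thesis by auto
    qed
  qed
qed

lemma scalar_span_Suc: "scalar_span n \<subseteq> scalar_span (Suc n)"
proof
  fix g assume g: "g \<in> scalar_span n"
  then have "g \<in> carrier A" using zsubD(1)[OF scalar_span_zsub] by blast
  then have "g = g \<oplus> \<zero> \<otimes> x n" using x_closed by simp
  then show "g \<in> scalar_span (Suc n)" using g Z_zero by auto
qed

text \<open>
  If no \<open>x\<^sub>n\<close> vanished, the \<open>x\<^sub>n\<close> would be linearly independent modulo \<open>U\<close> over the residue field, against the
  ascending chain condition on scalar submodules.
\<close>

lemma scalar_span_Int:
  assumes zU: "\<And>z. z \<in> Z \<Longrightarrow> z \<in> J \<Longrightarrow> z \<otimes> x 0 \<in> U" and nz: "\<And>n. x n \<noteq> \<zero>"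
  shows "scalar_span n \<inter> P n \<subseteq> U"
proof (induction n)
  case 0
  then show ?case using left_idealD(2)[OF U_left_ideal] by auto
next
  case (Suc n)
  show ?case
  proof
    fix y assume "y \<in> scalar_span (Suc n) \<inter> P (Suc n)"
    then obtain g z where g: "g \<in> scalar_span n" "z \<in> Z" "y = g \<oplus> z \<otimes> x n" and y: "y \<in> P (Suc n)"
      by auto
    have c: "g \<in> carrier A" using zsubD(1)[OF scalar_span_zsub] g(1) by blast
    have c: "g \<in> carrier A" "z \<otimes> x n \<in> carrier A" "y \<in> carrier A"
      using c g(2) x_closed P_carrier[of "Suc n"] y by (simp_all add: subsetD)
    have zP: "z \<otimes> x n \<in> P n" using g by (auto simp: mem_r_coset_iff)
    have "g = y \<ominus> z \<otimes> x n" using g(3) c by (simp add: minus_eq a_assoc r_neg)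
    also have "\<dots> \<in> P n"
      using left_idealD(6)[OF P_left_ideal _ zP] y P_Suc by blast
    finally have gU: "g \<in> U" using Suc g by blast
    have "z \<otimes> x n = y \<ominus> g" using g(3) c by (simp add: minus_eq a_ac r_neg2)
    also have "\<dots> \<in> P (Suc n)"
      by (rule left_idealD(6)[OF P_left_ideal y]) (use gU in blast)
    finally have zS: "z \<otimes> x n \<in> P (Suc n)" .
    \<comment> \<open>An invertible \<open>z\<close> would put \<open>x n\<close> into
      \<open>P (Suc n)\<close>, that is into \<open>J x n\<close>, and force it to be zero.\<close>
    have "z \<in> J"
    proof (rule ccontr)
      assume "z \<notin> J"
      then obtain z' where z': "z' \<in> Z" "z \<otimes> z' = \<one>" using Z_local[OF g(2)] by blast
      have "z' \<otimes> z = \<one>" using z' g(2) Z_central by simp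
      then have "z' \<otimes> (z \<otimes> x n) = x n" using z' g(2) x_closed by (simp add: m_assoc[symmetric])
      moreover have "z' \<otimes> (z \<otimes> x n) \<in> P (Suc n)"
        using left_idealD(4)[OF P_left_ideal _ zS] z'(1) by simp
      ultimately show False using eq_zero_of_mem_Suc nz by simp
    qed
    then have "z \<otimes> x 0 \<in> U" using zU g by blast
    \<comment> \<open>As a multiple of \<open>x 0\<close>, the term \<open>x n\<close> inherits that
      \<open>z\<close> moves it into \<open>U\<close>.\<close>
    moreover obtain a where a: "a \<in> carrier A" "x n = a \<otimes> x 0"
      using principal_self[OF x_closed, of n] P_antimono[of 0 n] mem_r_coset_iff[of "x n" A "carrier A" "x 0"]
      by blast
    moreover have "z \<otimes> x n = a \<otimes> (z \<otimes> x 0)" using Z_lcomm[OF g(2) a(1) x_closed] a(2) by simp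
    ultimately have "z \<otimes> x n \<in> U" using left_idealD(4)[OF U_left_ideal] by metis
    then show "y \<in> U" unfolding g(3) by (rule left_idealD(3)[OF U_left_ideal gU])
  qed
qed

text \<open>Three cases: some term vanishes; a nonunit scalar moves \<open>x 0\<close> out of
  \<open>U\<close>; or nonunit scalars act as zero modulo \<open>U\<close>. In the last case the
  stabilised \<open>scalar_span\<close> captures a later term \<open>x n\<close>, which then lies in
  \<open>U\<close> and so in \<open>J x n\<close>.\<close>

lemma U_zero: "U = {\<zero>}"
proof (cases "\<exists>n. x n = \<zero>")
  case True
  then show ?thesis using U_zero_of_zero by blast
next
  case nz: False
  show ?thesis
  proof (cases "\<exists>z \<in> Z. z \<in> J \<and> z \<otimes> x 0 \<notin> U")
    case True
    then show ?thesis using U_zero_divisible by blast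
  next
    case False
    obtain n where n: "\<And>i. i \<ge> n \<Longrightarrow> scalar_span i = scalar_span n"
      using Z_acc[of scalar_span, OF scalar_span_zsub scalar_span_Suc] by blast
    have "x n = \<zero> \<oplus> \<one> \<otimes> x n" using x_closed by simp
    then have "x n \<in> scalar_span (Suc n)"
      using Z_one zsubD(2)[OF scalar_span_zsub] by auto
    then have "x n \<in> scalar_span n" using n[OF le_SucI[OF order.refl]] by blast
    moreover have "x n \<in> P n" using principal_self[OF x_closed] .
    ultimately have "x n \<in> U" using scalar_span_Int[of n] False nz by blast
    then have "x n \<in> P (Suc n)" by blast
    then show ?thesis using eq_zero_of_mem_Suc nz by blast
  qed
qed

lemma left_ideals_below:
  assumes "left_ideal N" "N \<subseteq> P 0"
  shows "N = {\<zero>} \<or> (\<exists>n. N = P n)"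
  using below_U_or_term[OF assms] left_idealD(2)[OF assms(1)] U_zero by auto

end

section \<open>String algebras and words\<close>

context quiver_algebra
begin

text \<open>A nonempty word that survives multiplication by \<open>e v\<close> on the right ends in
  an arrow with tail \<open>v\<close>, and so is a left multiple of that arrow.\<close>

lemma J_e_mem_left_ideal:
  assumes v: "v \<in> V" and N: "left_ideal N" and a: "\<And>a. a \<in> E \<Longrightarrow> t a = v \<Longrightarrow> arr a \<in> N" and j: "j \<in> J"
  shows "j \<otimes> e v \<in> N"
proof -
  have "J \<subseteq> {y \<in> carrier A. y \<otimes> e v \<in> N}"
  proof (rule J_least[OF zsub_right_quotient[OF left_ideal_zsub[OF N] e_closed[OF v]]])
    fix as assume as: "as \<noteq> []" "set as \<subseteq> E"
    obtain bs d where bs: "as = bs @ [d]" using as(1) rev_exhaust by blast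
    have E: "set bs \<subseteq> E" "d \<in> E" using as bs by auto
    have "word as \<otimes> e v \<in> N"
    proof (cases "v = t d")
      case True
      then have "word as \<otimes> e v = word bs \<otimes> arr d"
        using word_e[OF as] bs E by (simp add: word_append arr_closed)
      then show ?thesis using left_idealD(4)[OF N] a[OF E(2)] True E by simp
    next
      case False
      then show ?thesis using word_e_other[OF as v] bs left_idealD(2)[OF N] by simp
    qed
    then show "word as \<in> {y \<in> carrier A. y \<otimes> e v \<in> N}" using as by simp
  qed
  then show ?thesis using j by blast
qed

end

text \<open>Directness is stated for pairs: at most two arrows share a tail or a head, so the sum
  over the other arrows has at most one term. Composability is not listed in the special conditions,
  since a nonzero product of two arrows implies it.\<close>

locale string_quiver_algebra = local_quiver_algebra A V E h t e arr Z
  for A :: "('a, 'c) ring_scheme" (structure) and V :: "'v set" and E :: "'e set"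
    and h t e arr Z +
  assumes direct_left: "a \<in> E \<Longrightarrow> b \<in> E \<Longrightarrow> a \<noteq> b \<Longrightarrow> t a = t b \<Longrightarrow>
      (carrier A #> arr a) \<inter> (carrier A #> arr b) = {\<zero>}"
    and direct_right: "a \<in> E \<Longrightarrow> b \<in> E \<Longrightarrow> a \<noteq> b \<Longrightarrow> h a = h b \<Longrightarrow>
      (arr a <# carrier A) \<inter> (arr b <# carrier A) = {\<zero>}"
    and degree_left: "v \<in> V \<Longrightarrow> card {a \<in> E. t a = v} \<le> 2"
    and degree_right: "v \<in> V \<Longrightarrow> card {a \<in> E. h a = v} \<le> 2"
    and arr_nonzero: "a \<in> E \<Longrightarrow> arr a \<noteq> \<zero>"
    and special_left: "a \<in> E \<Longrightarrow> a' \<in> E \<Longrightarrow> b \<in> E \<Longrightarrow> arr a \<otimes> arr b \<noteq> \<zero> \<Longrightarrow>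
      arr a' \<otimes> arr b \<noteq> \<zero> \<Longrightarrow> a = a'"
    and special_right: "a \<in> E \<Longrightarrow> a' \<in> E \<Longrightarrow> b \<in> E \<Longrightarrow> arr b \<otimes> arr a \<noteq> \<zero> \<Longrightarrow>
      arr b \<otimes> arr a' \<noteq> \<zero> \<Longrightarrow> a = a'"
begin

section \<open>Uniqueness of nonzero words\<close>

lemma card_le_2_cases:
  assumes "finite S" "card S \<le> 2"
  obtains "S = {}" | a where "S = {a}" | a b where "a \<noteq> b" "S = {a, b}"
proof -
  have "card S = 0 \<or> card S = 1 \<or> card S = 2" using assms(2) by linarith
  then show ?thesis
    using that assms(1) by (auto simp: card_1_singleton_iff card_2_iff)
qed

lemma word_Cons_Cons_nonzero:
  assumes "set (a # b # as) \<subseteq> E" "word (a # b # as) \<noteq> \<zero>"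
  shows "arr a \<otimes> arr b \<noteq> \<zero>" "word (b # as) \<noteq> \<zero>"
proof -
  have "word (a # b # as) = (arr a \<otimes> arr b) \<otimes> word as"
    using assms(1) by (simp add: m_assoc arr_closed)
  then show "arr a \<otimes> arr b \<noteq> \<zero>" using assms by auto
  have "word (a # b # as) = arr a \<otimes> word (b # as)" by simp
  then show "word (b # as) \<noteq> \<zero>" using assms arr_closed by auto
qed

lemma Cons_word_unique:
  assumes "as \<noteq> []" "set as \<subseteq> E" "b \<in> E" "c \<in> E" "word (b # as) \<noteq> \<zero>" "word (c # as) \<noteq> \<zero>"
  shows "b = c"
proof (cases as)
  case (Cons a as')
  then show ?thesis
    using word_Cons_Cons_nonzero[of b a as'] word_Cons_Cons_nonzero[of c a as'] assms
    by (intro special_left[of b c a]) auto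
qed (use assms in simp)

text \<open>Read from the left, each arrow of a nonzero word leaves one choice for the next by
  \<open>special_right\<close>, so two such words with a common left arrow agree as far as both
  extend.\<close>

lemma word_take_unique:
  assumes "as \<noteq> []" "bs \<noteq> []" "set as \<subseteq> E" "set bs \<subseteq> E" "hd as = hd bs"
    and "length as \<le> length bs" "word as \<noteq> \<zero>" "word bs \<noteq> \<zero>"
  shows "take (length as) bs = as"
  using assms
proof (induction as arbitrary: bs)
  case (Cons a as)
  then obtain bs' where bs: "bs = a # bs'" by (cases bs) auto
  show ?case
  proof (cases as)
    case Nil
    then show ?thesis using bs by simp
  next
    case as: (Cons c cs)
    then obtain d ds where bs': "bs' = d # ds" using Cons.prems bs by (cases bs') auto
    have "c = d"
      using word_Cons_Cons_nonzero(1)[of a c cs] word_Cons_Cons_nonzero(1)[of a d ds] Cons.prems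
      unfolding bs bs' as by (intro special_right[of c d a]) auto
    have "take (length as) bs' = as"
    proof (rule Cons.IH)
      show "as \<noteq> []" "bs' \<noteq> []" "hd as = hd bs'" using as bs' \<open>c = d\<close> by auto
      show "set as \<subseteq> E" "set bs' \<subseteq> E" "length as \<le> length bs'" using Cons.prems bs by auto
      show "word as \<noteq> \<zero>"
        using word_Cons_Cons_nonzero(2)[of a c cs] Cons.prems unfolding as by blast
      show "word bs' \<noteq> \<zero>"
        using word_Cons_Cons_nonzero(2)[of a d ds] Cons.prems unfolding bs bs' by blast
    qed
    then show ?thesis using bs by simp
  qed
qed simp

text \<open>A nonempty word placed before \<open>w\<close> factors through some
  \<open>d # w\<close>, and this is zero unless \<open>d = c\<close>. If every extension of
  \<open>w\<close> vanishes, any arrow may serve as \<open>c\<close> and both sides are zero; this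
  is what allows \<open>walk\<close> to continue forever.\<close>

lemma J_word_coset:
  assumes w: "w \<noteq> []" "set w \<subseteq> E" "c \<in> E" and c: "\<And>d. d \<in> E \<Longrightarrow> word (d # w) \<noteq> \<zero> \<Longrightarrow> d = c"
  shows "J #> word w = carrier A #> word (c # w)"
proof
  let ?N = "carrier A #> word (c # w)"
  have wc: "word w \<in> carrier A" "word (c # w) \<in> carrier A" using w arr_closed by auto
  note N = principal_left_ideal[OF wc(2)]
  have "J \<subseteq> {y \<in> carrier A. y \<otimes> word w \<in> ?N}"
  proof (rule J_least[OF zsub_right_quotient[OF left_ideal_zsub[OF N] wc(1)]])
    fix as assume as: "as \<noteq> []" "set as \<subseteq> E"
    obtain bs d where bs: "as = bs @ [d]" using as(1) rev_exhaust by blast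
    have E: "set bs \<subseteq> E" "d \<in> E" using as bs by auto
    have "word as \<otimes> word w = word bs \<otimes> word (d # w)"
      using bs E wc by (simp add: word_append m_assoc arr_closed)
    also have "\<dots> \<in> ?N"
    proof (cases "d = c")
      case True
      show ?thesis unfolding True using E by (intro r_cosetI) auto
    next
      case False
      then have "word (d # w) = \<zero>" using c[OF E(2)] by blast
      then show ?thesis using left_idealD(2)[OF N] E by simp
    qed
    finally show "word as \<in> {y \<in> carrier A. y \<otimes> word w \<in> ?N}" using as by simp
  qed
  then show "J #> word w \<subseteq> ?N" unfolding r_coset_def[of _ J] by blast
  show "?N \<subseteq> J #> word w"
  proof
    fix y assume "y \<in> ?N"
    then obtain a where a: "a \<in> carrier A" "y = a \<otimes> word (c # w)" by (auto simp: mem_r_coset_iff)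
    have "y = (a \<otimes> arr c) \<otimes> word w" using a w arr_closed wc by (simp add: m_assoc)
    then show "y \<in> J #> word w"
      using r_cosetI[OF J_lmult[OF a(1) arr_in_J[OF w(3)]]] by simp
  qed
qed

text \<open>
  The arrow extending a walk to a nonzero word is unique if it exists; otherwise the next word, and with it
  every later one, is zero.
\<close>

primrec walk :: "'e \<Rightarrow> nat \<Rightarrow> 'e list" where
  "walk a 0 = [a]"
| "walk a (Suc n) = (SOME c. c \<in> E \<and> (word (c # walk a n) \<noteq> \<zero> \<or> (\<forall>d \<in> E. word (d # walk a n) = \<zero>)))
     # walk a n"

lemma walk_Suc:
  assumes "a \<in> E"
  obtains c where "c \<in> E" "walk a (Suc n) = c # walk a n"
    "word (c # walk a n) \<noteq> \<zero> \<or> (\<forall>d \<in> E. word (d # walk a n) = \<zero>)"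
proof -
  let ?Q = "\<lambda>c. c \<in> E \<and> (word (c # walk a n) \<noteq> \<zero> \<or> (\<forall>d \<in> E. word (d # walk a n) = \<zero>))"
  have "\<exists>c. ?Q c"
    using assms by (cases "\<exists>d \<in> E. word (d # walk a n) \<noteq> \<zero>") auto
  then have Q: "?Q (SOME c. ?Q c)" by (rule someI_ex)
  show ?thesis
  proof (rule that)
    show "(SOME c. ?Q c) \<in> E" using Q by (rule conjunct1)
    show "walk a (Suc n) = (SOME c. ?Q c) # walk a n" by (rule walk.simps(2))
    show "word ((SOME c. ?Q c) # walk a n) \<noteq> \<zero> \<or> (\<forall>d \<in> E. word (d # walk a n) = \<zero>)"
      using Q by (rule conjunct2)
  qed
qed

lemma walk_word:
  assumes "a \<in> E"
  shows "walk a n \<noteq> []" "set (walk a n) \<subseteq> E" "last (walk a n) = a"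
proof -
  have "walk a n \<noteq> [] \<and> set (walk a n) \<subseteq> E \<and> last (walk a n) = a"
  proof (induction n)
    case (Suc n)
    obtain c where "c \<in> E" "walk a (Suc n) = c # walk a n" using walk_Suc[OF assms] .
    then show ?case using Suc by simp
  qed (use assms in simp)
  then show "walk a n \<noteq> []" "set (walk a n) \<subseteq> E" "last (walk a n) = a" by auto
qed

lemma radical_chain_walk:
  assumes "a \<in> E"
  shows "radical_chain A V E h t e arr Z (\<lambda>n. word (walk a n)) (\<lambda>n. h (hd (walk a n)))"
proof (unfold_locales)
  fix n
  note w = walk_word[OF assms, of n]
  show "word (walk a n) \<in> carrier A" using w by simp
  show "h (hd (walk a n)) \<in> V" using w hd_in_set h_V by blast
  show "e (h (hd (walk a n))) \<otimes> word (walk a n) = word (walk a n)" using e_word w by blast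
  obtain c where c: "c \<in> E" "walk a (Suc n) = c # walk a n"
    "word (c # walk a n) \<noteq> \<zero> \<or> (\<forall>d \<in> E. word (d # walk a n) = \<zero>)"
    using walk_Suc[OF assms] .
  show "J #> word (walk a n) = carrier A #> word (walk a (Suc n))"
    unfolding c(2) using Cons_word_unique[OF w(1,2) _ c(1)] c(3)
    by (intro J_word_coset w c(1)) blast
qed

lemma left_ideals_below_arrow:
  assumes "a \<in> E" "left_ideal N" "N \<subseteq> carrier A #> arr a"
  shows "N = {\<zero>} \<or> (\<exists>n. N = carrier A #> word (walk a n))"
proof -
  interpret radical_chain A V E h t e arr Z "\<lambda>n. word (walk a n)" "\<lambda>n. h (hd (walk a n))"
    by (rule radical_chain_walk[OF assms(1)])
  show ?thesis using left_ideals_below[OF assms(2)] assms(1,3) arr_closed by simp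
qed

lemma left_ideals_below_arrow_chain:
  assumes "a \<in> E" "left_ideal N" "N \<subseteq> carrier A #> arr a" "left_ideal K" "K \<subseteq> carrier A #> arr a"
  shows "N \<subseteq> K \<or> K \<subseteq> N"
proof -
  interpret radical_chain A V E h t e arr Z "\<lambda>n. word (walk a n)" "\<lambda>n. h (hd (walk a n))"
    by (rule radical_chain_walk[OF assms(1)])
  have "P m \<subseteq> P n \<or> P n \<subseteq> P m" for m n using P_antimono nat_le_linear by blast
  then show ?thesis
    using left_ideals_below_arrow[OF assms(1-3)] left_ideals_below_arrow[OF assms(1,4,5)]
      left_idealD(2)[OF assms(2)] left_idealD(2)[OF assms(4)] by auto
qed

text \<open>
  Zero stands in for a missing arrow when fewer than two arrows start at \<open>v\<close>.
\<close>

definition arrow_or_zero :: "'v \<Rightarrow> 'a \<Rightarrow> bool" where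
  "arrow_or_zero v b \<longleftrightarrow> b = \<zero> \<or> (\<exists>a \<in> E. t a = v \<and> b = arr a)"

lemma arrow_or_zeroD:
  assumes "arrow_or_zero v b"
  shows "b \<in> carrier A" "b \<in> J" "v \<in> V \<Longrightarrow> b \<otimes> e v = b"
  using assms zsubD(2)[OF zsub_J] unfolding arrow_or_zero_def
  by (auto simp: arr_closed arr_in_J arr_e e_closed)

text \<open>The sum of \<open>A b\<close> and \<open>A c\<close> is a left ideal that contains every
  arrow with tail \<open>v\<close>, hence contains \<open>J e v\<close>. The trivial intersection
  comes from directness and later makes the decomposition unique.\<close>

lemma radical_summands:
  assumes v: "v \<in> V"
  obtains b c where "arrow_or_zero v b" "arrow_or_zero v c"
    "(carrier A #> b) \<inter> (carrier A #> c) = {\<zero>}"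
    "\<And>j. j \<in> J \<Longrightarrow> \<exists>y \<in> carrier A #> b. \<exists>y' \<in> carrier A #> c. j \<otimes> e v = y \<oplus> y'"
proof -
  have "\<exists>b c. arrow_or_zero v b \<and> arrow_or_zero v c \<and> (carrier A #> b) \<inter> (carrier A #> c) = {\<zero>} \<and>
    (\<forall>a \<in> E. t a = v \<longrightarrow> arr a = b \<or> arr a = c)"
  proof -
    have "carrier A #> \<zero> \<subseteq> {\<zero>}" by (auto simp: mem_r_coset_iff)
    then have z: "carrier A #> \<zero> = {\<zero>}" using principal_self[OF zero_closed] by blast
    have fin: "finite {a \<in> E. t a = v}" using finite_E by simp
    consider "{a \<in> E. t a = v} = {}" | a where "{a \<in> E. t a = v} = {a}"
      | a b where "a \<noteq> b" "{a \<in> E. t a = v} = {a, b}"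
      using card_le_2_cases[OF fin degree_left[OF v]] .
    then show ?thesis
    proof cases
      case 1
      then show ?thesis using z by (intro exI[of _ \<zero>]) (auto simp: arrow_or_zero_def)
    next
      case (2 a)
      then have a: "a \<in> E" "t a = v" "\<And>b. b \<in> E \<Longrightarrow> t b = v \<Longrightarrow> b = a" by auto
      have "\<zero> \<in> carrier A #> arr a"
        using left_idealD(2)[OF principal_left_ideal[OF arr_closed[OF a(1)]]] .
      then have "(carrier A #> arr a) \<inter> (carrier A #> \<zero>) = {\<zero>}" unfolding z by blast
      moreover have "arrow_or_zero v (arr a)" "arrow_or_zero v \<zero>"
        using a unfolding arrow_or_zero_def by blast+
      moreover have "\<forall>c \<in> E. t c = v \<longrightarrow> arr c = arr a \<or> arr c = \<zero>" using a(3) by blast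
      ultimately show ?thesis by blast
    next
      case (3 a b)
      then have a: "a \<in> E" "t a = v" "b \<in> E" "t b = v" "\<And>c. c \<in> E \<Longrightarrow> t c = v \<Longrightarrow> c = a \<or> c = b"
        by auto
      then show ?thesis using direct_left[OF a(1,3) 3(1)]
        by (intro exI[of _ "arr a"] exI[of _ "arr b"]) (auto simp: arrow_or_zero_def)
    qed
  qed
  then obtain b c where bc: "arrow_or_zero v b" "arrow_or_zero v c"
    "(carrier A #> b) \<inter> (carrier A #> c) = {\<zero>}" "\<And>a. a \<in> E \<Longrightarrow> t a = v \<Longrightarrow> arr a = b \<or> arr a = c"
    by blast
  note c = arrow_or_zeroD(1)[OF bc(1)] arrow_or_zeroD(1)[OF bc(2)]
  let ?N = "(carrier A #> b) <+>\<^bsub>regular_module A\<^esub> (carrier A #> c)"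
  have N: "left_ideal ?N"
    by (rule reg.submodule_set_add[OF principal_left_ideal[OF c(1)] principal_left_ideal[OF c(2)]])
  have "b \<in> ?N" "c \<in> ?N"
    using reg.set_add_upper[OF principal_left_ideal[OF c(1)] principal_left_ideal[OF c(2)]]
      principal_self[OF c(1)] principal_self[OF c(2)] by blast+
  then have "j \<otimes> e v \<in> ?N" if "j \<in> J" for j
    using J_e_mem_left_ideal[OF v N _ that] bc(4) by metis
  then show ?thesis using that[OF bc(1-3)] by (simp add: mem_set_add_iff)
qed

text \<open>If both products survived, specialness would make the two arrows equal, and an arrow
  lying in both ideals would be zero.\<close>

lemma radical_summands_special:
  assumes bc: "arrow_or_zero v b" "arrow_or_zero v c" "(carrier A #> b) \<inter> (carrier A #> c) = {\<zero>}"
    and p: "p \<noteq> []" "set p \<subseteq> E"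
  shows "b \<otimes> word p = \<zero> \<or> c \<otimes> word p = \<zero>"
proof (rule ccontr)
  assume n: "\<not> ?thesis"
  have wp: "word p \<in> carrier A" using p by simp
  obtain a where a: "a \<in> E" "b = arr a"
    using bc(1) n wp unfolding arrow_or_zero_def by auto
  obtain a' where a': "a' \<in> E" "c = arr a'"
    using bc(2) n wp unfolding arrow_or_zero_def by auto
  have "a = a'" using Cons_word_unique[OF p a(1) a'(1)] n a a' by simp
  then have "b \<in> {\<zero>}" using bc(3) a a' principal_self[OF arr_closed[OF a(1)]] by auto
  then show False using arr_nonzero a by auto
qed

text \<open>
  Modulo the component starting with the other arrow into \<open>h b\<close>, every element of \<open>Jp\<close> is a combination of
  longer words with left arrow \<open>b\<close>, and these start with \<open>p\<close> by \<open>word_take_unique\<close>.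
\<close>

lemma J_word_Int_right:
  assumes p: "p \<noteq> []" "set p \<subseteq> E" "word p \<noteq> \<zero>" and b: "b = hd p"
  shows "(J #> word p) \<inter> (arr b <# carrier A) \<subseteq> word p <# J"
proof
  fix y assume "y \<in> (J #> word p) \<inter> (arr b <# carrier A)"
  then obtain j l where j: "j \<in> J" "y = j \<otimes> word p" and l: "l \<in> carrier A" "y = arr b \<otimes> l"
    by (auto simp: mem_r_coset_iff mem_l_coset_iff)
  have bE: "b \<in> E" using p b by (cases p) auto
  have wp: "word p \<in> carrier A" using p by simp
  have eb: "e (h b) \<in> carrier A" using e_closed h_V bE by blast
  \<comment> \<open>\<open>s\<close> is the other arrow with head \<open>h b\<close>, or zero if
    \<open>b\<close> is the only one.\<close>
  have "\<exists>s \<in> carrier A. (\<forall>c \<in> E. h c = h b \<longrightarrow> c = b \<or> arr c = s) \<and>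
    (s = \<zero> \<or> (\<exists>c \<in> E. c \<noteq> b \<and> h c = h b \<and> s = arr c))"
  proof -
    have fin: "finite {a \<in> E. h a = h b}" using finite_E by simp
    consider "{a \<in> E. h a = h b} = {}" | a where "{a \<in> E. h a = h b} = {a}"
      | a c where "a \<noteq> c" "{a \<in> E. h a = h b} = {a, c}"
      using card_le_2_cases[OF fin degree_right[OF h_V[OF bE]]] .
    then show ?thesis
    proof cases
      case 1
      then show ?thesis using bE by auto
    next
      case (2 a)
      have "b \<in> {a \<in> E. h a = h b}" using bE by simp
      then have "{c \<in> E. h c = h b} = {b}" using 2 by auto
      then show ?thesis by (intro bexI[of _ \<zero>]) auto
    next
      case (3 a c)
      define d where "d = (if a = b then c else a)"
      have "d \<in> {a \<in> E. h a = h b}" "b \<in> {a \<in> E. h a = h b}" using 3 bE unfolding d_def by auto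
      then have "d \<in> E" "h d = h b" "d \<noteq> b" "\<And>x. x \<in> E \<Longrightarrow> h x = h b \<Longrightarrow> x = b \<or> x = d"
        using 3 unfolding d_def by (auto split: if_splits)
      then show ?thesis using arr_closed by (intro bexI[of _ "arr d"]) auto
    qed
  qed
  then obtain s where s: "s \<in> carrier A" "\<And>c. c \<in> E \<Longrightarrow> h c = h b \<Longrightarrow> c = b \<or> arr c = s"
    "s = \<zero> \<or> (\<exists>c \<in> E. c \<noteq> b \<and> h c = h b \<and> s = arr c)" by blast
  \<comment> \<open>The factor \<open>e (h b)\<close> discards the words with another head. A
    remaining word \<open>as @ p\<close> has left arrow \<open>b\<close>, and then contributes to
    \<open>word p \<otimes> j\<close>, or it has the other arrow in front, and then contributes to
    \<open>s \<otimes> x\<close>.\<close>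
  let ?N = "{y \<in> carrier A. \<exists>j \<in> J. \<exists>x \<in> carrier A. e (h b) \<otimes> (y \<otimes> word p) = word p \<otimes> j \<oplus> s \<otimes> x}"
  have J0: "\<zero> \<in> J" using zsubD(2)[OF zsub_J] .
  have "J \<subseteq> ?N"
  proof (rule J_least)
    show "zsub ?N"
      unfolding scalar_submodule_def
    proof (intro conjI ballI)
      show "?N \<subseteq> carrier A" by auto
      have "e (h b) \<otimes> (\<zero> \<otimes> word p) = word p \<otimes> \<zero> \<oplus> s \<otimes> \<zero>" using wp eb s by simp
      then show "\<zero> \<in> ?N" using J0 by blast
      show "x \<oplus> y \<in> ?N" if xy: "x \<in> ?N" "y \<in> ?N" for x y
      proof -
        obtain j k u w where x: "x \<in> carrier A" "j \<in> J" "u \<in> carrier A"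
          "e (h b) \<otimes> (x \<otimes> word p) = word p \<otimes> j \<oplus> s \<otimes> u"
          and y: "y \<in> carrier A" "k \<in> J" "w \<in> carrier A"
          "e (h b) \<otimes> (y \<otimes> word p) = word p \<otimes> k \<oplus> s \<otimes> w" using xy by blast
        have "e (h b) \<otimes> ((x \<oplus> y) \<otimes> word p) = word p \<otimes> (j \<oplus> k) \<oplus> s \<otimes> (u \<oplus> w)"
          using x y wp eb s by (simp add: l_distr r_distr a_ac)
        moreover have "j \<oplus> k \<in> J" using zsubD(3)[OF zsub_J] x y by blast
        moreover have "u \<oplus> w \<in> carrier A" "x \<oplus> y \<in> carrier A" using x y by auto
        ultimately show ?thesis by blast
      qed
      show "z \<otimes> x \<in> ?N" if zx: "z \<in> Z" "x \<in> ?N" for z x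
      proof -
        obtain j u where x: "x \<in> carrier A" "j \<in> J" "u \<in> carrier A"
          "e (h b) \<otimes> (x \<otimes> word p) = word p \<otimes> j \<oplus> s \<otimes> u" using zx by blast
        have "e (h b) \<otimes> ((z \<otimes> x) \<otimes> word p) = e (h b) \<otimes> (z \<otimes> (x \<otimes> word p))"
          using x zx wp by (simp add: m_assoc)
        also have "\<dots> = z \<otimes> (word p \<otimes> j \<oplus> s \<otimes> u)"
          using Z_lcomm[OF zx(1) eb, of "x \<otimes> word p"] x wp by simp
        also have "\<dots> = z \<otimes> (word p \<otimes> j) \<oplus> z \<otimes> (s \<otimes> u)"
          using x zx wp s by (simp add: r_distr)
        also have "\<dots> = word p \<otimes> (z \<otimes> j) \<oplus> s \<otimes> (z \<otimes> u)"
          using Z_lcomm[OF zx(1) wp, of j] Z_lcomm[OF zx(1) s(1) x(3)] x by simp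
        finally have "e (h b) \<otimes> ((z \<otimes> x) \<otimes> word p) = word p \<otimes> (z \<otimes> j) \<oplus> s \<otimes> (z \<otimes> u)" .
        moreover have "z \<otimes> j \<in> J" using zsubD(4)[OF zsub_J] zx x by blast
        moreover have "z \<otimes> u \<in> carrier A" "z \<otimes> x \<in> carrier A" using x zx by auto
        ultimately show ?thesis by blast
      qed
    qed
    fix as assume as: "as \<noteq> []" "set as \<subseteq> E"
    let ?q = "as @ p"
    have q: "?q \<noteq> []" "set ?q \<subseteq> E" "word as \<otimes> word p = word ?q" "hd ?q = hd as"
      using as p by (auto simp: word_append)
    have hE: "hd as \<in> E" using as by (cases as) auto
    have "\<exists>j \<in> J. \<exists>x \<in> carrier A. e (h b) \<otimes> word ?q = word p \<otimes> j \<oplus> s \<otimes> x"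
    proof (cases "word ?q = \<zero> \<or> h (hd as) \<noteq> h b")
      case True
      then have "e (h b) \<otimes> word ?q = \<zero>"
        using e_word_other[OF q(1,2) h_V[OF bE]] q(4) eb by auto
      then have "e (h b) \<otimes> word ?q = word p \<otimes> \<zero> \<oplus> s \<otimes> \<zero>" using wp s by simp
      then show ?thesis using J0 by blast
    next
      case False
      then have eq: "e (h b) \<otimes> word ?q = word ?q" using e_word[OF q(1,2)] q(4) by simp
      show ?thesis
      proof (cases "hd as = b")
        case True
        have "take (length p) ?q = p"
          by (rule word_take_unique) (use p q True False b in auto)
        then have d: "?q = p @ drop (length p) ?q" by (metis append_take_drop_id)
        \<comment> \<open>\<open>r\<close> is as long as \<open>as\<close>; hence it is nonempty and
          its word lies in \<open>J\<close>.\<close>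
        define r where "r = drop (length p) ?q"
        have "set r \<subseteq> set ?q" unfolding r_def by (rule set_drop_subset)
        then have r: "r \<noteq> []" "set r \<subseteq> E" "?q = p @ r"
          using as q(2) d unfolding r_def by auto
        then have "word ?q = word p \<otimes> word r \<oplus> s \<otimes> \<zero>"
          using p s(1) by (simp add: word_append)
        then show ?thesis using eq word_in_J[OF r(1,2)] zero_closed by metis
      next
        case hd: False
        then have "arr (hd as) = s" using s(2)[OF hE] False by blast
        then have "word ?q = word p \<otimes> \<zero> \<oplus> s \<otimes> word (tl as @ p)"
          using as p wp s(1) by (cases as) auto
        moreover have "word (tl as @ p) \<in> carrier A" using as p by (cases as) auto
        ultimately show ?thesis using eq J0 by metis
      qed
    qed
    then show "word as \<in> ?N" using q(3) as by simp
  qed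
  then obtain j' x where x: "j' \<in> J" "x \<in> carrier A" "e (h b) \<otimes> y = word p \<otimes> j' \<oplus> s \<otimes> x"
    using j by blast
  have "e (h b) \<otimes> y = y"
    unfolding l(2) using l(1) eb bE by (simp add: m_assoc[symmetric] arr_closed e_arr)
  then have y: "y = word p \<otimes> j' \<oplus> s \<otimes> x" using x by simp
  have yc: "y \<in> carrier A" using l bE arr_closed by simp
  \<comment> \<open>The component along \<open>s\<close> is also a right multiple of
    \<open>arr b\<close>, because both \<open>y\<close> and \<open>word p\<close> are; directness on
    the right therefore kills it.\<close>
  have "s \<otimes> x = y \<ominus> word p \<otimes> j'"
    using y x wp s yc by (simp add: minus_eq a_ac r_neg r_neg1)
  moreover have "y \<ominus> word p \<otimes> j' \<in> arr b <# carrier A"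
  proof -
    have wpt: "word p = arr b \<otimes> word (tl p)" "word (tl p) \<in> carrier A" using p b by (cases p; auto)+
    have "y \<ominus> word p \<otimes> j' = arr b \<otimes> (l \<ominus> word (tl p) \<otimes> j')"
      unfolding l(2) wpt(1) using l(1) wpt(2) x(1) arr_closed[OF bE]
      by (simp add: minus_eq r_distr r_minus m_assoc)
    then show ?thesis using l(1) wpt(2) x(1) by (auto simp: mem_l_coset_iff)
  qed
  moreover have "s \<otimes> x \<in> s <# carrier A" using x by (auto simp: mem_l_coset_iff)
  ultimately have m: "s \<otimes> x \<in> (arr b <# carrier A) \<inter> (s <# carrier A)" by simp
  have "s \<otimes> x = \<zero>"
    using s(3)
  proof
    assume "\<exists>c \<in> E. c \<noteq> b \<and> h c = h b \<and> s = arr c"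
    then show ?thesis using m direct_right[OF bE] by (metis singletonD)
  qed (use x in simp)
  then have "y = word p \<otimes> j'" using y x wp by simp
  then show "y \<in> word p <# J" using x by (auto simp: mem_l_coset_iff)
qed

end

section \<open>Cyclic modules\<close>

context quiver_algebra
begin

lemma smult_r_distr_diff:
  assumes "left_module A M" "a \<in> carrier A" "b \<in> carrier A" "x \<in> carrier M"
  shows "a \<odot>\<^bsub>M\<^esub> x = b \<odot>\<^bsub>M\<^esub> x \<longleftrightarrow> (a \<ominus> b) \<odot>\<^bsub>M\<^esub> x = \<zero>\<^bsub>M\<^esub>"
proof -
  interpret M: left_module A M by (rule assms(1))
  have "a \<odot>\<^bsub>M\<^esub> x \<in> carrier M" "b \<odot>\<^bsub>M\<^esub> x \<in> carrier M"
    using assms M.smult_closed by auto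
  then have "a \<odot>\<^bsub>M\<^esub> x = b \<odot>\<^bsub>M\<^esub> x \<longleftrightarrow> a \<odot>\<^bsub>M\<^esub> x \<ominus>\<^bsub>M\<^esub> b \<odot>\<^bsub>M\<^esub> x = \<zero>\<^bsub>M\<^esub>"
    by (metis M.M.add.inv_closed M.M.minus_equality M.M.minus_minus M.M.minus_eq M.M.r_neg)
  then show ?thesis using assms by (simp add: M.smult_l_diff)
qed

text \<open>Applied with \<open>w = e v\<close>: the map sending \<open>a\<close> to
  \<open>a x\<close> is injective on the elements fixed by right multiplication with
  \<open>e v\<close>, that is on \<open>A e v\<close>.\<close>

lemma smult_inject:
  assumes M: "left_module A M" and x: "x \<in> carrier M" and w: "w \<in> carrier A"
    and inj: "\<And>a. a \<in> carrier A \<Longrightarrow> a \<odot>\<^bsub>M\<^esub> x = \<zero>\<^bsub>M\<^esub> \<Longrightarrow> a \<otimes> w = \<zero>"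
    and ab: "a \<in> carrier A" "b \<in> carrier A" "a \<otimes> w = a" "b \<otimes> w = b" "a \<odot>\<^bsub>M\<^esub> x = b \<odot>\<^bsub>M\<^esub> x"
  shows "a = b"
proof -
  have "(a \<ominus> b) \<odot>\<^bsub>M\<^esub> x = \<zero>\<^bsub>M\<^esub>" using smult_r_distr_diff[OF M ab(1,2) x] ab(5) by simp
  then have "(a \<ominus> b) \<otimes> w = \<zero>" using inj ab by simp
  then have "a \<ominus> b = \<zero>" using ab w by (simp add: minus_eq l_distr l_minus)
  then show ?thesis using ab by simp
qed

text \<open>Together with \<open>image_submodule\<close> this moves questions on submodules of a
  cyclic module to left ideals of the ring. With \<open>K\<close> zero it yields
  annihilators.\<close>

lemma preimage_left_ideal:
  assumes M: "left_module A M" and x: "x \<in> carrier M" and K: "submodule K A M" and L: "left_ideal L"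
  shows "left_ideal {a \<in> L. a \<odot>\<^bsub>M\<^esub> x \<in> K}"
proof -
  interpret M: left_module A M by (rule M)
  note K = M.submoduleD[OF K] and L = left_idealD[OF L]
  have c: "a \<in> carrier A" if "a \<in> L" for a using that L(1) by blast
  show ?thesis
    unfolding left_ideal_iff
  proof (intro conjI ballI)
    show "{a \<in> L. a \<odot>\<^bsub>M\<^esub> x \<in> K} \<subseteq> carrier A" using L(1) by blast
    show "\<zero> \<in> {a \<in> L. a \<odot>\<^bsub>M\<^esub> x \<in> K}" using L(2) K(2) x by simp
    show "a \<oplus> b \<in> {a \<in> L. a \<odot>\<^bsub>M\<^esub> x \<in> K}"
      if "a \<in> {a \<in> L. a \<odot>\<^bsub>M\<^esub> x \<in> K}" "b \<in> {a \<in> L. a \<odot>\<^bsub>M\<^esub> x \<in> K}" for a b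
      using that L(3) K(3) c x by (simp add: M.smult_l_distr)
    show "a \<otimes> b \<in> {a \<in> L. a \<odot>\<^bsub>M\<^esub> x \<in> K}"
      if "a \<in> carrier A" "b \<in> {a \<in> L. a \<odot>\<^bsub>M\<^esub> x \<in> K}" for a b
      using that L(4) K(4) c x by (simp add: M.smult_assoc)
  qed
qed

lemma image_submodule:
  assumes M: "left_module A M" and x: "x \<in> carrier M" and L: "left_ideal L"
  shows "submodule ((\<lambda>a. a \<odot>\<^bsub>M\<^esub> x) ` L) A M"
proof -
  interpret M: left_module A M by (rule M)
  note L = left_idealD[OF L]
  have c: "a \<in> carrier A" if "a \<in> L" for a using that L(1) by blast
  show ?thesis
    unfolding M.submodule_iff
  proof (intro conjI ballI)
    show "(\<lambda>a. a \<odot>\<^bsub>M\<^esub> x) ` L \<subseteq> carrier M" using c M.smult_closed[OF _ x] by blast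
    show "\<zero>\<^bsub>M\<^esub> \<in> (\<lambda>a. a \<odot>\<^bsub>M\<^esub> x) ` L" using L(2) x by (intro image_eqI[of _ _ \<zero>]) auto
    show "y \<oplus>\<^bsub>M\<^esub> y' \<in> (\<lambda>a. a \<odot>\<^bsub>M\<^esub> x) ` L"
      if y: "y \<in> (\<lambda>a. a \<odot>\<^bsub>M\<^esub> x) ` L" "y' \<in> (\<lambda>a. a \<odot>\<^bsub>M\<^esub> x) ` L" for y y'
    proof -
      obtain a b where a: "a \<in> L" "b \<in> L" "y = a \<odot>\<^bsub>M\<^esub> x" "y' = b \<odot>\<^bsub>M\<^esub> x" using y by blast
      then show ?thesis
        using L(3) c x by (intro image_eqI[of _ _ "a \<oplus> b"]) (auto simp: M.smult_l_distr)
    qed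
    show "b \<odot>\<^bsub>M\<^esub> y \<in> (\<lambda>a. a \<odot>\<^bsub>M\<^esub> x) ` L"
      if y: "b \<in> carrier A" "y \<in> (\<lambda>a. a \<odot>\<^bsub>M\<^esub> x) ` L" for b y
    proof -
      obtain a where a: "a \<in> L" "y = a \<odot>\<^bsub>M\<^esub> x" using y by blast
      then show ?thesis
        using L(4) c x y(1) by (intro image_eqI[of _ _ "b \<otimes> a"]) (auto simp: M.smult_assoc)
    qed
  qed
qed

end

context local_quiver_algebra
begin

definition radical_multiples :: "('a, 'm) module \<Rightarrow> 'm \<Rightarrow> 'm set" where
  "radical_multiples M x = (\<lambda>j. j \<odot>\<^bsub>M\<^esub> x) ` J"

context
  fixes M :: "('a, 'm) module" and x :: 'm and v :: 'v
  assumes M: "left_module A M" and v: "v \<in> V" and x: "x \<in> carrier M" "e v \<odot>\<^bsub>M\<^esub> x = x"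
    and nz: "x \<noteq> \<zero>\<^bsub>M\<^esub>" and gen: "carrier M = (\<lambda>a. a \<odot>\<^bsub>M\<^esub> x) ` carrier A"
begin

interpretation M: left_module A M by (rule M)

lemma radical_multiples_submodule: "submodule (radical_multiples M x) A M"
  unfolding radical_multiples_def by (rule image_submodule[OF M x(1) J_left_ideal])

lemma generator_not_radical_multiple: "x \<notin> radical_multiples M x"
  using nakayama_element[OF M x(1)] nz unfolding radical_multiples_def by blast

text \<open>An element \<open>a x\<close> outside \<open>J x\<close> has \<open>a e v\<close>
  outside \<open>J\<close>, so some multiple of it is the generator \<open>x\<close>.\<close>

lemma submodule_cases:
  assumes K: "submodule K A M"
  shows "K \<subseteq> radical_multiples M x \<or> K = carrier M"
proof (cases "K \<subseteq> radical_multiples M x")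
  case False
  then obtain y where y: "y \<in> K" "y \<notin> radical_multiples M x" by blast
  note K = M.submoduleD[OF K]
  obtain a where a: "a \<in> carrier A" "y = a \<odot>\<^bsub>M\<^esub> x" using y K(1) gen by blast
  have ev: "e v \<in> carrier A" using e_closed v by simp
  have ya: "y = (a \<otimes> e v) \<odot>\<^bsub>M\<^esub> x" using a ev x by (simp add: M.smult_assoc)
  then have "a \<otimes> e v \<notin> J" using y(2) unfolding radical_multiples_def by blast
  then obtain b where b: "b \<in> carrier A" "b \<otimes> (a \<otimes> e v) = e v"
    using unit_left[OF a(1) v] by blast
  have "b \<odot>\<^bsub>M\<^esub> y = (b \<otimes> (a \<otimes> e v)) \<odot>\<^bsub>M\<^esub> x" using ya b(1) a ev x by (simp add: M.smult_assoc)
  then have "x \<in> K" using K(4)[OF b(1) y(1)] b x by simp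
  then have "carrier M \<subseteq> K" unfolding gen using K(4) by blast
  then show ?thesis using K(1) by blast
qed simp

lemma maximal_submodule_iff: "maximal_submodule K A M \<longleftrightarrow> K = radical_multiples M x"
proof
  assume K: "maximal_submodule K A M"
  then have "K \<subseteq> radical_multiples M x"
    using submodule_cases unfolding maximal_submodule_def by blast
  then show "K = radical_multiples M x"
    using K radical_multiples_submodule generator_not_radical_multiple x(1)
    unfolding maximal_submodule_def by blast
next
  assume K: "K = radical_multiples M x"
  have "radical_multiples M x \<noteq> carrier M" using generator_not_radical_multiple x(1) by blast
  then show "maximal_submodule K A M"
    using submodule_cases radical_multiples_submodule unfolding maximal_submodule_def K by blast
qed

lemma module_radical_eq: "module_radical A M = radical_multiples M x"
  using M.submoduleD(1)[OF radical_multiples_submodule]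
  unfolding module_radical_def maximal_submodule_iff by auto

end

end

context string_quiver_algebra
begin

text \<open>The preimages of two submodules are left ideals below one arrow, hence comparable, and
  their images are the submodules again.\<close>

lemma uniserial_arrow_multiple:
  assumes M: "left_module A M" and x: "x \<in> carrier M" and b: "arrow_or_zero v b"
  shows "uniserial_module A (M\<lparr>carrier := (\<lambda>a. a \<odot>\<^bsub>M\<^esub> x) ` (carrier A #> b)\<rparr>)"
proof -
  interpret M: left_module A M by (rule M)
  let ?f = "\<lambda>a. a \<odot>\<^bsub>M\<^esub> x"
  have L: "left_ideal (carrier A #> b)" by (rule principal_left_ideal[OF arrow_or_zeroD(1)[OF b]])
  have "K1 \<subseteq> K2 \<or> K2 \<subseteq> K1"
    if K: "submodule K1 A M" "submodule K2 A M" "K1 \<subseteq> ?f ` (carrier A #> b)" "K2 \<subseteq> ?f ` (carrier A #> b)"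
    for K1 K2
  proof -
    let ?L = "\<lambda>K. {a \<in> carrier A #> b. a \<odot>\<^bsub>M\<^esub> x \<in> K}"
    have im: "K1 = ?f ` ?L K1" "K2 = ?f ` ?L K2" using K(3,4) by blast+
    have l: "left_ideal (?L K1)" "left_ideal (?L K2)"
      using preimage_left_ideal[OF M x _ L] K by auto
    have "?L K1 \<subseteq> ?L K2 \<or> ?L K2 \<subseteq> ?L K1"
    proof (cases "b = \<zero>")
      case True
      have "?L K1 \<subseteq> {\<zero>}" using True by (auto simp: mem_r_coset_iff)
      then show ?thesis using left_idealD(2)[OF l(2)] by blast
    next
      case False
      then obtain a where a: "a \<in> E" "b = arr a" using b unfolding arrow_or_zero_def by blast
      show ?thesis
        by (rule left_ideals_below_arrow_chain[OF a(1) l(1) _ l(2)]) (use a in blast)+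
    qed
    then show ?thesis using im by blast
  qed
  then show ?thesis
    unfolding uniserial_module_def M.submodule_restrict_iff[OF image_submodule[OF M x L]] by blast
qed

text \<open>\<open>gen\<close> and \<open>inj\<close> say that \<open>M\<close> is a copy of
  \<open>A e v\<close> with \<open>x\<close> in the place of \<open>e v\<close>, so no isomorphism
  has to be built. In \<open>biserial_module\<close> the alternative with the radical is met for the
  sum, and the alternative with zero for the intersection.\<close>

lemma biserial_projective:
  fixes M :: "('a, 'm) module"
  assumes M: "left_module A M" and v: "v \<in> V" and x: "x \<in> carrier M" "e v \<odot>\<^bsub>M\<^esub> x = x"
    and gen: "carrier M = (\<lambda>a. a \<odot>\<^bsub>M\<^esub> x) ` carrier A"
    and inj: "\<And>a. a \<in> carrier A \<Longrightarrow> a \<odot>\<^bsub>M\<^esub> x = \<zero>\<^bsub>M\<^esub> \<Longrightarrow> a \<otimes> e v = \<zero>"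
  shows "biserial_module A M"
proof -
  interpret M: left_module A M by (rule M)
  have "x \<noteq> \<zero>\<^bsub>M\<^esub>"
  proof
    assume "x = \<zero>\<^bsub>M\<^esub>"
    then have "\<one> \<otimes> e v = \<zero>" by (intro inj) auto
    then show False using e_notin_J[OF v] zsubD(2)[OF zsub_J] e_closed[OF v] by simp
  qed
  note rad = maximal_submodule_iff[OF M v x this gen] module_radical_eq[OF M v x this gen]
  obtain b c where bc: "arrow_or_zero v b" "arrow_or_zero v c"
    "(carrier A #> b) \<inter> (carrier A #> c) = {\<zero>}"
    "\<And>j. j \<in> J \<Longrightarrow> \<exists>y \<in> carrier A #> b. \<exists>y' \<in> carrier A #> c. j \<otimes> e v = y \<oplus> y'"
    using radical_summands[OF v] by blast
  note b = arrow_or_zeroD[OF bc(1)] and c = arrow_or_zeroD[OF bc(2)]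
  let ?f = "\<lambda>a. a \<odot>\<^bsub>M\<^esub> x"
  let ?L = "?f ` (carrier A #> b)" and ?N = "?f ` (carrier A #> c)"
  have Lb: "left_ideal (carrier A #> b)" and Lc: "left_ideal (carrier A #> c)"
    using principal_left_ideal b c by auto
  have L: "submodule ?L A M" and N: "submodule ?N A M"
    using image_submodule[OF M x(1)] Lb Lc by auto
  have AJ: "carrier A #> d \<subseteq> J" if "d \<in> J" for d
    using J_lmult that by (auto simp: mem_r_coset_iff)
  have "?L <+>\<^bsub>M\<^esub> ?N = radical_multiples M x"
  proof
    show "?L <+>\<^bsub>M\<^esub> ?N \<subseteq> radical_multiples M x"
      by (rule M.set_add_least[OF radical_multiples_submodule[OF M v x \<open>x \<noteq> \<zero>\<^bsub>M\<^esub>\<close> gen]])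
        (use AJ[OF b(2)] AJ[OF c(2)] in \<open>auto simp: radical_multiples_def\<close>)
    show "radical_multiples M x \<subseteq> ?L <+>\<^bsub>M\<^esub> ?N"
    proof
      fix y assume "y \<in> radical_multiples M x"
      then obtain j where j: "j \<in> J" "y = j \<odot>\<^bsub>M\<^esub> x" unfolding radical_multiples_def by blast
      obtain l n where l: "l \<in> carrier A #> b" "n \<in> carrier A #> c" "j \<otimes> e v = l \<oplus> n"
        using bc(4)[OF j(1)] by blast
      have lc: "l \<in> carrier A" "n \<in> carrier A" using l left_idealD(1)[OF Lb] left_idealD(1)[OF Lc] by auto
      have "y = (j \<otimes> e v) \<odot>\<^bsub>M\<^esub> x" using j x e_closed[OF v] by (simp add: M.smult_assoc)
      then have "y = l \<odot>\<^bsub>M\<^esub> x \<oplus>\<^bsub>M\<^esub> n \<odot>\<^bsub>M\<^esub> x" using l(3) lc x by (simp add: M.smult_l_distr)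
      then show "y \<in> ?L <+>\<^bsub>M\<^esub> ?N" using l(1,2) unfolding mem_set_add_iff by blast
    qed
  qed
  moreover have "?L \<inter> ?N = {\<zero>\<^bsub>M\<^esub>}"
  proof
    show "?L \<inter> ?N \<subseteq> {\<zero>\<^bsub>M\<^esub>}"
    proof
      fix y assume "y \<in> ?L \<inter> ?N"
      then obtain l n where l: "l \<in> carrier A #> b" "n \<in> carrier A #> c" "y = l \<odot>\<^bsub>M\<^esub> x" "y = n \<odot>\<^bsub>M\<^esub> x"
        by blast
      have lc: "l \<in> carrier A" "n \<in> carrier A" using l left_idealD(1)[OF Lb] left_idealD(1)[OF Lc] by auto
      have le: "l \<otimes> e v = l" "n \<otimes> e v = n"
        using l(1,2) b c v e_closed[OF v] by (auto simp: mem_r_coset_iff m_assoc)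
      have "l = n" using smult_inject[OF M x(1) e_closed[OF v] inj lc le] l by simp
      then have "l = \<zero>" using l bc(3) by blast
      then show "y \<in> {\<zero>\<^bsub>M\<^esub>}" using l x by simp
    qed
    show "{\<zero>\<^bsub>M\<^esub>} \<subseteq> ?L \<inter> ?N" using M.submoduleD(2)[OF L] M.submoduleD(2)[OF N] by blast
  qed
  ultimately show ?thesis
    unfolding biserial_module_def
    using L N uniserial_arrow_multiple[OF M x(1) bc(1)] uniserial_arrow_multiple[OF M x(1) bc(2)] rad
    by metis
qed

text \<open>The counterpart of \<open>minimal_left_annihilating_path\<close> for words. The trivial
  right factor is left out, since it annihilates \<open>word p\<close> only when
  \<open>word p\<close> is zero.\<close>

definition annihilating_word :: "'e list \<Rightarrow> 'e list \<Rightarrow> bool" where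
  "annihilating_word p q \<longleftrightarrow> q \<noteq> [] \<and> set q \<subseteq> E \<and> word q \<noteq> \<zero> \<and> t (last q) = h (hd p) \<and>
     word q \<otimes> word p = \<zero> \<and>
     (\<forall>r s. q = r @ s \<and> r \<noteq> [] \<and> s \<noteq> [] \<longrightarrow> word s \<otimes> word p \<noteq> \<zero>)"

text \<open>The annihilator is a left ideal below an arrow, so it is zero or generated by a word
  \<open>q\<close> of the walk, and generation forces minimality: a proper right factor
  \<open>s\<close> of \<open>q = r @ s\<close> that annihilates \<open>p\<close> would lie in
  \<open>A q\<close>, so \<open>s = l r s\<close> with \<open>l r\<close> in \<open>J\<close>, and
  Nakayama's lemma would make \<open>s\<close> and hence \<open>q\<close> zero.\<close>

lemma annihilator_below_arrow:
  assumes p: "p \<noteq> []" "set p \<subseteq> E" and b: "arrow_or_zero (h (hd p)) b"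
  defines "K \<equiv> {a \<in> carrier A #> b. a \<otimes> word p = \<zero>}"
  shows "left_ideal K" "K = {\<zero>} \<or> (\<exists>q. annihilating_word p q \<and> K = carrier A #> word q)"
proof -
  have wp: "word p \<in> carrier A" using p by simp
  have bc: "b \<in> carrier A" using arrow_or_zeroD(1)[OF b] .
  have "left_ideal {a \<in> carrier A #> b. a \<odot>\<^bsub>regular_module A\<^esub> word p \<in> {\<zero>\<^bsub>regular_module A\<^esub>}}"
    by (rule preimage_left_ideal[OF reg.left_module_axioms _ reg.submodule_zero principal_left_ideal[OF bc]])
      (use wp in simp)
  then show K: "left_ideal K" unfolding K_def by simp
  show "K = {\<zero>} \<or> (\<exists>q. annihilating_word p q \<and> K = carrier A #> word q)"
  proof (cases "K = {\<zero>}")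
    case False
    have "b \<noteq> \<zero>"
    proof
      assume "b = \<zero>"
      then have "K \<subseteq> {\<zero>}" unfolding K_def by (auto simp: mem_r_coset_iff)
      then show False using False left_idealD(2)[OF K] by blast
    qed
    then obtain a where a: "a \<in> E" "t a = h (hd p)" "b = arr a"
      using b unfolding arrow_or_zero_def by blast
    have "K \<subseteq> carrier A #> arr a" unfolding K_def a(3) by blast
    then obtain n where n: "K = carrier A #> word (walk a n)"
      using left_ideals_below_arrow[OF a(1) K] False by blast
    let ?q = "walk a n"
    note q = walk_word[OF a(1), of n]
    have wq: "word ?q \<in> carrier A" using q by simp
    have nz: "word ?q \<noteq> \<zero>"
    proof
      assume "word ?q = \<zero>"
      then have "K \<subseteq> {\<zero>}" unfolding n by (auto simp: mem_r_coset_iff)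
      then show False using False left_idealD(2)[OF K] by blast
    qed
    have "word ?q \<in> K" using principal_self[OF wq] unfolding n .
    then have "word ?q \<otimes> word p = \<zero>" unfolding K_def by blast
    moreover have "word s \<otimes> word p \<noteq> \<zero>" if rs: "?q = r @ s" "r \<noteq> []" "s \<noteq> []" for r s
    proof
      assume s0: "word s \<otimes> word p = \<zero>"
      have E: "set r \<subseteq> E" "set s \<subseteq> E" using q(2) rs(1) by auto
      have "last s = a" using q(3) rs by simp
      then have "s = butlast s @ [a]" using rs(3) append_butlast_last_id by metis
      then have "word s = word (butlast s) \<otimes> arr a"
        using E a(1) arr_closed word_append[of "butlast s" "[a]"] by (metis append_Nil2 in_set_butlastD
            list.set(1) list.simps(15) empty_subsetI insert_subset subset_iff word_Cons word_Nil r_one)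
      moreover have "word (butlast s) \<in> carrier A"
        using E in_set_butlastD by (intro word_closed) fastforce
      ultimately have "word s \<in> carrier A #> b" using a(3) r_cosetI by metis
      then have "word s \<in> carrier A #> word ?q" using s0 unfolding n[symmetric] K_def by blast
      then obtain l where l: "l \<in> carrier A" "word s = l \<otimes> word ?q" by (auto simp: mem_r_coset_iff)
      then have "word s = (l \<otimes> word r) \<otimes> word s" using rs(1) E by (simp add: word_append m_assoc)
      moreover have "l \<otimes> word r \<in> J" using J_lmult[OF l(1) word_in_J[OF rs(2) E(1)]] .
      ultimately have "word s = \<zero>" using nakayama_regular E by simp
      then show False using nz rs(1) E by (simp add: word_append)
    qed
    ultimately have "annihilating_word p ?q"
      unfolding annihilating_word_def using q nz a(2) by simp
    then show ?thesis using n by blast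
  qed simp
qed

text \<open>As in \<open>biserial_projective\<close>, the hypotheses make \<open>P\<close> a copy of
  \<open>A e v\<close> with \<open>x\<close> for \<open>e v\<close>; in it \<open>K\<close>
  corresponds to the left annihilator of \<open>word p\<close>.\<close>

lemma kernel_direct_sum:
  fixes P :: "('a, 'm) module"
  assumes P: "left_module A P" and p: "p \<noteq> []" "set p \<subseteq> E" "word p \<noteq> \<zero>"
    and x: "x \<in> carrier P" "e (h (hd p)) \<odot>\<^bsub>P\<^esub> x = x"
    and gen: "carrier P = (\<lambda>a. a \<odot>\<^bsub>P\<^esub> x) ` carrier A"
    and inj: "\<And>a. a \<in> carrier A \<Longrightarrow> a \<odot>\<^bsub>P\<^esub> x = \<zero>\<^bsub>P\<^esub> \<Longrightarrow> a \<otimes> e (h (hd p)) = \<zero>"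
    and K: "K = {a \<odot>\<^bsub>P\<^esub> x | a. a \<in> carrier A \<and> a \<otimes> word p = \<zero>}"
  shows "direct_sum_of_at_most A 2 {ideal_module A (carrier A #> word q) | q. annihilating_word p q}
    (P\<lparr>carrier := K\<rparr>)"
proof -
  interpret P: left_module A P by (rule P)
  define v where "v = h (hd p)"
  have v: "v \<in> V" using p h_V unfolding v_def by (cases p) auto
  have ev: "e v \<in> carrier A" using e_closed v by simp
  have wp: "word p \<in> carrier A" using p by simp
  let ?f = "\<lambda>a. a \<odot>\<^bsub>P\<^esub> x"
  let ?A = "{a \<in> carrier A. a \<otimes> word p = \<zero>}"
  have A: "left_ideal ?A"
  proof -
    have "left_ideal {a \<in> carrier A. a \<odot>\<^bsub>regular_module A\<^esub> word p \<in> {\<zero>\<^bsub>regular_module A\<^esub>}}"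
      by (rule preimage_left_ideal[OF reg.left_module_axioms _ reg.submodule_zero])
        (use wp reg.submodule_carrier in auto)
    then show ?thesis by simp
  qed
  have K': "K = ?f ` ?A" unfolding K by blast
  have Ks: "submodule K A P" unfolding K' by (rule image_submodule[OF P x(1) A])
  obtain b c where bc: "arrow_or_zero v b" "arrow_or_zero v c"
    "(carrier A #> b) \<inter> (carrier A #> c) = {\<zero>}"
    "\<And>j. j \<in> J \<Longrightarrow> \<exists>y \<in> carrier A #> b. \<exists>y' \<in> carrier A #> c. j \<otimes> e v = y \<oplus> y'"
    using radical_summands[OF v] by blast
  let ?K = "\<lambda>b. {a \<in> carrier A #> b. a \<otimes> word p = \<zero>}"
  have props: "left_ideal (?K b) \<and> (?K b = {\<zero>} \<or> (\<exists>q. annihilating_word p q \<and> ?K b = carrier A #> word q))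
      \<and> (\<forall>a \<in> ?K b. a \<in> carrier A \<and> a \<otimes> e v = a)"
    if b: "arrow_or_zero v b" for b
  proof -
    have "a \<in> carrier A \<and> a \<otimes> e v = a" if "a \<in> carrier A #> b" for a
      using that arrow_or_zeroD[OF b] v ev by (auto simp: mem_r_coset_iff m_assoc)
    then show ?thesis
      using annihilator_below_arrow[OF p(1,2), of b] b unfolding v_def[symmetric] by blast
  qed
  have sub: "submodule (?f ` ?K b) A (P\<lparr>carrier := K\<rparr>)" if b: "arrow_or_zero v b" for b
  proof -
    have "?K b \<subseteq> ?A" using props[OF b] by blast
    then have "?f ` ?K b \<subseteq> K" unfolding K' by (rule image_mono)
    then show ?thesis
      using image_submodule[OF P x(1), of "?K b"] props[OF b] P.submodule_restrict_iff[OF Ks] by blast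
  qed
  have iso: "\<exists>C \<in> {ideal_module A (carrier A #> word q) | q. annihilating_word p q}.
      isomorphic_modules A (P\<lparr>carrier := K, carrier := ?f ` ?K b\<rparr>) C"
    if b: "arrow_or_zero v b" and n: "?f ` ?K b \<noteq> {\<zero>\<^bsub>P\<^esub>}" for b
  proof -
    have inj_f: "inj_on ?f (?K b)"
    proof (rule inj_onI)
      fix l n assume ln: "l \<in> ?K b" "n \<in> ?K b" "l \<odot>\<^bsub>P\<^esub> x = n \<odot>\<^bsub>P\<^esub> x"
      have lc: "l \<in> carrier A" "n \<in> carrier A" "l \<otimes> e v = l" "n \<otimes> e v = n"
        using props[OF b] ln by auto
      show "l = n" using smult_inject[OF P x(1) ev inj[folded v_def] lc] ln(3) by simp
    qed
    have "?K b \<noteq> {\<zero>}"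
    proof
      assume "?K b = {\<zero>}"
      then have "?f ` ?K b = ?f ` {\<zero>}" by (rule arg_cong)
      then show False using n x by simp
    qed
    then obtain q where q: "annihilating_word p q" "?K b = carrier A #> word q"
      using props[OF b] by blast
    have D: "left_ideal (?K b)" using props[OF b] by blast
    \<comment> \<open>The isomorphism has to start at the summand of the kernel, so the inverse of
      the map sending \<open>a\<close> to \<open>a x\<close> is taken.\<close>
    define g where "g = inv_into (?K b) ?f"
    have gf: "g (a \<odot>\<^bsub>P\<^esub> x) = a" if "a \<in> ?K b" for a
      unfolding g_def using inv_into_f_f[OF inj_f that] by simp
    have "g \<in> module_hom A (P\<lparr>carrier := ?f ` ?K b\<rparr>) (ideal_module A (?K b))"
    proof -
      have cK: "a \<in> carrier A" if "a \<in> ?K b" for a using that left_idealD(1)[OF D] by blast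
      have "g (?f a \<oplus>\<^bsub>P\<^esub> ?f a') = g (?f a) \<oplus> g (?f a')" if "a \<in> ?K b" "a' \<in> ?K b" for a a'
      proof -
        have "?f a \<oplus>\<^bsub>P\<^esub> ?f a' = ?f (a \<oplus> a')" using P.smult_l_distr[OF cK[OF that(1)] cK[OF that(2)] x(1)] by simp
        then show ?thesis using gf[OF left_idealD(3)[OF D that]] gf that by simp
      qed
      moreover have "g (r \<odot>\<^bsub>P\<^esub> ?f a) = r \<otimes> g (?f a)" if "r \<in> carrier A" "a \<in> ?K b" for r a
      proof -
        have "r \<odot>\<^bsub>P\<^esub> ?f a = ?f (r \<otimes> a)" using P.smult_assoc[OF that(1) cK[OF that(2)] x(1)] by simp
        then show ?thesis using gf[OF left_idealD(4)[OF D that]] gf[OF that(2)] by simp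
      qed
      moreover have "g y \<in> ?K b" if "y \<in> ?f ` ?K b" for y
        unfolding g_def by (rule inv_into_into[OF that])
      ultimately show ?thesis
        unfolding module_hom_def hom_def by auto
    qed
    moreover have "bij_betw g (?f ` ?K b) (?K b)"
      unfolding g_def by (rule bij_betw_inv_into) (simp add: bij_betw_def inj_f)
    ultimately have "isomorphic_modules A (P\<lparr>carrier := ?f ` ?K b\<rparr>) (ideal_module A (?K b))"
      unfolding isomorphic_modules_def by auto
    then show ?thesis using q by auto
  qed
  have "?f ` ?K b \<inter> ?f ` ?K c = {\<zero>\<^bsub>P\<lparr>carrier := K\<rparr>\<^esub>}"
  proof
    show "?f ` ?K b \<inter> ?f ` ?K c \<subseteq> {\<zero>\<^bsub>P\<lparr>carrier := K\<rparr>\<^esub>}"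
    proof
      fix y assume "y \<in> ?f ` ?K b \<inter> ?f ` ?K c"
      then obtain l n where l: "l \<in> ?K b" "n \<in> ?K c" "y = l \<odot>\<^bsub>P\<^esub> x" "y = n \<odot>\<^bsub>P\<^esub> x" by blast
      have lc: "l \<in> carrier A" "n \<in> carrier A" "l \<otimes> e v = l" "n \<otimes> e v = n"
        using props[OF bc(1)] props[OF bc(2)] l by auto
      have "l = n" using smult_inject[OF P x(1) ev inj[folded v_def] lc] l by simp
      then have "l = \<zero>" using l bc(3) by blast
      then show "y \<in> {\<zero>\<^bsub>P\<lparr>carrier := K\<rparr>\<^esub>}" using l x by simp
    qed
    show "{\<zero>\<^bsub>P\<lparr>carrier := K\<rparr>\<^esub>} \<subseteq> ?f ` ?K b \<inter> ?f ` ?K c"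
      using P.left_module_restrict[OF Ks] left_module.submoduleD(2)[OF _ sub[OF bc(1)]]
        left_module.submoduleD(2)[OF _ sub[OF bc(2)]] by blast
  qed
  moreover have "?f ` ?K b <+>\<^bsub>P\<lparr>carrier := K\<rparr>\<^esub> ?f ` ?K c = carrier (P\<lparr>carrier := K\<rparr>)"
  proof
    interpret PK: left_module A "P\<lparr>carrier := K\<rparr>" by (rule P.left_module_restrict[OF Ks])
    show "?f ` ?K b <+>\<^bsub>P\<lparr>carrier := K\<rparr>\<^esub> ?f ` ?K c \<subseteq> carrier (P\<lparr>carrier := K\<rparr>)"
      using PK.submoduleD(1)[OF PK.submodule_set_add[OF sub[OF bc(1)] sub[OF bc(2)]]] .
    show "carrier (P\<lparr>carrier := K\<rparr>) \<subseteq> ?f ` ?K b <+>\<^bsub>P\<lparr>carrier := K\<rparr>\<^esub> ?f ` ?K c"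
    proof
      fix y assume "y \<in> carrier (P\<lparr>carrier := K\<rparr>)"
      then obtain a where a: "a \<in> carrier A" "a \<otimes> word p = \<zero>" "y = a \<odot>\<^bsub>P\<^esub> x"
        unfolding K by auto
      have ep: "e v \<otimes> word p = word p" using e_word[OF p(1,2)] unfolding v_def .
      have aev: "(a \<otimes> e v) \<otimes> word p = \<zero>" using a ev wp ep by (simp add: m_assoc)
      \<comment> \<open>Otherwise \<open>a e v\<close> could be multiplied to \<open>e v\<close>,
        and \<open>e v\<close> would annihilate \<open>word p\<close>, which it fixes.\<close>
      have "a \<otimes> e v \<in> J"
      proof (rule ccontr)
        assume "a \<otimes> e v \<notin> J"
        then obtain d where d: "d \<in> carrier A" "d \<otimes> (a \<otimes> e v) = e v" using unit_left[OF a(1) v] by blast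
        then have "word p = (d \<otimes> (a \<otimes> e v)) \<otimes> word p" using ep by simp
        also have "\<dots> = d \<otimes> ((a \<otimes> e v) \<otimes> word p)" using d(1) a(1) ev wp by (simp add: m_assoc)
        also have "\<dots> = \<zero>" using aev d by simp
        finally show False using p(3) by simp
      qed
      moreover have "(a \<otimes> e v) \<otimes> e v = a \<otimes> e v" using a ev v by (simp add: m_assoc e_mult)
      ultimately obtain l n where l: "l \<in> carrier A #> b" "n \<in> carrier A #> c" "a \<otimes> e v = l \<oplus> n"
        using bc(4)[of "a \<otimes> e v"] by auto
      have b: "b \<in> carrier A" and c: "c \<in> carrier A"
        using arrow_or_zeroD(1) bc(1,2) by auto
      have lc: "l \<in> carrier A" "n \<in> carrier A"
        using l left_idealD(1)[OF principal_left_ideal[OF b]] left_idealD(1)[OF principal_left_ideal[OF c]] by auto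
      \<comment> \<open>Since one of the two products \<open>l p\<close> and \<open>n p\<close>
        vanishes and their sum is zero, the other vanishes too, so each component separately
        annihilates \<open>word p\<close>.\<close>
      have "b \<otimes> word p = \<zero> \<or> c \<otimes> word p = \<zero>"
        by (rule radical_summands_special[OF bc(1-3) p(1,2)])
      then have "l \<otimes> word p = \<zero> \<or> n \<otimes> word p = \<zero>"
        using l(1,2) b c wp by (auto simp: mem_r_coset_iff m_assoc)
      moreover have "l \<otimes> word p \<oplus> n \<otimes> word p = \<zero>"
        using aev unfolding l(3) using lc wp by (simp add: l_distr)
      ultimately have "l \<otimes> word p = \<zero>" "n \<otimes> word p = \<zero>" using lc wp by auto
      then have "l \<in> ?K b" "n \<in> ?K c" using l by auto
      moreover have "y = l \<odot>\<^bsub>P\<^esub> x \<oplus>\<^bsub>P\<^esub> n \<odot>\<^bsub>P\<^esub> x"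
      proof -
        have "y = (a \<otimes> e v) \<odot>\<^bsub>P\<^esub> x" using a x ev unfolding v_def by (simp add: P.smult_assoc)
        then show ?thesis unfolding l(3) using lc x by (simp add: P.smult_l_distr)
      qed
      ultimately show "y \<in> ?f ` ?K b <+>\<^bsub>P\<lparr>carrier := K\<rparr>\<^esub> ?f ` ?K c"
        unfolding mem_set_add_iff by auto
    qed
  qed
  ultimately show ?thesis
    using iso[OF bc(1)] iso[OF bc(2)]
    by (intro left_module.direct_sum_of_at_most_2I[OF P.left_module_restrict[OF Ks] sub[OF bc(1)] sub[OF bc(2)]])
      auto
qed

end

section \<open>Projective modules\<close>

lemma module_hom_iff:
  "f \<in> module_hom A M N \<longleftrightarrow> (\<forall>x \<in> carrier M. f x \<in> carrier N) \<and>
     (\<forall>x \<in> carrier M. \<forall>y \<in> carrier M. f (x \<oplus>\<^bsub>M\<^esub> y) = f x \<oplus>\<^bsub>N\<^esub> f y) \<and>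
     (\<forall>a \<in> carrier A. \<forall>x \<in> carrier M. f (a \<odot>\<^bsub>M\<^esub> x) = a \<odot>\<^bsub>N\<^esub> f x)"
  by (auto simp: module_hom_def hom_def Pi_iff)

lemma module_homD:
  assumes "f \<in> module_hom A M N"
  shows "x \<in> carrier M \<Longrightarrow> f x \<in> carrier N"
    "x \<in> carrier M \<Longrightarrow> y \<in> carrier M \<Longrightarrow> f (x \<oplus>\<^bsub>M\<^esub> y) = f x \<oplus>\<^bsub>N\<^esub> f y"
    "a \<in> carrier A \<Longrightarrow> x \<in> carrier M \<Longrightarrow> f (a \<odot>\<^bsub>M\<^esub> x) = a \<odot>\<^bsub>N\<^esub> f x"
  using assms unfolding module_hom_iff by auto

lemma module_hom_zero:
  assumes "f \<in> module_hom A M N" "left_module A M" "left_module A N"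
  shows "f \<zero>\<^bsub>M\<^esub> = \<zero>\<^bsub>N\<^esub>"
proof -
  interpret M: left_module A M by (rule assms(2))
  interpret N: left_module A N by (rule assms(3))
  have "f (\<zero>\<^bsub>A\<^esub> \<odot>\<^bsub>M\<^esub> \<zero>\<^bsub>M\<^esub>) = \<zero>\<^bsub>A\<^esub> \<odot>\<^bsub>N\<^esub> f \<zero>\<^bsub>M\<^esub>"
    by (rule module_homD(3)[OF assms(1)]) auto
  then show ?thesis using module_homD(1)[OF assms(1), of "\<zero>\<^bsub>M\<^esub>"] by simp
qed

lemma module_hom_finsum:
  assumes f: "f \<in> module_hom A M N" and M: "left_module A M" and N: "left_module A N"
    and g: "\<And>i. i \<in> S \<Longrightarrow> g i \<in> carrier M"
  shows "f (finsum M g S) = finsum N (\<lambda>i. f (g i)) S"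
proof -
  interpret M: left_module A M by (rule M)
  interpret N: left_module A N by (rule N)
  show ?thesis
    using g
  proof (induction S rule: infinite_finite_induct)
    case (infinite S)
    then show ?case using module_hom_zero[OF f M N] by simp
  next
    case empty
    then show ?case using module_hom_zero[OF f M N] by simp
  next
    case (insert i S)
    then have "g \<in> S \<rightarrow> carrier M" "g i \<in> carrier M" by auto
    moreover from this have "(\<lambda>i. f (g i)) \<in> S \<rightarrow> carrier N" using module_homD(1)[OF f] by auto
    ultimately show ?case using insert module_homD[OF f] by simp
  qed
qed

text \<open>
  The fields \<open>mult\<close> and \<open>one\<close> of the record play no role in a module.
\<close>

definition free_module :: "('a, 'c) ring_scheme \<Rightarrow> 'm set \<Rightarrow> ('a, 'm \<Rightarrow> 'a) module" where
  "free_module A S = \<lparr>carrier = {f. finite {p. f p \<noteq> \<zero>\<^bsub>A\<^esub>} \<and> {p. f p \<noteq> \<zero>\<^bsub>A\<^esub>} \<subseteq> S \<and> range f \<subseteq> carrier A},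
     monoid.mult = undefined, monoid.one = undefined, ring.zero = (\<lambda>_. \<zero>\<^bsub>A\<^esub>),
     ring.add = (\<lambda>f g p. f p \<oplus>\<^bsub>A\<^esub> g p), smult = (\<lambda>a f p. a \<otimes>\<^bsub>A\<^esub> f p)\<rparr>"

lemma free_module_simps:
  "f \<in> carrier (free_module A S) \<longleftrightarrow>
     finite {p. f p \<noteq> \<zero>\<^bsub>A\<^esub>} \<and> {p. f p \<noteq> \<zero>\<^bsub>A\<^esub>} \<subseteq> S \<and> (\<forall>p. f p \<in> carrier A)"
  "\<zero>\<^bsub>free_module A S\<^esub> = (\<lambda>_. \<zero>\<^bsub>A\<^esub>)"
  "f \<oplus>\<^bsub>free_module A S\<^esub> g = (\<lambda>p. f p \<oplus>\<^bsub>A\<^esub> g p)"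
  "a \<odot>\<^bsub>free_module A S\<^esub> f = (\<lambda>p. a \<otimes>\<^bsub>A\<^esub> f p)"
  by (auto simp: free_module_def)

lemma left_module_free:
  assumes "ring A"
  shows "left_module A (free_module A S)"
proof -
  interpret ring A by (rule assms)
  have add: "(\<lambda>p. f p \<oplus>\<^bsub>A\<^esub> g p) \<in> carrier (free_module A S)"
    if fg: "f \<in> carrier (free_module A S)" "g \<in> carrier (free_module A S)" for f g
  proof -
    have "{p. f p \<oplus>\<^bsub>A\<^esub> g p \<noteq> \<zero>\<^bsub>A\<^esub>} \<subseteq> {p. f p \<noteq> \<zero>\<^bsub>A\<^esub>} \<union> {p. g p \<noteq> \<zero>\<^bsub>A\<^esub>}" by auto
    moreover have "finite ({p. f p \<noteq> \<zero>\<^bsub>A\<^esub>} \<union> {p. g p \<noteq> \<zero>\<^bsub>A\<^esub>})"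
      using fg by (simp add: free_module_simps)
    ultimately have "finite {p. f p \<oplus>\<^bsub>A\<^esub> g p \<noteq> \<zero>\<^bsub>A\<^esub>}" by (rule finite_subset)
    moreover have "{p. f p \<oplus>\<^bsub>A\<^esub> g p \<noteq> \<zero>\<^bsub>A\<^esub>} \<subseteq> S"
      using fg \<open>{p. f p \<oplus>\<^bsub>A\<^esub> g p \<noteq> \<zero>\<^bsub>A\<^esub>} \<subseteq> _\<close> unfolding free_module_simps by blast
    ultimately show ?thesis using fg by (simp add: free_module_simps)
  qed
  have smult: "(\<lambda>p. a \<otimes>\<^bsub>A\<^esub> f p) \<in> carrier (free_module A S)"
    if af: "a \<in> carrier A" "f \<in> carrier (free_module A S)" for a f
  proof -
    have "{p. a \<otimes>\<^bsub>A\<^esub> f p \<noteq> \<zero>\<^bsub>A\<^esub>} \<subseteq> {p. f p \<noteq> \<zero>\<^bsub>A\<^esub>}" using af by auto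
    moreover from this have "finite {p. a \<otimes>\<^bsub>A\<^esub> f p \<noteq> \<zero>\<^bsub>A\<^esub>}"
      using af by (auto simp: free_module_simps intro: finite_subset)
    ultimately show ?thesis using af by (auto simp: free_module_simps)
  qed
  have "abelian_group (free_module A S)"
  proof (rule abelian_groupI)
    fix f assume f: "f \<in> carrier (free_module A S)"
    have "(\<lambda>p. \<ominus>\<^bsub>A\<^esub> \<one>\<^bsub>A\<^esub> \<otimes>\<^bsub>A\<^esub> f p) \<in> carrier (free_module A S)" by (rule smult) (use f in auto)
    moreover have "(\<lambda>p. \<ominus>\<^bsub>A\<^esub> \<one>\<^bsub>A\<^esub> \<otimes>\<^bsub>A\<^esub> f p) \<oplus>\<^bsub>free_module A S\<^esub> f = \<zero>\<^bsub>free_module A S\<^esub>"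
      using f by (auto simp: free_module_simps l_minus l_neg)
    ultimately show "\<exists>g \<in> carrier (free_module A S). g \<oplus>\<^bsub>free_module A S\<^esub> f = \<zero>\<^bsub>free_module A S\<^esub>"
      by blast
  qed (auto simp: add free_module_simps(3), auto simp: free_module_simps a_assoc fun_eq_iff intro: a_comm)
  then show ?thesis
    using assms smult
    by (auto simp: left_module_def left_module_axioms_def free_module_simps(3,4))
      (auto simp: free_module_simps l_distr r_distr m_assoc)
qed

section \<open>The evaluation map of the free module\<close>

context left_module
begin

text \<open>Makes sums with different supports comparable by enlarging all of them to a common
  finite set.\<close>

lemma evaluation_superset:
  assumes "finite T" "{p. f p \<noteq> \<zero>\<^bsub>A\<^esub>} \<subseteq> T" "T \<subseteq> carrier M" "\<And>p. f p \<in> carrier A"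
  shows "finsum M (\<lambda>p. f p \<odot> p) {p. f p \<noteq> \<zero>\<^bsub>A\<^esub>} = finsum M (\<lambda>p. f p \<odot> p) T"
  by (rule M.add.finprod_mono_neutral_cong_left) (use assms in \<open>auto simp: smult_closed subset_iff\<close>)

lemma smult_finsum:
  assumes "a \<in> carrier A" "\<And>i. i \<in> S \<Longrightarrow> g i \<in> carrier M"
  shows "a \<odot> finsum M g S = finsum M (\<lambda>i. a \<odot> g i) S"
  using assms(2)
proof (induction S rule: infinite_finite_induct)
  case (insert i S)
  then have "g \<in> S \<rightarrow> carrier M" "g i \<in> carrier M" by auto
  moreover from this have "(\<lambda>i. a \<odot> g i) \<in> S \<rightarrow> carrier M" using assms(1) smult_closed by auto
  ultimately show ?case using insert assms(1) by (simp add: smult_r_distr smult_closed)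
qed (use assms(1) in auto)

lemma evaluation_hom:
  "(\<lambda>f. finsum M (\<lambda>p. f p \<odot> p) {p. f p \<noteq> \<zero>\<^bsub>A\<^esub>}) \<in> module_hom A (free_module A (carrier M)) M"
  unfolding module_hom_iff
proof (intro conjI ballI)
  fix f assume f: "f \<in> carrier (free_module A (carrier M))"
  then have F: "finite {p. f p \<noteq> \<zero>\<^bsub>A\<^esub>}" "{p. f p \<noteq> \<zero>\<^bsub>A\<^esub>} \<subseteq> carrier M" "\<And>p. f p \<in> carrier A"
    by (auto simp: free_module_simps)
  show "finsum M (\<lambda>p. f p \<odot> p) {p. f p \<noteq> \<zero>\<^bsub>A\<^esub>} \<in> carrier M"
    by (rule M.finsum_closed) (use F smult_closed in auto)
  fix g assume g: "g \<in> carrier (free_module A (carrier M))"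
  then have G: "finite {p. g p \<noteq> \<zero>\<^bsub>A\<^esub>}" "{p. g p \<noteq> \<zero>\<^bsub>A\<^esub>} \<subseteq> carrier M" "\<And>p. g p \<in> carrier A"
    by (auto simp: free_module_simps)
  let ?T = "{p. f p \<noteq> \<zero>\<^bsub>A\<^esub>} \<union> {p. g p \<noteq> \<zero>\<^bsub>A\<^esub>}"
  have T: "finite ?T" "?T \<subseteq> carrier M" using F G by auto
  have c: "(\<lambda>p. f p \<odot> p) \<in> ?T \<rightarrow> carrier M" "(\<lambda>p. g p \<odot> p) \<in> ?T \<rightarrow> carrier M"
    using T(2) F(3) G(3) smult_closed by auto
  have "finsum M (\<lambda>p. (f p \<oplus>\<^bsub>A\<^esub> g p) \<odot> p) {p. f p \<oplus>\<^bsub>A\<^esub> g p \<noteq> \<zero>\<^bsub>A\<^esub>} = finsum M (\<lambda>p. (f p \<oplus>\<^bsub>A\<^esub> g p) \<odot> p) ?T"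
    by (rule evaluation_superset[OF T(1) _ T(2)]) (use F G in auto)
  also have "\<dots> = finsum M (\<lambda>p. f p \<odot> p \<oplus> g p \<odot> p) ?T"
    by (rule M.finsum_cong') (use F G T c smult_l_distr in auto)
  also have "\<dots> = finsum M (\<lambda>p. f p \<odot> p) ?T \<oplus> finsum M (\<lambda>p. g p \<odot> p) ?T"
    by (rule M.finsum_addf[OF c])
  also have "finsum M (\<lambda>p. f p \<odot> p) ?T = finsum M (\<lambda>p. f p \<odot> p) {p. f p \<noteq> \<zero>\<^bsub>A\<^esub>}"
    by (rule evaluation_superset[OF T(1) _ T(2), symmetric]) (use F in auto)
  also have "finsum M (\<lambda>p. g p \<odot> p) ?T = finsum M (\<lambda>p. g p \<odot> p) {p. g p \<noteq> \<zero>\<^bsub>A\<^esub>}"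
    by (rule evaluation_superset[OF T(1) _ T(2), symmetric]) (use G in auto)
  finally show "finsum M (\<lambda>p. (f \<oplus>\<^bsub>free_module A (carrier M)\<^esub> g) p \<odot> p)
      {p. (f \<oplus>\<^bsub>free_module A (carrier M)\<^esub> g) p \<noteq> \<zero>\<^bsub>A\<^esub>} =
    finsum M (\<lambda>p. f p \<odot> p) {p. f p \<noteq> \<zero>\<^bsub>A\<^esub>} \<oplus> finsum M (\<lambda>p. g p \<odot> p) {p. g p \<noteq> \<zero>\<^bsub>A\<^esub>}"
    unfolding free_module_simps .
next
  fix a f assume a: "a \<in> carrier A" and f: "f \<in> carrier (free_module A (carrier M))"
  then have F: "finite {p. f p \<noteq> \<zero>\<^bsub>A\<^esub>}" "{p. f p \<noteq> \<zero>\<^bsub>A\<^esub>} \<subseteq> carrier M" "\<And>p. f p \<in> carrier A"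
    by (auto simp: free_module_simps)
  have "finsum M (\<lambda>p. (a \<otimes>\<^bsub>A\<^esub> f p) \<odot> p) {p. a \<otimes>\<^bsub>A\<^esub> f p \<noteq> \<zero>\<^bsub>A\<^esub>} = finsum M (\<lambda>p. (a \<otimes>\<^bsub>A\<^esub> f p) \<odot> p) {p. f p \<noteq> \<zero>\<^bsub>A\<^esub>}"
    by (rule evaluation_superset[OF F(1) _ F(2)]) (use F a in auto)
  also have "\<dots> = finsum M (\<lambda>p. a \<odot> (f p \<odot> p)) {p. f p \<noteq> \<zero>\<^bsub>A\<^esub>}"
    by (rule M.finsum_cong') (use F a smult_closed smult_assoc in auto)
  also have "\<dots> = a \<odot> finsum M (\<lambda>p. f p \<odot> p) {p. f p \<noteq> \<zero>\<^bsub>A\<^esub>}"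
    by (rule smult_finsum[symmetric]) (use F a smult_closed in auto)
  finally show "finsum M (\<lambda>p. (a \<odot>\<^bsub>free_module A (carrier M)\<^esub> f) p \<odot> p)
      {p. (a \<odot>\<^bsub>free_module A (carrier M)\<^esub> f) p \<noteq> \<zero>\<^bsub>A\<^esub>} =
    a \<odot> finsum M (\<lambda>p. f p \<odot> p) {p. f p \<noteq> \<zero>\<^bsub>A\<^esub>}"
    unfolding free_module_simps .
qed

lemma evaluation_surj:
  "(\<lambda>f. finsum M (\<lambda>p. f p \<odot> p) {p. f p \<noteq> \<zero>\<^bsub>A\<^esub>}) ` carrier (free_module A (carrier M)) = carrier M"
proof
  show "(\<lambda>f. finsum M (\<lambda>p. f p \<odot> p) {p. f p \<noteq> \<zero>\<^bsub>A\<^esub>}) ` carrier (free_module A (carrier M)) \<subseteq> carrier M"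
    using module_homD(1)[OF evaluation_hom] by blast
  show "carrier M \<subseteq> (\<lambda>f. finsum M (\<lambda>p. f p \<odot> p) {p. f p \<noteq> \<zero>\<^bsub>A\<^esub>}) ` carrier (free_module A (carrier M))"
  proof
    fix x assume x: "x \<in> carrier M"
    define d where "d = (\<lambda>p. if p = x then \<one>\<^bsub>A\<^esub> else \<zero>\<^bsub>A\<^esub>)"
    have s: "{p. d p \<noteq> \<zero>\<^bsub>A\<^esub>} \<subseteq> {x}" unfolding d_def by auto
    have "finite {p. d p \<noteq> \<zero>\<^bsub>A\<^esub>}" using s by (rule finite_subset) simp
    then have d: "d \<in> carrier (free_module A (carrier M))"
      using s x unfolding free_module_simps by (auto simp: d_def)
    have "finsum M (\<lambda>p. d p \<odot> p) {p. d p \<noteq> \<zero>\<^bsub>A\<^esub>} = finsum M (\<lambda>p. d p \<odot> p) {x}"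
      by (rule evaluation_superset) (use s x in \<open>auto simp: d_def\<close>)
    also have "\<dots> = x" using x by (simp add: d_def smult_one)
    finally show "x \<in> (\<lambda>f. finsum M (\<lambda>p. f p \<odot> p) {p. f p \<noteq> \<zero>\<^bsub>A\<^esub>}) ` carrier (free_module A (carrier M))"
      using d by force
  qed
qed

end

text \<open>The identity of \<open>P\<close> is lifted along the evaluation map from the free module
  on the carrier of \<open>P\<close>, and the coordinates of the lift are the \<open>f p\<close>.
  The types in \<open>projective_module\<close> are chosen for this instance.\<close>

lemma projective_dual_basis:
  fixes P :: "('a, 'm) module"
  assumes P: "projective_module A P"
  obtains f :: "'m \<Rightarrow> 'm \<Rightarrow> 'a" where
    "\<And>p. f p \<in> module_hom A P (regular_module A)"
    "\<And>x. x \<in> carrier P \<Longrightarrow> finite {p. f p x \<noteq> \<zero>\<^bsub>A\<^esub>}"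
    "\<And>x. x \<in> carrier P \<Longrightarrow> {p. f p x \<noteq> \<zero>\<^bsub>A\<^esub>} \<subseteq> carrier P"
    "\<And>x. x \<in> carrier P \<Longrightarrow> finsum P (\<lambda>p. f p x \<odot>\<^bsub>P\<^esub> p) {p. f p x \<noteq> \<zero>\<^bsub>A\<^esub>} = x"
proof -
  interpret P: left_module A P using P unfolding projective_module_def by blast
  let ?F = "free_module A (carrier P)"
  have F: "left_module A ?F" by (rule left_module_free[OF P.R.ring_axioms])
  have id: "(\<lambda>x. x) \<in> module_hom A P P" unfolding module_hom_iff by auto
  have "\<exists>h \<in> module_hom A P ?F. \<forall>x \<in> carrier P.
      (\<lambda>f. finsum P (\<lambda>p. f p \<odot>\<^bsub>P\<^esub> p) {p. f p \<noteq> \<zero>\<^bsub>A\<^esub>}) (h x) = (\<lambda>x. x) x"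
    using P F P.left_module_axioms P.evaluation_hom P.evaluation_surj id
    unfolding projective_module_def by blast
  then obtain h where h: "h \<in> module_hom A P ?F"
    "\<And>x. x \<in> carrier P \<Longrightarrow> finsum P (\<lambda>p. h x p \<odot>\<^bsub>P\<^esub> p) {p. h x p \<noteq> \<zero>\<^bsub>A\<^esub>} = x" by auto
  have c: "h x \<in> carrier ?F" if "x \<in> carrier P" for x using module_homD(1)[OF h(1) that] .
  show ?thesis
  proof (rule that[of "\<lambda>p x. h x p"])
    show "(\<lambda>x. h x p) \<in> module_hom A P (regular_module A)" for p
      using c module_homD(2,3)[OF h(1)] unfolding module_hom_iff
      by (auto simp: free_module_simps)
  qed (use c h(2) in \<open>auto simp: free_module_simps\<close>)
qed

lemma finsum_regular:
  assumes "ring A" "g \<in> S \<rightarrow> carrier A"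
  shows "finsum (regular_module A) g S = finsum A g S"
proof -
  interpret ring A by (rule assms(1))
  interpret M: left_module A "regular_module A" by (rule left_module_regular[OF assms(1)])
  show ?thesis
    using assms(2)
  proof (induction S rule: infinite_finite_induct)
    case (insert i S)
    then have "g \<in> S \<rightarrow> carrier A" "g i \<in> carrier A" by auto
    moreover from this have "g \<in> S \<rightarrow> carrier (regular_module A)" "g i \<in> carrier (regular_module A)" by auto
    ultimately show ?case
      using insert M.M.finsum_insert[of S i g] by simp
  next
    case (infinite S)
    then show ?case using M.M.finsum_infinite[of S g] by simp
  next
    case empty
    then show ?case using M.M.finsum_empty[of g] by simp
  qed
qed

section \<open>Nakayama's lemma and the splitting of projective modules\<close>

context local_quiver_algebra
begin

text \<open>A row vector fixed by a matrix with entries in \<open>J\<close> is zero. Determinants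
  are of no use over a noncommutative ring, so the unknowns are eliminated one at a time:
  \<open>\<one> - a s s\<close> is a unit, which expresses \<open>x s\<close> through the
  others.\<close>

lemma nakayama_family:
  assumes "finite S" "\<And>i. i \<in> S \<Longrightarrow> x i \<in> carrier A" "\<And>i j. i \<in> S \<Longrightarrow> j \<in> S \<Longrightarrow> a i j \<in> J"
    and "\<And>j. j \<in> S \<Longrightarrow> x j = (\<Oplus>i\<in>S. x i \<otimes> a i j)" and "j \<in> S"
  shows "x j = \<zero>"
  using assms
proof (induction S arbitrary: a j rule: finite_induct)
  case (insert s S)
  have xc: "x i \<in> carrier A" if "i \<in> insert s S" for i using insert.prems(1) that by blast
  have aJ: "a i j \<in> J" if "i \<in> insert s S" "j \<in> insert s S" for i j using insert.prems(2) that by blast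
  have ac: "a i j \<in> carrier A" if "i \<in> insert s S" "j \<in> insert s S" for i j using aJ that by auto
  have c: "x i \<otimes> a i j \<in> carrier A" if "i \<in> insert s S" "j \<in> insert s S" for i j
    using xc ac that by simp
  have split: "x j = x s \<otimes> a s j \<oplus> (\<Oplus>i\<in>S. x i \<otimes> a i j)" if j: "j \<in> insert s S" for j
  proof -
    have "x j = (\<Oplus>i\<in>insert s S. x i \<otimes> a i j)" by (rule insert.prems(3)[OF j])
    also have "\<dots> = x s \<otimes> a s j \<oplus> (\<Oplus>i\<in>S. x i \<otimes> a i j)"
      by (rule finsum_insert) (use insert.hyps c j in auto)
    finally show ?thesis .
  qed
  obtain u where u: "u \<in> carrier A" "(\<one> \<oplus> \<ominus> a s s) \<otimes> u = \<one>"
    using one_plus_J[OF J_minus[OF aJ[of s s]]] by auto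
  have sum_c: "(\<Oplus>i\<in>S. x i \<otimes> a i j) \<in> carrier A" if "j \<in> insert s S" for j
    using c that by (intro finsum_closed) auto
  have "x s \<otimes> (\<one> \<oplus> \<ominus> a s s) = x s \<oplus> \<ominus> (x s \<otimes> a s s)"
    using xc[of s] ac[of s s] by (simp add: r_distr r_minus)
  also have "\<dots> = (\<Oplus>i\<in>S. x i \<otimes> a i s)"
  proof -
    have "x s \<otimes> a s s \<in> carrier A" "(\<Oplus>i\<in>S. x i \<otimes> a i s) \<in> carrier A" using c sum_c by auto
    then have "(x s \<otimes> a s s \<oplus> (\<Oplus>i\<in>S. x i \<otimes> a i s)) \<oplus> \<ominus> (x s \<otimes> a s s) = (\<Oplus>i\<in>S. x i \<otimes> a i s)"
      by (simp add: a_ac r_neg r_neg1 r_neg2)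
    then show ?thesis using split[of s] by simp
  qed
  finally have "x s \<otimes> (\<one> \<oplus> \<ominus> a s s) \<otimes> u = (\<Oplus>i\<in>S. x i \<otimes> a i s) \<otimes> u" by simp
  moreover have "x s \<otimes> (\<one> \<oplus> \<ominus> a s s) \<otimes> u = x s"
    using xc[of s] ac[of s s] u by (simp add: m_assoc)
  ultimately have xs: "x s = (\<Oplus>i\<in>S. x i \<otimes> a i s) \<otimes> u" by simp
  \<comment> \<open>The matrix left after substituting the expression for \<open>x s\<close>; its
    entries are again in \<open>J\<close>, so the induction hypothesis applies to it.\<close>
  define b where "b i j = a i s \<otimes> u \<otimes> a s j \<oplus> a i j" for i j
  have bJ: "b i j \<in> J" if "i \<in> S" "j \<in> S" for i j
  proof -
    have "a i s \<otimes> u \<otimes> a s j \<in> J" using ac[of i s] u aJ[of s j] that by (intro J_lmult) auto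
    then show ?thesis using aJ[of i j] that zsubD(3)[OF zsub_J] unfolding b_def by blast
  qed
  have eq: "x j = (\<Oplus>i\<in>S. x i \<otimes> b i j)" if j: "j \<in> S" for j
  proof -
    have "x s \<otimes> a s j = (\<Oplus>i\<in>S. x i \<otimes> a i s) \<otimes> (u \<otimes> a s j)"
      using xs sum_c[of s] u ac[of s j] j m_assoc[of "\<Oplus>i\<in>S. x i \<otimes> a i s" u "a s j"] by simp
    also have "\<dots> = (\<Oplus>i\<in>S. x i \<otimes> a i s \<otimes> (u \<otimes> a s j))"
      by (rule finsum_ldistr) (use insert.hyps u ac[of s j] c j in auto)
    finally have "x j = (\<Oplus>i\<in>S. x i \<otimes> a i s \<otimes> (u \<otimes> a s j)) \<oplus> (\<Oplus>i\<in>S. x i \<otimes> a i j)"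
      using split[of j] j by simp
    also have "\<dots> = (\<Oplus>i\<in>S. x i \<otimes> a i s \<otimes> (u \<otimes> a s j) \<oplus> x i \<otimes> a i j)"
      by (rule finsum_addf[symmetric]) (use c u ac j in auto)
    also have "\<dots> = (\<Oplus>i\<in>S. x i \<otimes> b i j)"
    proof (rule finsum_cong')
      show "(\<lambda>i. x i \<otimes> b i j) \<in> S \<rightarrow> carrier A" using xc bJ j by auto
      show "x i \<otimes> a i s \<otimes> (u \<otimes> a s j) \<oplus> x i \<otimes> a i j = x i \<otimes> b i j" if "i \<in> S" for i
        using that j xc[of i] ac[of i s] ac[of s j] ac[of i j] u(1) unfolding b_def
        by (simp add: r_distr m_assoc)
    qed simp
    finally show ?thesis .
  qed
  have z: "x j = \<zero>" if "j \<in> S" for j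
  proof (rule insert.IH[of b j])
    show "x i \<in> carrier A" if "i \<in> S" for i using xc that by blast
    show "b i j \<in> J" if "i \<in> S" "j \<in> S" for i j using bJ that by blast
    show "x j = (\<Oplus>i\<in>S. x i \<otimes> b i j)" if "j \<in> S" for j using eq that by blast
    show "j \<in> S" by (rule that)
  qed
  have "(\<Oplus>i\<in>S. x i \<otimes> a i s) = (\<Oplus>i\<in>S. \<zero>)"
    by (rule finsum_cong') (use z ac in auto)
  then have "x s = \<zero>" using xs u by simp
  then show ?case using z[of j] insert.prems(4) by (cases "j = s") auto
next
  case empty
  from empty.prems(4) show ?case by simp
qed

text \<open>Multiplying values on the right preserves left linearity. Since \<open>x\<close> is
  fixed by \<open>e v\<close>, so is \<open>f x\<close>, and \<open>unit_right\<close> provides the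
  factor that turns it into \<open>e v\<close>.\<close>

lemma hom_normalize:
  assumes f: "f \<in> module_hom A P (regular_module A)" and x: "x \<in> carrier P"
    and v: "v \<in> V" "e v \<odot>\<^bsub>P\<^esub> x = x" and n: "f x \<notin> J"
  shows "\<exists>g \<in> module_hom A P (regular_module A). g x = e v \<and> (\<forall>z \<in> carrier P. g z \<otimes> e v = g z)"
proof -
  have ev: "e v \<in> carrier A" using e_closed v by simp
  have fx: "f x \<in> carrier A" using module_homD(1)[OF f x] by simp
  have fe: "e v \<otimes> f x = f x" using module_homD(3)[OF f ev x] v by simp
  obtain y where y: "y \<in> carrier A" "(e v \<otimes> f x) \<otimes> y = e v"
    using unit_right[OF fx v(1)] n fe by auto
  have fc: "f z \<in> carrier A" if "z \<in> carrier P" for z using module_homD(1)[OF f that] by simp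
  have "(\<lambda>z. f z \<otimes> (y \<otimes> e v)) \<in> module_hom A P (regular_module A)"
    using module_homD(2,3)[OF f] fc y(1) ev unfolding module_hom_iff by (auto simp: l_distr m_assoc)
  moreover have "f x \<otimes> (y \<otimes> e v) = e v"
    using y fe fx ev v(1) by (simp add: m_assoc[symmetric] e_mult)
  moreover have "f z \<otimes> (y \<otimes> e v) \<otimes> e v = f z \<otimes> (y \<otimes> e v)" if "z \<in> carrier P" for z
    using fc[OF that] y(1) ev v(1) by (simp add: m_assoc e_mult)
  ultimately show ?thesis by (intro bexI[of _ "\<lambda>z. f z \<otimes> (y \<otimes> e v)"]) auto
qed

text \<open>If all coordinates of \<open>x\<close> were in \<open>J\<close>, then \<open>x\<close>,
  being the sum of the \<open>f p x\<close> times \<open>p\<close> with each \<open>p\<close> a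
  multiple of \<open>x\<close>, would lie in \<open>J x\<close>. So some coordinate is outside
  \<open>J\<close> and can be normalised.\<close>

lemma projective_generator:
  assumes P: "projective_module A P" and x: "x \<in> carrier P" and v: "v \<in> V" "e v \<odot>\<^bsub>P\<^esub> x = x"
    and nz: "x \<noteq> \<zero>\<^bsub>P\<^esub>" and gen: "carrier P = (\<lambda>a. a \<odot>\<^bsub>P\<^esub> x) ` carrier A"
  shows "\<exists>g \<in> module_hom A P (regular_module A). g x = e v"
proof -
  interpret P: left_module A P using P unfolding projective_module_def by blast
  obtain f where f: "\<And>p. f p \<in> module_hom A P (regular_module A)"
    "finite {p. f p x \<noteq> \<zero>}" "{p. f p x \<noteq> \<zero>} \<subseteq> carrier P"
    "finsum P (\<lambda>p. f p x \<odot>\<^bsub>P\<^esub> p) {p. f p x \<noteq> \<zero>} = x"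
    by (rule projective_dual_basis[OF P]) (use x in blast)
  let ?S = "{p. f p x \<noteq> \<zero>}"
  have "\<exists>p. f p x \<notin> J"
  proof (rule ccontr)
    assume J: "\<nexists>p. f p x \<notin> J"
    have R: "submodule (radical_multiples P x) A P"
      by (rule radical_multiples_submodule[OF P.left_module_axioms v(1) x v(2) nz gen])
    have "finsum P (\<lambda>p. f p x \<odot>\<^bsub>P\<^esub> p) S \<in> radical_multiples P x" if "finite S" "S \<subseteq> carrier P" for S
      using that
    proof (induction S rule: finite_induct)
      case empty
      then show ?case using P.submoduleD(2)[OF R] by simp
    next
      case (insert p S)
      then obtain a where a: "a \<in> carrier A" "p = a \<odot>\<^bsub>P\<^esub> x" using gen by auto
      have fp: "f p x \<in> J" for p using J by blast
      have "f p x \<odot>\<^bsub>P\<^esub> p = (f p x \<otimes> a) \<odot>\<^bsub>P\<^esub> x"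
        using P.smult_assoc[OF J_closed[OF fp] a(1) x, of p] a(2) by simp
      then have m: "f p x \<odot>\<^bsub>P\<^esub> p \<in> radical_multiples P x"
        using J_rmult[OF a(1) fp[of p]] unfolding radical_multiples_def by auto
      have "finsum P (\<lambda>p. f p x \<odot>\<^bsub>P\<^esub> p) (insert p S) = f p x \<odot>\<^bsub>P\<^esub> p \<oplus>\<^bsub>P\<^esub> finsum P (\<lambda>p. f p x \<odot>\<^bsub>P\<^esub> p) S"
        by (rule P.M.finsum_insert) (use insert fp J_closed P.smult_closed in auto)
      then show ?case using P.submoduleD(3)[OF R m] insert by simp
    qed
    then have "x \<in> radical_multiples P x" using f(2-4) by metis
    then show False using generator_not_radical_multiple[OF P.left_module_axioms v(1) x v(2) nz gen] by blast
  qed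
  then show ?thesis using hom_normalize[OF f(1) x v] by blast
qed

text \<open>A coordinate value outside \<open>J\<close> is first cut down by a vertex
  \<open>v\<close> and then normalised to \<open>e v\<close>. The resulting map \<open>g\<close>
  splits off a nonzero cyclic summand, which is all of \<open>P\<close> by
  indecomposability.\<close>

lemma indecomposable_projective_generator:
  assumes P: "projective_module A P" and ind: "indecomposable_module A P"
  obtains v x g where "v \<in> V" "x \<in> carrier P" "e v \<odot>\<^bsub>P\<^esub> x = x"
    "carrier P = (\<lambda>a. a \<odot>\<^bsub>P\<^esub> x) ` carrier A"
    "g \<in> module_hom A P (regular_module A)" "g x = e v"
proof -
  interpret P: left_module A P using P unfolding projective_module_def by blast
  obtain f where f: "\<And>p. f p \<in> module_hom A P (regular_module A)"
    "\<And>x. x \<in> carrier P \<Longrightarrow> finite {p. f p x \<noteq> \<zero>}"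
    "\<And>x. x \<in> carrier P \<Longrightarrow> {p. f p x \<noteq> \<zero>} \<subseteq> carrier P"
    "\<And>x. x \<in> carrier P \<Longrightarrow> finsum P (\<lambda>p. f p x \<odot>\<^bsub>P\<^esub> p) {p. f p x \<noteq> \<zero>} = x"
    by (rule projective_dual_basis[OF P]) blast
  have fc: "f p y \<in> carrier A" if "y \<in> carrier P" for p y using module_homD(1)[OF f(1) that] by simp
  have "\<exists>p. \<exists>y \<in> carrier P. f p y \<notin> J"
  proof (rule ccontr)
    assume J: "\<not> (\<exists>p. \<exists>y \<in> carrier P. f p y \<notin> J)"
    have "x = \<zero>\<^bsub>P\<^esub>" if x: "x \<in> carrier P" for x
    proof -
      let ?S = "{p. f p x \<noteq> \<zero>}"
      have S: "finite ?S" "?S \<subseteq> carrier P" using f(2,3)[OF x] by auto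
      \<comment> \<open>Applying the coordinate \<open>f j\<close> to the dual basis expansion of
        \<open>x\<close> shows that its finitely many nonzero coordinates form a vector fixed by a
        matrix over \<open>J\<close>.\<close>
      have "f j x = (\<Oplus>i\<in>?S. f i x \<otimes> f j i)" for j
      proof -
        have "f j x = f j (finsum P (\<lambda>p. f p x \<odot>\<^bsub>P\<^esub> p) ?S)" using f(4)[OF x] by simp
        also have "\<dots> = finsum (regular_module A) (\<lambda>p. f j (f p x \<odot>\<^bsub>P\<^esub> p)) ?S"
          by (rule module_hom_finsum[OF f(1) P.left_module_axioms reg.left_module_axioms])
            (use S fc[OF x] P.smult_closed in auto)
        also have "\<dots> = finsum (regular_module A) (\<lambda>p. f p x \<otimes> f j p) ?S"
          by (rule reg.M.finsum_cong')
            (use S fc x module_homD(3)[OF f(1) fc[OF x]] in auto)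
        also have "\<dots> = (\<Oplus>i\<in>?S. f i x \<otimes> f j i)"
          by (rule finsum_regular[OF ring_axioms]) (use S fc x in auto)
        finally show ?thesis .
      qed
      then have "f j x = \<zero>" if "j \<in> ?S" for j
        using nakayama_family[of ?S "\<lambda>i. f i x" "\<lambda>i j. f j i" j] S J fc[OF x] that by blast
      then have "?S = {}" by blast
      then have "finsum P (\<lambda>p. f p x \<odot>\<^bsub>P\<^esub> p) ?S = \<zero>\<^bsub>P\<^esub>" by simp
      then show ?thesis using f(4)[OF x] by simp
    qed
    then show False using ind unfolding indecomposable_module_def by blast
  qed
  then obtain p y where y: "y \<in> carrier P" "f p y \<notin> J" by blast
  have "\<exists>v \<in> V. e v \<otimes> f p y \<notin> J"
  proof (rule ccontr)
    assume "\<not> ?thesis"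
    then have "(\<Oplus>v\<in>V. e v \<otimes> f p y) \<in> J" by (intro zsub_finsum[OF zsub_J]) blast
    then show False using sum_e_mult[OF fc[OF y(1)]] y(2) by simp
  qed
  then obtain v where v: "v \<in> V" "e v \<otimes> f p y \<notin> J" by blast
  have ev: "e v \<in> carrier A" using e_closed v by simp
  define x where "x = e v \<odot>\<^bsub>P\<^esub> y"
  have x: "x \<in> carrier P" "e v \<odot>\<^bsub>P\<^esub> x = x"
    using ev y v P.smult_assoc[OF ev ev y(1)] unfolding x_def by (auto simp: P.smult_closed e_mult)
  have "f p x \<notin> J" using v module_homD(3)[OF f(1) ev y(1)] unfolding x_def by simp
  then obtain g where g: "g \<in> module_hom A P (regular_module A)" "g x = e v"
    "\<And>z. z \<in> carrier P \<Longrightarrow> g z \<otimes> e v = g z"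
    using hom_normalize[OF f(1) x(1) v(1) x(2)] by blast
  \<comment> \<open>\<open>P\<close> splits into \<open>A x\<close> and the kernel of
    \<open>g\<close>; the component of \<open>z\<close> in \<open>A x\<close> is \<open>g z\<close>
    times \<open>x\<close>, because \<open>g x = e v\<close> and \<open>g z\<close> is fixed by
    \<open>e v\<close>.\<close>
  let ?K = "(\<lambda>a. a \<odot>\<^bsub>P\<^esub> x) ` carrier A" and ?L = "{y \<in> carrier P. g y = \<zero>}"
  have gc: "g y \<in> carrier A" if "y \<in> carrier P" for y using module_homD(1)[OF g(1) that] by simp
  have K: "submodule ?K A P"
    by (rule image_submodule[OF P.left_module_axioms x(1)]) (use reg.submodule_carrier in simp)
  have L: "submodule ?L A P"
    using module_homD(2,3)[OF g(1)] module_hom_zero[OF g(1) P.left_module_axioms reg.left_module_axioms]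
    unfolding P.submodule_iff by (auto simp: P.smult_closed)
  have ga: "g (a \<odot>\<^bsub>P\<^esub> x) = a \<otimes> e v" if "a \<in> carrier A" for a
    using module_homD(3)[OF g(1) that x(1)] g(2) by simp
  have ae: "a \<odot>\<^bsub>P\<^esub> x = (a \<otimes> e v) \<odot>\<^bsub>P\<^esub> x" if "a \<in> carrier A" for a
    using P.smult_assoc[OF that ev x(1)] x(2) by simp
  have "?K \<inter> ?L \<subseteq> {\<zero>\<^bsub>P\<^esub>}"
  proof
    fix z assume "z \<in> ?K \<inter> ?L"
    then obtain a where a: "a \<in> carrier A" "z = a \<odot>\<^bsub>P\<^esub> x" "g z = \<zero>" by blast
    then have "z = \<zero> \<odot>\<^bsub>P\<^esub> x" using ga[OF a(1)] ae[OF a(1)] by simp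
    then show "z \<in> {\<zero>\<^bsub>P\<^esub>}" using x by simp
  qed
  then have KL: "?K \<inter> ?L = {\<zero>\<^bsub>P\<^esub>}" using P.submoduleD(2)[OF K] P.submoduleD(2)[OF L] by blast
  have sum: "?K <+>\<^bsub>P\<^esub> ?L = carrier P"
  proof
    show "?K <+>\<^bsub>P\<^esub> ?L \<subseteq> carrier P" using P.submoduleD(1)[OF P.submodule_set_add[OF K L]] .
    show "carrier P \<subseteq> ?K <+>\<^bsub>P\<^esub> ?L"
    proof
      fix z assume z: "z \<in> carrier P"
      let ?l = "z \<oplus>\<^bsub>P\<^esub> (\<ominus> g z) \<odot>\<^bsub>P\<^esub> x"
      have gzx: "g z \<odot>\<^bsub>P\<^esub> x \<in> carrier P" "(\<ominus> g z) \<odot>\<^bsub>P\<^esub> x \<in> carrier P"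
        using P.smult_closed gc[OF z] x(1) by auto
      have "g ?l = g z \<oplus> (\<ominus> g z) \<otimes> e v"
        using module_homD(2)[OF g(1) z gzx(2)] ga[of "\<ominus> g z"] gc[OF z] by simp
      also have "\<dots> = \<zero>" using g(3)[OF z] gc[OF z] ev by (simp add: l_minus r_neg)
      finally have "?l \<in> ?L" using z gzx by simp
      moreover have "z = g z \<odot>\<^bsub>P\<^esub> x \<oplus>\<^bsub>P\<^esub> ?l"
        using z gzx(1) P.smult_l_minus[OF gc[OF z] x(1)] by (simp add: P.M.a_ac P.M.r_neg P.M.r_neg1 P.M.r_neg2)
      moreover have "g z \<odot>\<^bsub>P\<^esub> x \<in> ?K" using gc[OF z] by blast
      ultimately show "z \<in> ?K <+>\<^bsub>P\<^esub> ?L" unfolding mem_set_add_iff by blast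
    qed
  qed
  have "x \<noteq> \<zero>\<^bsub>P\<^esub>"
    using g(2) module_hom_zero[OF g(1) P.left_module_axioms reg.left_module_axioms]
      e_notin_J[OF v(1)] zsubD(2)[OF zsub_J] by auto
  moreover have "x \<in> ?K" using P.smult_one[OF x(1)] by (metis imageI one_closed)
  ultimately have "?K \<noteq> {\<zero>\<^bsub>P\<^esub>}" by blast
  then have L0: "?L = {\<zero>\<^bsub>P\<^esub>}"
    using ind K L sum KL unfolding indecomposable_module_def by blast
  have "carrier P \<subseteq> ?K"
  proof
    fix z assume "z \<in> carrier P"
    then have "z \<in> ?K <+>\<^bsub>P\<^esub> ?L" using sum by simp
    then obtain k l where kl: "k \<in> ?K" "l \<in> ?L" "z = k \<oplus>\<^bsub>P\<^esub> l" unfolding mem_set_add_iff by blast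
    then have "z = k" using L0 P.submoduleD(1)[OF K] by auto
    then show "z \<in> ?K" using kl by simp
  qed
  then have "carrier P = ?K" using P.submoduleD(1)[OF K] by blast
  then show ?thesis using that v(1) x g(1,2) by blast
qed

end

section \<open>The radical and semiperfectness\<close>

text \<open>An equality of records, so a result on left modules over the quotient of the opposite
  ring reads at once as a result on right modules over the quotient.\<close>

lemma opposite_ring_Quot: "opposite_ring A Quot I = opposite_ring (A Quot I)"
proof -
  have "rcoset_mult (opposite_ring A) I S T = rcoset_mult A I T S" for S T
    unfolding rcoset_mult_def a_r_coset_def by auto
  then show ?thesis
    by (simp add: FactRing_def opposite_ring_def[of "A Quot I"] A_RCOSETS_def a_r_coset_def
        set_add_def fun_eq_iff)
qed

context quiver_algebra
begin

lemma noetherian_left: "noetherian_module A (regular_module A)"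
  by (rule reg.acc_module_imp_noetherian[OF acc_regular])

lemma J_ideal: "ideal J A"
proof (rule idealI[OF ring_axioms])
  show "subgroup J (add_monoid A)"
  proof (rule add.subgroupI)
    show "J \<subseteq> carrier A" by (rule J_carrier)
    show "J \<noteq> {}" using zsubD(2)[OF zsub_J] by blast
    show "\<ominus> a \<in> J" if "a \<in> J" for a using J_minus[OF that] .
    show "a \<oplus> b \<in> J" if "a \<in> J" "b \<in> J" for a b using zsubD(3)[OF zsub_J that] .
  qed
qed (use J_lmult J_rmult in auto)

abbreviation "B \<equiv> A Quot J"
abbreviation "quot x \<equiv> J +> x"

lemma ring_B: "ring B"
  by (rule ideal.quotient_is_ring[OF J_ideal])

lemma carrier_B: "carrier B = quot ` carrier A"
  by (auto simp: FactRing_def A_RCOSETS_def')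

lemma quot_closed: "x \<in> carrier A \<Longrightarrow> quot x \<in> carrier B"
  by (simp add: carrier_B)

lemma quot_add: "x \<in> carrier A \<Longrightarrow> y \<in> carrier A \<Longrightarrow> quot (x \<oplus> y) = quot x \<oplus>\<^bsub>B\<^esub> quot y"
  using ring_hom_add[OF ideal.rcos_ring_hom[OF J_ideal]] by simp

lemma quot_mult: "x \<in> carrier A \<Longrightarrow> y \<in> carrier A \<Longrightarrow> quot (x \<otimes> y) = quot x \<otimes>\<^bsub>B\<^esub> quot y"
  using ring_hom_mult[OF ideal.rcos_ring_hom[OF J_ideal]] by simp

lemma quot_eq_iff: "x \<in> carrier A \<Longrightarrow> y \<in> carrier A \<Longrightarrow> quot x = quot y \<longleftrightarrow> x \<ominus> y \<in> J"
  using quotient_eq_iff_same_a_r_cos[OF J_ideal] by simp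

lemma quot_zero: "quot \<zero> = \<zero>\<^bsub>B\<^esub>"
  by (rule ring_hom_zero[OF ideal.rcos_ring_hom[OF J_ideal] ring_axioms ring_B])

lemma quot_eq_zero_iff: "x \<in> carrier A \<Longrightarrow> quot x = \<zero>\<^bsub>B\<^esub> \<longleftrightarrow> x \<in> J"
  using quot_eq_iff[of x \<zero>] by (simp add: quot_zero[symmetric] minus_eq)

lemma pullback_left_ideal:
  assumes "submodule N B (regular_module B)"
  shows "left_ideal {y \<in> carrier A. quot y \<in> N}"
proof -
  interpret rB: left_module B "regular_module B" by (rule left_module_regular[OF ring_B])
  note N = rB.submoduleD[OF assms]
  show ?thesis
    unfolding left_ideal_iff using N(2-4) quot_add quot_mult quot_zero quot_closed by auto
qed

lemma image_quot_submodule: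
  assumes "left_ideal L"
  shows "submodule (quot ` L) B (regular_module B)"
proof -
  interpret rB: left_module B "regular_module B" by (rule left_module_regular[OF ring_B])
  note L = left_idealD[OF assms]
  have c: "x \<in> carrier A" if "x \<in> L" for x using that L(1) by blast
  show ?thesis
    unfolding rB.submodule_iff
  proof (intro conjI ballI)
    show "quot ` L \<subseteq> carrier (regular_module B)" using c quot_closed by auto
    show "\<zero>\<^bsub>regular_module B\<^esub> \<in> quot ` L" using L(2) quot_zero by force
    show "x \<oplus>\<^bsub>regular_module B\<^esub> y \<in> quot ` L" if xy: "x \<in> quot ` L" "y \<in> quot ` L" for x y
    proof -
      obtain l m where l: "l \<in> L" "m \<in> L" "x = quot l" "y = quot m" using xy by blast
      then show ?thesis using quot_add[OF c[OF l(1)] c[OF l(2)]] L(3)[OF l(1,2)]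
        by (intro image_eqI[of _ _ "l \<oplus> m"]) auto
    qed
    show "b \<odot>\<^bsub>regular_module B\<^esub> x \<in> quot ` L" if bx: "b \<in> carrier (A Quot J)" "x \<in> quot ` L" for b x
    proof -
      obtain a l where l: "a \<in> carrier A" "l \<in> L" "b = quot a" "x = quot l"
        using bx unfolding carrier_B by blast
      then show ?thesis using quot_mult[OF l(1) c[OF l(2)]] L(4)[OF l(1,2)]
        by (intro image_eqI[of _ _ "a \<otimes> l"]) auto
    qed
  qed
qed

end

context local_quiver_algebra
begin

text \<open>For each vertex the set \<open>?M\<close> of all \<open>y\<close> with
  \<open>y e v\<close> in \<open>J\<close> is a maximal left ideal, and these sets intersect in
  \<open>J\<close>. Conversely, a maximal left ideal not containing \<open>J\<close> would, together
  with \<open>J\<close>, give the whole ring, and so would contain some \<open>\<one> - j\<close>, a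
  unit.\<close>

lemma jacobson_radical_eq: "jacobson_radical A = J"
proof
  show "jacobson_radical A \<subseteq> J"
  proof
    fix x assume "x \<in> jacobson_radical A"
    then have x: "x \<in> carrier A" "\<And>N. maximal_submodule N A (regular_module A) \<Longrightarrow> x \<in> N"
      unfolding jacobson_radical_def module_radical_def by auto
    have "x \<otimes> e v \<in> J" if v: "v \<in> V" for v
    proof -
      have ev: "e v \<in> carrier A" using e_closed v by simp
      let ?M = "{y \<in> carrier A. y \<otimes> e v \<in> J}"
      have M: "left_ideal ?M"
        using preimage_left_ideal[OF reg.left_module_axioms _ J_left_ideal reg.submodule_carrier, of "e v"] ev by simp
      have "\<one> \<notin> ?M" using e_notin_J[OF v] ev by simp
      then have "?M \<noteq> carrier A" using one_closed by blast
      moreover have "K = ?M \<or> K = carrier A" if K: "left_ideal K" "?M \<subseteq> K" for K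
      proof (cases "K \<subseteq> ?M")
        case False
        note K' = left_idealD[OF K(1)]
        obtain y where y: "y \<in> K" "y \<notin> ?M" using False by blast
        then have yc: "y \<in> carrier A" using K'(1) by blast
        obtain a where a: "a \<in> carrier A" "a \<otimes> (y \<otimes> e v) = e v"
          using unit_left[OF yc v] y yc by blast
        \<comment> \<open>Since \<open>a y e v = e v\<close>, the element
          \<open>\<one> - a y\<close> lies in \<open>?M\<close>, and adding the element
          \<open>a y\<close> of \<open>K\<close> produces \<open>\<one>\<close>.\<close>
        have "(\<one> \<ominus> a \<otimes> y) \<otimes> e v = \<zero>"
          using a yc ev by (simp add: minus_eq l_distr l_minus m_assoc r_neg)
        then have "\<one> \<ominus> a \<otimes> y \<in> K" using K(2) a yc zsubD(2)[OF zsub_J] by auto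
        moreover have "a \<otimes> y \<in> K" using K'(4)[OF a(1) y(1)] .
        ultimately have "(\<one> \<ominus> a \<otimes> y) \<oplus> a \<otimes> y \<in> K" by (rule K'(3))
        then have "\<one> \<in> K" using a yc by (simp add: minus_eq a_assoc l_neg)
        then have "carrier A \<subseteq> K" using K'(4) by force
        then show ?thesis using K'(1) by blast
      qed (use K in blast)
      ultimately have "maximal_submodule ?M A (regular_module A)"
        using M unfolding maximal_submodule_def by simp
      then have "x \<in> ?M" by (rule x(2))
      then show ?thesis by blast
    qed
    then have "(\<Oplus>v\<in>V. x \<otimes> e v) \<in> J" by (rule zsub_finsum[OF zsub_J])
    then show "x \<in> J" using sum_mult_e x(1) by simp
  qed
  show "J \<subseteq> jacobson_radical A"
  proof -
    have "J \<subseteq> N" if N: "maximal_submodule N A (regular_module A)" for N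
    proof -
      have lN: "left_ideal N" "N \<noteq> carrier A" using N unfolding maximal_submodule_def by auto
      let ?S = "N <+>\<^bsub>regular_module A\<^esub> J"
      have S: "left_ideal ?S" "N \<subseteq> ?S" "J \<subseteq> ?S"
        using reg.submodule_set_add[OF lN(1) J_left_ideal] reg.set_add_upper[OF lN(1) J_left_ideal] by auto
      then have "?S = N \<or> ?S = carrier A" using N unfolding maximal_submodule_def by auto
      moreover have "?S \<noteq> carrier A"
      proof
        assume "?S = carrier A"
        then have "\<one> \<in> ?S" by simp
        then obtain n j where n: "n \<in> N" "j \<in> J" "\<one> = n \<oplus> j" by (auto simp: mem_set_add_iff)
        have nc: "n \<in> carrier A" using n left_idealD(1)[OF lN(1)] by blast
        obtain u where u: "u \<in> carrier A" "u \<otimes> (\<one> \<oplus> \<ominus> j) = \<one>"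
          using one_plus_J[OF J_minus[OF n(2)]] by blast
        have "\<one> \<oplus> \<ominus> j = n" unfolding n(3) using nc n(2) by (simp add: a_assoc r_neg)
        then have "\<one> \<in> N" using u left_idealD(4)[OF lN(1) u(1) n(1)] by simp
        then have "carrier A \<subseteq> N" using left_idealD(4)[OF lN(1)] by force
        then show False using lN left_idealD(1)[OF lN(1)] by blast
      qed
      ultimately show ?thesis using S by blast
    qed
    then show ?thesis
      using J_carrier unfolding jacobson_radical_def module_radical_def by auto
  qed
qed

text \<open>The hypothesis concerns \<open>x e v\<close>, the conclusion a left multiple of
  \<open>x\<close>. The bridge is that the same unit \<open>z\<close> is the scalar part of
  \<open>e v x\<close>.\<close>

lemma scalar_part_unit:
  assumes x: "x \<in> carrier A" and v: "v \<in> V" and n: "x \<otimes> e v \<notin> J"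
  shows "\<exists>a \<in> carrier A. \<exists>j \<in> J. a \<otimes> x = e v \<oplus> j"
proof -
  have ev: "e v \<in> carrier A" using e_closed v by simp
  obtain z y k where z: "z \<in> Z" "y \<in> Z" "y \<otimes> z = \<one>" "k \<in> J" "e v \<otimes> x = z \<otimes> e v \<oplus> k"
    using unit_scalar_part[OF assms] by metis
  have "(y \<otimes> e v) \<otimes> x = y \<otimes> (z \<otimes> e v \<oplus> k)" using z(2,5) x ev by (simp add: m_assoc)
  also have "\<dots> = e v \<oplus> y \<otimes> k" using z(1-4) ev by (simp add: r_distr m_assoc[symmetric])
  finally have "(y \<otimes> e v) \<otimes> x = e v \<oplus> y \<otimes> k" .
  moreover have "y \<otimes> k \<in> J" using zsubD(4)[OF zsub_J] z by blast
  ultimately show ?thesis using z(2) ev by (metis Z_closed m_closed)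
qed

text \<open>An element of the ideal can be multiplied to \<open>e v\<close>, modulo
  \<open>J\<close>, at every vertex with \<open>x e v\<close> outside \<open>J\<close>; conversely
  \<open>x\<close> is the sum of its parts \<open>x e v\<close>. A left ideal of the quotient is
  thus determined by the vertices it contains.\<close>

lemma mem_quotient_left_ideal:
  assumes N: "submodule N B (regular_module B)" and x: "x \<in> carrier A"
  shows "quot x \<in> N \<longleftrightarrow> (\<forall>v \<in> V. x \<otimes> e v \<in> J \<or> quot (e v) \<in> N)"
proof
  let ?L = "{y \<in> carrier A. quot y \<in> N}"
  have L: "left_ideal ?L" by (rule pullback_left_ideal[OF N])
  have JL: "j \<in> ?L" if "j \<in> J" for j
    using that left_idealD(2)[OF L] quot_eq_zero_iff[of j] quot_zero by simp
  {
    assume q: "quot x \<in> N"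
    show "\<forall>v \<in> V. x \<otimes> e v \<in> J \<or> quot (e v) \<in> N"
    proof (intro ballI disjCI)
      fix v assume v: "v \<in> V" and n: "quot (e v) \<notin> N"
      have ev: "e v \<in> carrier A" using e_closed v by simp
      show "x \<otimes> e v \<in> J"
      proof (rule ccontr)
        assume "x \<otimes> e v \<notin> J"
        then obtain a j where a: "a \<in> carrier A" "j \<in> J" "a \<otimes> x = e v \<oplus> j"
          using scalar_part_unit[OF x v] by blast
        have "e v \<oplus> j \<in> ?L" using left_idealD(4)[OF L a(1), of x] x q a(3) by simp
        then have "(e v \<oplus> j) \<ominus> j \<in> ?L" using JL[OF a(2)] by (rule left_idealD(6)[OF L])
        then show False using n ev a(2) by (simp add: minus_eq a_assoc r_neg)
      qed
    qed
  next
    assume *: "\<forall>v \<in> V. x \<otimes> e v \<in> J \<or> quot (e v) \<in> N"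
    have "x \<otimes> e v \<in> ?L" if v: "v \<in> V" for v
      using * v JL left_idealD(4)[OF L x, of "e v"] e_closed by blast
    then have "(\<Oplus>v\<in>V. x \<otimes> e v) \<in> ?L" by (rule zsub_finsum[OF left_ideal_zsub[OF L]])
    then show "quot x \<in> N" using sum_mult_e x by simp
  }
qed

lemma quotient_left_ideal_eqI:
  assumes N: "submodule N B (regular_module B)" and K: "submodule K B (regular_module B)"
    and eq: "\<And>v. v \<in> V \<Longrightarrow> quot (e v) \<in> N \<longleftrightarrow> quot (e v) \<in> K"
  shows "N = K"
proof -
  interpret rB: left_module B "regular_module B" by (rule left_module_regular[OF ring_B])
  have "quot x \<in> N \<longleftrightarrow> quot x \<in> K" if "x \<in> carrier A" for x
    using mem_quotient_left_ideal[OF N that] mem_quotient_left_ideal[OF K that] eq by blast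
  moreover have "N \<subseteq> quot ` carrier A" "K \<subseteq> quot ` carrier A"
    using rB.submoduleD(1)[OF N] rB.submoduleD(1)[OF K] by (auto simp: carrier_B)
  ultimately show ?thesis by blast
qed

text \<open>
  By the previous lemma the quotient has only finitely many left ideals.
\<close>

lemma artinian_quotient: "artinian_module B (regular_module B)"
  unfolding artinian_module_def
proof (intro conjI allI impI)
  show "left_module B (regular_module B)" by (rule left_module_regular[OF ring_B])
  fix N :: "nat \<Rightarrow> 'a set set"
  assume N: "\<forall>i. submodule (N i) B (regular_module B) \<and> N (Suc i) \<subseteq> N i"
  define D where "D i = {v \<in> V. quot (e v) \<in> N i}" for i
  have mono: "N j \<subseteq> N i" if "i \<le> j" for i j
    using lift_Suc_antimono_le[of N i j] N that by blast
  have fin: "finite (D i)" for i using finite_V unfolding D_def by simp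
  \<comment> \<open>The later sets of vertices lie in \<open>D n\<close> and cannot be smaller, so
    they equal it.\<close>
  obtain n where n: "\<And>i. card (D n) \<le> card (D i)"
    using ex_has_least_nat[of "\<lambda>_. True" 0 "\<lambda>i. card (D i)"] by blast
  have "N i = N n" if "i \<ge> n" for i
  proof (rule quotient_left_ideal_eqI)
    have "D i \<subseteq> D n" using mono[OF that] unfolding D_def by blast
    then have "D i = D n" using card_subset_eq[OF fin] n[of i] card_mono[OF fin] by (meson le_antisym)
    then show "quot (e v) \<in> N i \<longleftrightarrow> quot (e v) \<in> N n" if "v \<in> V" for v
      using that unfolding D_def by blast
  qed (use N in auto)
  then show "\<exists>n. \<forall>i \<ge> n. N i = N n" by blast
qed

text \<open>A nonzero element of the image is the class of some \<open>a e v\<close> outside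
  \<open>J\<close>, and \<open>unit_left\<close> carries it back to the class of
  \<open>e v\<close>.\<close>

lemma simple_quotient:
  assumes v: "v \<in> V"
  shows "simple_submodule (quot ` (carrier A #> e v)) B (regular_module B)"
proof -
  interpret rB: left_module B "regular_module B" by (rule left_module_regular[OF ring_B])
  have ev: "e v \<in> carrier A" using e_closed v by simp
  let ?S = "quot ` (carrier A #> e v)"
  have S: "submodule ?S B (regular_module B)"
    by (rule image_quot_submodule[OF principal_left_ideal[OF ev]])
  have "quot (e v) \<in> ?S" using principal_self[OF ev] by blast
  moreover have "quot (e v) \<noteq> \<zero>\<^bsub>B\<^esub>" using quot_eq_zero_iff[OF ev] e_notin_J[OF v] by simp
  moreover have "K = {\<zero>\<^bsub>B\<^esub>} \<or> K = ?S" if K: "submodule K B (regular_module B)" "K \<subseteq> ?S" for K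
  proof (cases "K \<subseteq> {\<zero>\<^bsub>B\<^esub>}")
    case True
    then show ?thesis using rB.submoduleD(2)[OF K(1)] by auto
  next
    case False
    then obtain k where k: "k \<in> K" "k \<noteq> \<zero>\<^bsub>B\<^esub>" by blast
    then have "k \<in> ?S" using K(2) by blast
    then obtain y where "y \<in> carrier A #> e v" "k = quot y" by blast
    then obtain a where a: "a \<in> carrier A" "k = quot (a \<otimes> e v)"
      unfolding mem_r_coset_iff by blast
    have "a \<otimes> e v \<notin> J" using k a ev quot_eq_zero_iff by simp
    then obtain b where b: "b \<in> carrier A" "b \<otimes> (a \<otimes> e v) = e v" using unit_left[OF a(1) v] by blast
    have L: "left_ideal {y \<in> carrier A. quot y \<in> K}" by (rule pullback_left_ideal[OF K(1)])
    have "b \<otimes> (a \<otimes> e v) \<in> {y \<in> carrier A. quot y \<in> K}"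
      by (rule left_idealD(4)[OF L b(1)]) (use k a ev in simp)
    then have "e v \<in> {y \<in> carrier A. quot y \<in> K}" using b by simp
    then have "carrier A #> e v \<subseteq> {y \<in> carrier A. quot y \<in> K}" by (rule principal_least[OF L])
    then show ?thesis using K(2) by blast
  qed
  ultimately show ?thesis
    using S unfolding simple_submodule_def by auto
qed

text \<open>The span of the simple submodules contains the class of each \<open>e v\<close>, and
  these classes decide which left ideal it is.\<close>

lemma semisimple_quotient: "semisimple_module B (regular_module B)"
proof -
  interpret rB: left_module B "regular_module B" by (rule left_module_regular[OF ring_B])
  let ?U = "\<Union>{N. simple_submodule N B (regular_module B)}"
  have U: "?U \<subseteq> carrier (regular_module B)"
    using rB.submoduleD(1) unfolding simple_submodule_def by blast
  let ?S = "submodule_span B (regular_module B) ?U"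
  have S: "submodule ?S B (regular_module B)" by (rule rB.submodule_span_submodule[OF U])
  have "?S = carrier B"
  proof (rule quotient_left_ideal_eqI[OF S])
    show "submodule (carrier B) B (regular_module B)" using rB.submodule_carrier by simp
    fix v assume v: "v \<in> V"
    have "quot (e v) \<in> quot ` (carrier A #> e v)" using principal_self e_closed v by blast
    then have "quot (e v) \<in> ?U" using simple_quotient[OF v] by blast
    then have "quot (e v) \<in> ?S" by (rule subsetD[OF rB.submodule_span_superset])
    then show "quot (e v) \<in> ?S \<longleftrightarrow> quot (e v) \<in> carrier B" using quot_closed e_closed v by simp
  qed
  then show ?thesis
    using rB.left_module_axioms unfolding semisimple_module_def module_socle_def submodule_sum_def by simp
qed

text \<open>
  Modulo \<open>J\<close> every idempotent is the sum of those \<open>e v\<close> that it does not annihilate.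
\<close>

lemma idempotent_lifting:
  assumes x: "x \<in> carrier A" and id: "x \<otimes> x \<ominus> x \<in> J"
  shows "\<exists>f \<in> carrier A. f \<otimes> f = f \<and> f \<ominus> x \<in> J"
proof -
  define S where "S = {v \<in> V. x \<otimes> e v \<notin> J}"
  define f where "f = (\<Oplus>v\<in>S. e v)"
  have S: "finite S" "S \<subseteq> V" using finite_V unfolding S_def by auto
  have fc: "f \<in> carrier A" unfolding f_def using S e_closed by (intro finsum_closed) auto
  have fe: "f \<otimes> e v = (if v \<in> S then e v else \<zero>)" if v: "v \<in> V" for v
    unfolding f_def using S
  proof (induction S rule: finite_induct)
    case (insert w S)
    then have "e \<in> S \<rightarrow> carrier A" "e w \<in> carrier A" using e_closed by auto
    then show ?case using insert v e_closed by (auto simp: l_distr e_mult)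
  qed (use v e_closed in simp)
  have "f \<otimes> f = (\<Oplus>v\<in>S. f \<otimes> e v)"
    unfolding f_def[of] using S e_closed fc[unfolded f_def] by (intro finsum_rdistr) auto
  also have "\<dots> = f" unfolding f_def by (rule finsum_cong') (use S fe e_closed in \<open>auto simp: f_def\<close>)
  finally have ff: "f \<otimes> f = f" .
  have "(f \<ominus> x) \<otimes> e v \<in> J" if v: "v \<in> V" for v
  proof -
    have ev: "e v \<in> carrier A" using e_closed v by simp
    show ?thesis
    proof (cases "v \<in> S")
      case False
      then have "x \<otimes> e v \<in> J" using v unfolding S_def by simp
      moreover have "(f \<ominus> x) \<otimes> e v = \<ominus> (x \<otimes> e v)"
        using fe[OF v] False fc x ev by (simp add: minus_eq l_distr l_minus)
      ultimately show ?thesis using J_minus by simp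
    next
      case True
      have "x \<otimes> e v \<notin> J" using True unfolding S_def by simp
      then obtain z y j where z: "z \<in> Z" "j \<in> J" "x \<otimes> e v = z \<otimes> e v \<oplus> j" and y: "y \<in> Z"
        and yz: "y \<otimes> z = \<one>"
        using unit_scalar_part[OF x v] by metis
      have xx: "(x \<otimes> x \<ominus> x) \<otimes> e v \<in> J" by (rule J_rmult[OF ev id])
      \<comment> \<open>Modulo \<open>J\<close> the hypothesis says
        \<open>z (x e v) = x e v\<close>. Multiplying by the inverse \<open>y\<close> of
        \<open>z\<close> gives \<open>x e v = y (x e v) = e v\<close>. The equations
        \<open>e1\<close>, \<open>e2\<close> and \<open>e3\<close> carry the terms in
        \<open>J\<close> along.\<close>
      have "x \<otimes> (x \<otimes> e v) = z \<otimes> (x \<otimes> e v) \<oplus> x \<otimes> j"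
      proof -
        have "x \<otimes> (x \<otimes> e v) = x \<otimes> (z \<otimes> e v \<oplus> j)" using z(3) by simp
        also have "\<dots> = x \<otimes> (z \<otimes> e v) \<oplus> x \<otimes> j" using x z(1,2) ev by (simp add: r_distr)
        also have "x \<otimes> (z \<otimes> e v) = z \<otimes> (x \<otimes> e v)" by (rule Z_lcomm[OF z(1) x ev])
        finally show ?thesis .
      qed
      then have e1: "(x \<otimes> x \<ominus> x) \<otimes> e v = z \<otimes> (x \<otimes> e v) \<oplus> x \<otimes> j \<oplus> \<ominus> (x \<otimes> e v)"
        using x ev by (simp add: minus_eq l_distr l_minus m_assoc)
      have e2: "y \<otimes> ((x \<otimes> x \<ominus> x) \<otimes> e v) = x \<otimes> e v \<oplus> y \<otimes> (x \<otimes> j) \<oplus> \<ominus> (y \<otimes> (x \<otimes> e v))"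
      proof -
        have "y \<otimes> (z \<otimes> (x \<otimes> e v)) = x \<otimes> e v" using y z x ev yz by (simp add: m_assoc[symmetric])
        then show ?thesis unfolding e1 using y z x ev by (simp add: r_distr r_minus)
      qed
      have e3: "y \<otimes> (x \<otimes> e v) = e v \<oplus> y \<otimes> j"
        unfolding z(3) using y z ev yz by (simp add: r_distr m_assoc[symmetric])
      have "(f \<ominus> x) \<otimes> e v = e v \<ominus> x \<otimes> e v"
        using fe[OF v] True fc x ev by (simp add: minus_eq l_distr l_minus)
      also have "\<dots> = (y \<otimes> (x \<otimes> j) \<ominus> y \<otimes> j) \<ominus> y \<otimes> ((x \<otimes> x \<ominus> x) \<otimes> e v)"
      proof -
        define p q r where "p = x \<otimes> e v" and "q = y \<otimes> (x \<otimes> j)" and "r = y \<otimes> j"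
        have c: "p \<in> carrier A" "q \<in> carrier A" "r \<in> carrier A"
          unfolding p_def q_def r_def using x y z ev by auto
        have "r \<oplus> (e v \<oplus> (\<ominus> p \<oplus> \<ominus> r)) = (r \<oplus> \<ominus> r) \<oplus> (e v \<oplus> \<ominus> p)"
          using c ev by (simp add: a_ac)
        also have "\<dots> = e v \<oplus> \<ominus> p" using c ev by (simp add: r_neg)
        finally have "(q \<ominus> r) \<ominus> (p \<oplus> q \<oplus> \<ominus> (e v \<oplus> r)) = e v \<ominus> p"
          using c ev by (simp add: minus_eq minus_add a_ac r_neg r_neg1 r_neg2)
        then show ?thesis unfolding e2 e3 p_def q_def r_def by simp
      qed
      also have "\<dots> \<in> J"
      proof -
        have "y \<otimes> (x \<otimes> j) \<in> J" "y \<otimes> j \<in> J" "y \<otimes> ((x \<otimes> x \<ominus> x) \<otimes> e v) \<in> J"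
          using J_lmult y x z xx by auto
        then show ?thesis using left_idealD(6)[OF J_left_ideal] by blast
      qed
      finally show ?thesis .
    qed
  qed
  then have "(\<Oplus>v\<in>V. (f \<ominus> x) \<otimes> e v) \<in> J" by (rule zsub_finsum[OF zsub_J])
  then have "f \<ominus> x \<in> J" using sum_mult_e[of "f \<ominus> x"] fc x by simp
  then show ?thesis using fc ff by blast
qed

lemma noetherian_both: "two_sided_noetherian A"
  using ring_axioms noetherian_left quiver_algebra.noetherian_left[OF quiver_algebra_opposite]
  unfolding two_sided_noetherian_def by blast

lemma semiperfect: "semiperfect_ring A"
proof -
  interpret op: local_quiver_algebra "opposite_ring A" V E t h e arr Z
    by (rule local_quiver_algebra_opposite)
  have "artinian_module (opposite_ring B) (regular_module (opposite_ring B))"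
    using op.artinian_quotient unfolding arrow_ideal_opposite opposite_ring_Quot .
  then have "semisimple_artinian_ring B"
    using ring_B semisimple_quotient artinian_quotient unfolding semisimple_artinian_ring_def by blast
  then show ?thesis
    using ring_axioms idempotent_lifting unfolding semiperfect_ring_def jacobson_radical_eq by blast
qed

end

section \<open>Projective covers\<close>

context string_quiver_algebra
begin

lemma string_quiver_algebra_opposite: "string_quiver_algebra (opposite_ring A) V E t h e arr Z"
proof (intro string_quiver_algebra.intro local_quiver_algebra_opposite string_quiver_algebra_axioms.intro,
    unfold opposite_ring_simps r_coset_opposite_ring l_coset_opposite_ring)
  show "(arr a <# carrier A) \<inter> (arr b <# carrier A) = {\<zero>}"
    if "a \<in> E" "b \<in> E" "a \<noteq> b" "h a = h b" for a b using direct_right[OF that] .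
  show "(carrier A #> arr a) \<inter> (carrier A #> arr b) = {\<zero>}"
    if "a \<in> E" "b \<in> E" "a \<noteq> b" "t a = t b" for a b using direct_left[OF that] .
  show "card {a \<in> E. h a = v} \<le> 2" if "v \<in> V" for v using degree_right[OF that] .
  show "card {a \<in> E. t a = v} \<le> 2" if "v \<in> V" for v using degree_left[OF that] .
  show "arr a \<noteq> \<zero>" if "a \<in> E" for a using arr_nonzero[OF that] .
  show "a = a'" if "a \<in> E" "a' \<in> E" "b \<in> E" "arr b \<otimes> arr a \<noteq> \<zero>" "arr b \<otimes> arr a' \<noteq> \<zero>" for a a' b
    using special_right[OF that] .
  show "a = a'" if "a \<in> E" "a' \<in> E" "b \<in> E" "arr a \<otimes> arr b \<noteq> \<zero>" "arr a' \<otimes> arr b \<noteq> \<zero>" for a a' b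
    using special_left[OF that] .
qed

text \<open>Applying \<open>g\<close> to \<open>a x = 0\<close> yields \<open>a e v = 0\<close>,
  which is the injectivity that \<open>biserial_projective\<close> asks for.\<close>

lemma projective_indecomposable_biserial:
  assumes P: "projective_module A P" and ind: "indecomposable_module A P"
  shows "biserial_module A P"
proof -
  have M: "left_module A P" using P unfolding projective_module_def by blast
  obtain v x g where g: "v \<in> V" "x \<in> carrier P" "e v \<odot>\<^bsub>P\<^esub> x = x"
    "carrier P = (\<lambda>a. a \<odot>\<^bsub>P\<^esub> x) ` carrier A"
    "g \<in> module_hom A P (regular_module A)" "g x = e v"
    using indecomposable_projective_generator[OF P ind] .
  have "a \<otimes> e v = \<zero>" if a: "a \<in> carrier A" "a \<odot>\<^bsub>P\<^esub> x = \<zero>\<^bsub>P\<^esub>" for a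
    using module_homD(3)[OF g(5) a(1) g(2)] a(2) g(6)
      module_hom_zero[OF g(5) M reg.left_module_axioms] by simp
  then show ?thesis by (rule biserial_projective[OF M g(1-4)])
qed

lemma biserial: "biserial_ring TYPE('m) A"
  using noetherian_both semiperfect projective_indecomposable_biserial
    string_quiver_algebra.projective_indecomposable_biserial[OF string_quiver_algebra_opposite]
  unfolding biserial_ring_def by blast

lemma left_module_ideal: "left_ideal H \<Longrightarrow> left_module A (ideal_module A H)"
  unfolding ideal_module_def by (rule reg.left_module_restrict)

lemma submodule_ideal_module_iff:
  "left_ideal H \<Longrightarrow> submodule N A (ideal_module A H) \<longleftrightarrow> left_ideal N \<and> N \<subseteq> H"
  unfolding ideal_module_def by (rule reg.submodule_restrict_iff)

lemma a_kernel_eq: "a_kernel M N f = {x \<in> carrier M. f x = \<zero>\<^bsub>N\<^esub>}"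
  by (simp add: a_kernel_def')

text \<open>A homomorphism from \<open>A e v\<close> is determined by the image of
  \<open>e v\<close>. Any \<open>m\<close> lying over that image gives the lift sending
  \<open>y\<close> to \<open>y m\<close>, because \<open>y e v = y\<close>.\<close>

lemma projective_e:
  assumes v: "v \<in> V"
  shows "projective_module A (ideal_module A (carrier A #> e v) :: ('a, 'a) module)"
proof -
  have ev: "e v \<in> carrier A" using e_closed v by simp
  have H: "left_ideal (carrier A #> e v)" by (rule principal_left_ideal[OF ev])
  let ?P = "ideal_module A (carrier A #> e v)"
  have yc: "y \<in> carrier A" "y \<otimes> e v = y" if "y \<in> carrier A #> e v" for y
    using that ev v by (auto simp: mem_r_coset_iff m_assoc e_mult)
  have lift: "\<exists>k \<in> module_hom A ?P M. \<forall>x \<in> carrier ?P. g (k x) = f x"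
    if M: "left_module A M" and N: "left_module A N" and g: "g \<in> module_hom A M N"
      and surj: "g ` carrier M = carrier N" and f: "f \<in> module_hom A ?P N"
    for M :: "('a, 'a \<Rightarrow> 'a) module" and N :: "('a, 'a) module" and g f
  proof -
    interpret M: left_module A M by (rule M)
    have eP: "e v \<in> carrier ?P" using principal_self[OF ev] by simp
    then have "f (e v) \<in> g ` carrier M" using module_homD(1)[OF f] surj by simp
    then obtain m where m: "m \<in> carrier M" "g m = f (e v)" by (metis imageE)
    have "(\<lambda>y. y \<odot>\<^bsub>M\<^esub> m) \<in> module_hom A ?P M"
      using yc(1) m(1) unfolding module_hom_iff
      by (auto simp: M.smult_closed M.smult_l_distr M.smult_assoc)
    moreover have "\<forall>y \<in> carrier ?P. g (y \<odot>\<^bsub>M\<^esub> m) = f y"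
    proof
      fix y assume y: "y \<in> carrier ?P"
      have y': "y \<in> carrier A" "y \<otimes> e v = y" using yc y by auto
      have "g (y \<odot>\<^bsub>M\<^esub> m) = y \<odot>\<^bsub>N\<^esub> f (e v)" using module_homD(3)[OF g y'(1) m(1)] m(2) by simp
      also have "\<dots> = f (y \<otimes> e v)" using module_homD(3)[OF f y'(1) eP] by simp
      finally show "g (y \<odot>\<^bsub>M\<^esub> m) = f y" using y' by simp
    qed
    ultimately show ?thesis by (intro bexI[of _ "\<lambda>y. y \<odot>\<^bsub>M\<^esub> m"])
  qed
  show ?thesis
    unfolding projective_module_def
  proof (intro conjI allI impI)
    show "left_module A ?P" by (rule left_module_ideal[OF H])
  qed (elim conjE, rule lift)
qed

text \<open>The cover is right multiplication by \<open>word p\<close> on \<open>A e v\<close>. An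
  element of its kernel outside \<open>J\<close> could be multiplied to \<open>e v\<close> and would
  force \<open>word p\<close> to vanish, so the kernel lies in \<open>J\<close>.\<close>

lemma projective_cover_exists:
  assumes p: "p \<noteq> []" "set p \<subseteq> E" "word p \<noteq> \<zero>"
  shows "\<exists>(P :: ('a, 'a) module) \<pi>. projective_cover A P \<pi> (ideal_module A (carrier A #> word p))"
proof -
  define v where "v = h (hd p)"
  have v: "v \<in> V" using p h_V unfolding v_def by (cases p) auto
  have ev: "e v \<in> carrier A" using e_closed v by simp
  have wp: "word p \<in> carrier A" "e v \<otimes> word p = word p" using p e_word unfolding v_def by auto
  have H: "left_ideal (carrier A #> e v)" by (rule principal_left_ideal[OF ev])
  have Hp: "left_ideal (carrier A #> word p)" by (rule principal_left_ideal[OF wp(1)])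
  let ?P = "ideal_module A (carrier A #> e v)" and ?M = "ideal_module A (carrier A #> word p)"
  let ?\<pi> = "\<lambda>y. y \<otimes> word p"
  interpret P: left_module A ?P by (rule left_module_ideal[OF H])
  have yc: "y \<in> carrier A" "y \<otimes> e v = y" if "y \<in> carrier A #> e v" for y
    using that ev v by (auto simp: mem_r_coset_iff m_assoc e_mult)
  have hom: "?\<pi> \<in> module_hom A ?P ?M"
    using yc(1) wp unfolding module_hom_iff by (auto simp: l_distr m_assoc intro: r_cosetI)
  have "?\<pi> ` carrier ?P = carrier ?M"
  proof
    show "?\<pi> ` carrier ?P \<subseteq> carrier ?M" using module_homD(1)[OF hom] by blast
    show "carrier ?M \<subseteq> ?\<pi> ` carrier ?P"
    proof
      fix y assume "y \<in> carrier ?M"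
      then obtain a where a: "a \<in> carrier A" "y = a \<otimes> word p" by (auto simp: mem_r_coset_iff)
      then have "y = ?\<pi> (a \<otimes> e v)" using ev wp by (simp add: m_assoc)
      moreover have "a \<otimes> e v \<in> carrier ?P" using r_cosetI[OF a(1)] by simp
      ultimately show "y \<in> ?\<pi> ` carrier ?P" by blast
    qed
  qed
  moreover have "superfluous_submodule (a_kernel ?P ?M ?\<pi>) A ?P"
    unfolding superfluous_submodule_def a_kernel_eq
  proof (intro conjI allI impI)
    let ?K = "{x \<in> carrier ?P. ?\<pi> x = \<zero>\<^bsub>?M\<^esub>}"
    show "submodule ?K A ?P"
      using P.submoduleD(1-4)[OF P.submodule_carrier] yc(1) wp unfolding P.submodule_iff
      by (auto simp: l_distr m_assoc)
    fix N assume N: "submodule N A ?P \<and> ?K <+>\<^bsub>?P\<^esub> N = carrier ?P"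
    then have lN: "left_ideal N" "N \<subseteq> carrier A #> e v" using submodule_ideal_module_iff[OF H] by auto
    have "e v \<in> ?K <+>\<^bsub>?P\<^esub> N" using N principal_self[OF ev] by simp
    then obtain k n where k: "k \<in> ?K" "n \<in> N" "e v = k \<oplus> n" by (auto simp: mem_set_add_iff)
    have kc: "k \<in> carrier A" "k \<otimes> e v = k" using k(1) yc by auto
    have nc: "n \<in> carrier A" "n \<otimes> e v = n" using k(2) lN yc by auto
    have "k \<in> J"
    proof (rule ccontr)
      assume "k \<notin> J"
      then obtain a where a: "a \<in> carrier A" "a \<otimes> (k \<otimes> e v) = e v"
        using unit_left[OF kc(1) v] kc by auto
      have "word p = (a \<otimes> k) \<otimes> word p" using a kc wp by simp
      also have "\<dots> = a \<otimes> (k \<otimes> word p)" using a(1) kc(1) wp(1) by (rule m_assoc)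
      also have "\<dots> = \<zero>" using k(1) a by simp
      finally show False using p by simp
    qed
    have "n \<notin> J"
    proof
      assume "n \<in> J"
      then have "k \<oplus> n \<in> J" using zsubD(3)[OF zsub_J \<open>k \<in> J\<close>] by blast
      then show False using e_notin_J[OF v] k(3) by simp
    qed
    then obtain a where a: "a \<in> carrier A" "a \<otimes> (n \<otimes> e v) = e v"
      using unit_left[OF nc(1) v] nc by auto
    then have "e v \<in> N" using left_idealD(4)[OF lN(1) a(1) k(2)] nc by simp
    then show "N = carrier ?P" using principal_least[OF lN(1)] lN(2) by auto
  qed
  ultimately have "projective_cover A ?P ?\<pi> ?M"
    using projective_e[OF v] left_module_ideal[OF Hp] hom unfolding projective_cover_def by blast
  then show ?thesis by blast
qed

lemma projective_cover_kernel:
  fixes P :: "('a, 'm) module"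
  assumes p: "p \<noteq> []" "set p \<subseteq> E" "word p \<noteq> \<zero>"
    and cov: "projective_cover A P \<pi> (ideal_module A (carrier A #> word p))"
  shows "direct_sum_of_at_most A 2 {ideal_module A (carrier A #> word q) | q. annihilating_word p q}
    (P\<lparr>carrier := a_kernel P (ideal_module A (carrier A #> word p)) \<pi>\<rparr>)"
proof -
  let ?M = "ideal_module A (carrier A #> word p)"
  let ?K = "a_kernel P ?M \<pi>"
  have P: "projective_module A P" and M: "left_module A ?M" and hom: "\<pi> \<in> module_hom A P ?M"
    and surj: "\<pi> ` carrier P = carrier ?M" and K: "submodule ?K A P"
    and sup: "\<And>N. submodule N A P \<Longrightarrow> ?K <+>\<^bsub>P\<^esub> N = carrier P \<Longrightarrow> N = carrier P"
    using cov unfolding projective_cover_def superfluous_submodule_def by auto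
  interpret P: left_module A P using P unfolding projective_module_def by blast
  define v where "v = h (hd p)"
  have v: "v \<in> V" using p h_V unfolding v_def by (cases p) auto
  have ev: "e v \<in> carrier A" using e_closed v by simp
  have wp: "word p \<in> carrier A" "e v \<otimes> word p = word p" using p e_word unfolding v_def by auto
  have "word p \<in> \<pi> ` carrier P" using surj principal_self[OF wp(1)] by simp
  then obtain y where y: "y \<in> carrier P" "\<pi> y = word p" by (metis imageE)
  \<comment> \<open>Replacing \<open>y\<close> by \<open>e v y\<close> keeps its image, since
    \<open>e v\<close> fixes \<open>word p\<close>, and makes \<open>x\<close> fixed by
    \<open>e v\<close>.\<close>
  define x where "x = e v \<odot>\<^bsub>P\<^esub> y"
  have x: "x \<in> carrier P" "e v \<odot>\<^bsub>P\<^esub> x = x"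
    using ev y(1) v P.smult_assoc[OF ev ev y(1)] unfolding x_def by (auto simp: P.smult_closed e_mult)
  have px: "\<pi> x = word p" unfolding x_def using module_homD(3)[OF hom ev y(1)] y wp by simp
  have pa: "\<pi> (a \<odot>\<^bsub>P\<^esub> x) = a \<otimes> word p" if "a \<in> carrier A" for a
    using module_homD(3)[OF hom that x(1)] px by simp
  let ?N = "(\<lambda>a. a \<odot>\<^bsub>P\<^esub> x) ` carrier A"
  have N: "submodule ?N A P"
    by (rule image_submodule[OF P.left_module_axioms x(1)]) (use reg.submodule_carrier in simp)
  have "?K <+>\<^bsub>P\<^esub> ?N = carrier P"
  proof
    show "?K <+>\<^bsub>P\<^esub> ?N \<subseteq> carrier P" using P.submoduleD(1)[OF P.submodule_set_add[OF K N]] .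
    show "carrier P \<subseteq> ?K <+>\<^bsub>P\<^esub> ?N"
    proof
      fix z assume z: "z \<in> carrier P"
      then have "\<pi> z \<in> carrier A #> word p" using module_homD(1)[OF hom z] by simp
      then obtain a where a: "a \<in> carrier A" "\<pi> z = a \<otimes> word p" by (auto simp: mem_r_coset_iff)
      have ax: "a \<odot>\<^bsub>P\<^esub> x \<in> carrier P" "(\<ominus> a) \<odot>\<^bsub>P\<^esub> x \<in> carrier P" using P.smult_closed a(1) x(1) by auto
      let ?k = "z \<oplus>\<^bsub>P\<^esub> (\<ominus> a) \<odot>\<^bsub>P\<^esub> x"
      have "\<pi> ?k = a \<otimes> word p \<oplus> (\<ominus> a) \<otimes> word p"
        using module_homD(2)[OF hom z ax(2)] pa[of "\<ominus> a"] a by simp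
      then have "?k \<in> ?K" using z ax a(1) wp(1) unfolding a_kernel_eq by (simp add: l_minus r_neg)
      moreover have "z = ?k \<oplus>\<^bsub>P\<^esub> a \<odot>\<^bsub>P\<^esub> x"
        using z ax(1) P.smult_l_minus[OF a(1) x(1)] by (simp add: P.M.a_assoc P.M.l_neg)
      moreover have "a \<odot>\<^bsub>P\<^esub> x \<in> ?N" using a by blast
      ultimately show "z \<in> ?K <+>\<^bsub>P\<^esub> ?N" unfolding mem_set_add_iff by blast
    qed
  qed
  then have gen: "carrier P = ?N" using sup[OF N] by simp
  have nz: "x \<noteq> \<zero>\<^bsub>P\<^esub>"
    using px p(3) module_hom_zero[OF hom P.left_module_axioms M] by auto
  obtain g where g: "g \<in> module_hom A P (regular_module A)" "g x = e v"
    using projective_generator[OF P x(1) v x(2) nz gen] by blast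
  have inj: "a \<otimes> e v = \<zero>" if a: "a \<in> carrier A" "a \<odot>\<^bsub>P\<^esub> x = \<zero>\<^bsub>P\<^esub>" for a
    using module_homD(3)[OF g(1) a(1) x(1)] a(2) g(2)
      module_hom_zero[OF g(1) P.left_module_axioms reg.left_module_axioms] by simp
  have "?K = {a \<odot>\<^bsub>P\<^esub> x | a. a \<in> carrier A \<and> a \<otimes> word p = \<zero>}"
    unfolding a_kernel_eq using gen pa by auto
  then show ?thesis
    by (intro kernel_direct_sum[OF P.left_module_axioms p x(1) _ gen])
      (use x(2) inj in \<open>auto simp: v_def\<close>)
qed

end

section \<open>Locality of the vertex modules\<close>

context quiver_algebra
begin

text \<open>Turns the module conditions into the conditions of the locale. The third hypothesis
  expresses in \<open>Z\<close> that in a local ring either \<open>z\<close> or every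
  \<open>\<one> - y z\<close> is a unit.\<close>

lemma local_quiver_algebraI:
  assumes local: "\<And>v. v \<in> V \<Longrightarrow> local_module A (ideal_module A (carrier A #> e v))"
    and rad: "\<And>v. v \<in> V \<Longrightarrow> module_radical A (ideal_module A (carrier A #> e v)) =
      submodule_sum A (regular_module A) {carrier A #> arr a | a. a \<in> E \<and> t a = v}"
    and Z_local: "\<And>z. z \<in> Z \<Longrightarrow>
      (\<exists>z' \<in> Z. z \<otimes> z' = \<one>) \<or> (\<forall>y \<in> Z. \<exists>z' \<in> Z. z' \<otimes> (\<one> \<ominus> y \<otimes> z) = \<one>)"
  shows "local_quiver_algebra A V E h t e arr Z"
proof -
  have sub: "submodule N A (ideal_module A H) \<longleftrightarrow> left_ideal N \<and> N \<subseteq> H" if "left_ideal H" for N H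
    unfolding ideal_module_def by (rule reg.submodule_restrict_iff[OF that])
  have ev: "e v \<in> carrier A" "left_ideal (carrier A #> e v)" if "v \<in> V" for v
    using e_closed[OF that] principal_left_ideal by auto
  have yc: "y \<in> carrier A" "y \<otimes> e v = y" if "v \<in> V" "y \<in> carrier A #> e v" for v y
    using that ev by (auto simp: mem_r_coset_iff m_assoc e_mult)
  have J0: "\<zero> \<in> J" using zsubD(2)[OF zsub_J] .
  \<comment> \<open>The arrows with tail \<open>v\<close> generate exactly the part of
    \<open>J\<close> inside \<open>A e v\<close>, so the unique maximal submodule is that
    part.\<close>
  have maximal_iff: "maximal_submodule N A (ideal_module A (carrier A #> e v)) \<longleftrightarrow>
      N = J \<inter> (carrier A #> e v)" if v: "v \<in> V" for v N
  proof -
    let ?H = "carrier A #> e v"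
    let ?F = "{carrier A #> arr a | a. a \<in> E \<and> t a = v}"
    let ?S = "submodule_sum A (regular_module A) ?F"
    obtain K where K: "\<And>N. maximal_submodule N A (ideal_module A ?H) \<longleftrightarrow> N = K"
      using local[OF v] unfolding local_module_def by blast
    then have "maximal_submodule K A (ideal_module A ?H)" by blast
    then have "K \<subseteq> ?H" using sub[OF ev(2)[OF v]] unfolding maximal_submodule_def by blast
    then have "module_radical A (ideal_module A ?H) = K"
      unfolding module_radical_def K by auto
    then have KS: "K = ?S" using rad[OF v] by simp
    have JH: "left_ideal (J \<inter> ?H)" by (rule reg.submodule_Int[OF J_left_ideal ev(2)[OF v]])
    have arr: "arr a \<in> J \<inter> ?H" if "a \<in> E" "t a = v" for a
      using arr_in_J[OF that(1)] r_cosetI[OF arr_closed[OF that(1)], of "e v"] arr_e[OF that(1)] that by simp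
    have F: "\<Union>?F \<subseteq> J \<inter> ?H" using principal_least[OF JH arr] by blast
    have "?S \<subseteq> J \<inter> ?H"
      unfolding submodule_sum_def by (rule reg.submodule_span_least[OF JH F])
    moreover have "J \<inter> ?H \<subseteq> ?S"
    proof
      fix y assume y: "y \<in> J \<inter> ?H"
      have S: "left_ideal ?S"
        unfolding submodule_sum_def by (rule reg.submodule_span_submodule) (use F J_carrier in auto)
      have "arr a \<in> ?S" if "a \<in> E" "t a = v" for a
      proof -
        have "arr a \<in> \<Union>?F" using principal_self[OF arr_closed[OF that(1)]] that by blast
        then show ?thesis unfolding submodule_sum_def by (rule subsetD[OF reg.submodule_span_superset])
      qed
      then have "y \<otimes> e v \<in> ?S" using J_e_mem_left_ideal[OF v S] y by blast
      then show "y \<in> ?S" using yc[OF v] y by simp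
    qed
    ultimately show ?thesis using K KS by auto
  qed
  have e_notin: "e v \<notin> J" if v: "v \<in> V" for v
  proof
    assume "e v \<in> J"
    then have "carrier A #> e v \<subseteq> J" by (rule principal_least[OF J_left_ideal])
    then have "J \<inter> (carrier A #> e v) = carrier (ideal_module A (carrier A #> e v))" by auto
    then show False using maximal_iff[OF v] unfolding maximal_submodule_def by blast
  qed
  \<comment> \<open>Without \<open>e v\<close> the ideal \<open>N\<close> would extend to a maximal
    submodule of \<open>A e v\<close>, and that lies in \<open>J\<close>.\<close>
  have extend: "e v \<in> N" if v: "v \<in> V" and N: "left_ideal N" "N \<subseteq> carrier A #> e v" "\<not> N \<subseteq> J" for v N
  proof (rule ccontr)
    assume n: "e v \<notin> N"
    let ?H = "carrier A #> e v"
    let ?F = "{K. left_ideal K \<and> N \<subseteq> K \<and> K \<subseteq> ?H \<and> e v \<notin> K}"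
    obtain K where K: "K \<in> ?F" "\<And>L. L \<in> ?F \<Longrightarrow> K \<subseteq> L \<Longrightarrow> L = K"
    proof (rule acc_module_maximal[OF acc_regular, of ?F])
      show "?F \<noteq> {}" using N n by blast
    qed blast+
    have "L = K \<or> L = ?H" if L: "left_ideal L" "L \<subseteq> ?H" "K \<subseteq> L" for L
    proof (cases "e v \<in> L")
      case True
      then show ?thesis using principal_least[OF L(1)] L(2) by blast
    next
      case False
      then have "L \<in> ?F" using L K(1) by blast
      then show ?thesis using K(2) L(3) by blast
    qed
    moreover have "K \<noteq> ?H" using K(1) principal_self[OF ev(1)[OF v]] by blast
    ultimately have "maximal_submodule K A (ideal_module A ?H)"
      using K(1) unfolding maximal_submodule_def sub[OF ev(2)[OF v]] by auto
    then have "K \<subseteq> J" using maximal_iff[OF v] by blast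
    then show False using K(1) N(3) by blast
  qed
  have left_inverse: "\<exists>u \<in> carrier A. u \<otimes> (\<one> \<oplus> j) = \<one>" if j: "j \<in> J" for j
  proof (rule ccontr)
    assume no: "\<not> (\<exists>u \<in> carrier A. u \<otimes> (\<one> \<oplus> j) = \<one>)"
    have c: "\<one> \<oplus> j \<in> carrier A" using j by simp
    let ?X = "carrier A #> (\<one> \<oplus> j)"
    let ?F = "{K. left_ideal K \<and> ?X \<subseteq> K \<and> \<one> \<notin> K}"
    have "\<one> \<notin> ?X" using no by (auto simp: mem_r_coset_iff)
    obtain M where M: "M \<in> ?F" "\<And>L. L \<in> ?F \<Longrightarrow> M \<subseteq> L \<Longrightarrow> L = M"
    proof (rule acc_module_maximal[OF acc_regular, of ?F])
      show "?F \<noteq> {}" using principal_left_ideal[OF c] \<open>\<one> \<notin> ?X\<close> by blast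
    qed blast+
    have lM: "left_ideal M" using M(1) by blast
    \<comment> \<open>\<open>M\<close> is a maximal left ideal containing
      \<open>\<one> \<oplus> j\<close>. Once it is known to contain \<open>J\<close>, it contains
      \<open>\<one>\<close>, which is the contradiction sought.\<close>
    have "y \<in> M" if y: "y \<in> J" for y
    proof -
      have "y \<otimes> e v \<in> M" if v: "v \<in> V" for v
      proof (rule ccontr)
        assume n: "y \<otimes> e v \<notin> M"
        have ye: "y \<otimes> e v \<in> carrier A" using y ev(1)[OF v] by simp
        let ?L = "M <+>\<^bsub>regular_module A\<^esub> (carrier A #> (y \<otimes> e v))"
        have L: "left_ideal ?L" "M \<subseteq> ?L" "carrier A #> (y \<otimes> e v) \<subseteq> ?L"
          using reg.submodule_set_add[OF lM principal_left_ideal[OF ye]]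
            reg.set_add_upper[OF lM principal_left_ideal[OF ye]] by auto
        then have "y \<otimes> e v \<in> ?L" using principal_self[OF ye] by blast
        then have "?L \<noteq> M" using n by blast
        then have "?L \<notin> ?F" using M(2)[of ?L] L(2) by blast
        then have "\<one> \<in> ?L" using L M(1) by blast
        then obtain m a where m: "m \<in> M" "a \<in> carrier A" "\<one> = m \<oplus> a \<otimes> (y \<otimes> e v)"
          by (auto simp: mem_set_add_iff mem_r_coset_iff)
        have mc: "m \<in> carrier A" using m(1) left_idealD(1)[OF lM] by blast
        \<comment> \<open>Multiplying the decomposition of \<open>\<one>\<close> by
          \<open>e v\<close> on the left gives \<open>e v = n \<oplus> k\<close> with
          \<open>k\<close> in \<open>J\<close>. So \<open>n\<close> is an element of
          \<open>M\<close> that lies in \<open>A e v\<close> but not in \<open>J\<close>, and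
          \<open>extend\<close> puts \<open>e v\<close> into \<open>M\<close>.\<close>
        define k where "k = e v \<otimes> (a \<otimes> (y \<otimes> e v))"
        define n where "n = e v \<otimes> m"
        have kc: "k \<in> carrier A" "n \<in> carrier A" "k \<otimes> e v = k"
          unfolding k_def n_def using ev(1)[OF v] m(2) y mc v by (auto simp: m_assoc e_mult)
        have kJ: "k \<in> J" unfolding k_def using J_lmult J_rmult y m(2) ev(1)[OF v] by simp
        have eq: "e v = n \<oplus> k"
        proof -
          have "e v = e v \<otimes> (m \<oplus> a \<otimes> (y \<otimes> e v))" using ev(1)[OF v] m(3)[symmetric] by simp
          then show ?thesis unfolding n_def k_def using ev(1)[OF v] mc m(2) y by (simp add: r_distr)
        qed
        have "n \<notin> J"
        proof
          assume "n \<in> J"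
          then have "n \<oplus> k \<in> J" using zsubD(3)[OF zsub_J _ kJ] by blast
          then show False using eq e_notin[OF v] by simp
        qed
        have "n = e v \<ominus> k" unfolding eq using kc by (simp add: minus_eq a_assoc r_neg)
        then have "n = n \<otimes> e v" using kc ev(1)[OF v] v by (simp add: minus_eq l_distr l_minus e_mult)
        then have "n \<in> carrier A #> e v" using r_cosetI[OF kc(2), of "e v"] by simp
        then have nH: "carrier A #> n \<subseteq> carrier A #> e v" by (rule principal_least[OF ev(2)[OF v]])
        have nM: "n \<in> M" unfolding n_def using left_idealD(4)[OF lM ev(1)[OF v] m(1)] .
        have "e v \<in> carrier A #> n"
          by (rule extend[OF v principal_left_ideal[OF kc(2)] nH])
            (use principal_self[OF kc(2)] \<open>n \<notin> J\<close> in blast)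
        then have "e v \<in> M" using principal_least[OF lM nM] by blast
        then have "y \<otimes> e v \<in> M" using left_idealD(4)[OF lM] y by simp
        then show False using \<open>y \<otimes> e v \<notin> M\<close> by simp
      qed
      then have "(\<Oplus>v\<in>V. y \<otimes> e v) \<in> M" by (rule zsub_finsum[OF left_ideal_zsub[OF lM]])
      then show ?thesis using sum_mult_e y by simp
    qed
    then have jM: "j \<in> M" using j by blast
    have "\<one> \<oplus> j \<in> M" using M(1) principal_self[OF c] by blast
    then have "(\<one> \<oplus> j) \<ominus> j \<in> M" by (rule left_idealD(6)[OF lM _ jM])
    then have "\<one> \<in> M" using j by (simp add: minus_eq a_assoc r_neg)
    then show False using M(1) by blast
  qed
  show ?thesis
  proof (intro local_quiver_algebra.intro quiver_algebra_axioms local_quiver_algebra_axioms.intro)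
    show "e v \<notin> J" if "v \<in> V" for v by (rule e_notin[OF that])
    show "\<exists>u \<in> carrier A. u \<otimes> (\<one> \<oplus> j) = \<one> \<and> (\<one> \<oplus> j) \<otimes> u = \<one>" if j: "j \<in> J" for j
    proof -
      have jc: "j \<in> carrier A" using j by simp
      obtain u where u: "u \<in> carrier A" "u \<otimes> (\<one> \<oplus> j) = \<one>" using left_inverse[OF j] by blast
      \<comment> \<open>The left inverse \<open>u\<close> is again in \<open>\<one> + J\<close>,
        hence has a left inverse \<open>w\<close> of its own, and associativity identifies
        \<open>w\<close> with \<open>\<one> \<oplus> j\<close>.\<close>
      have "u \<oplus> u \<otimes> j = \<one>" using u jc by (simp add: r_distr)
      then have "u = \<one> \<oplus> \<ominus> (u \<otimes> j)" using u jc by (metis add.inv_closed a_assoc m_closed r_neg r_zero)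
      moreover have "\<ominus> (u \<otimes> j) \<in> J" using J_minus J_lmult[OF u(1) j] by simp
      ultimately obtain w where w: "w \<in> carrier A" "w \<otimes> u = \<one>" using left_inverse by metis
      have "w = w \<otimes> (u \<otimes> (\<one> \<oplus> j))" using u w by simp
      also have "\<dots> = (w \<otimes> u) \<otimes> (\<one> \<oplus> j)" using w(1) u(1) jc by (intro m_assoc[symmetric]) auto
      also have "\<dots> = \<one> \<oplus> j" using w jc by simp
      finally show ?thesis using u w by blast
    qed
    show "z \<in> J \<or> (\<exists>z' \<in> Z. z \<otimes> z' = \<one>)" if z: "z \<in> Z" for z
    proof (rule disjCI)
      assume "\<not> (\<exists>z' \<in> Z. z \<otimes> z' = \<one>)"
      then have unit: "\<exists>z' \<in> Z. z' \<otimes> (\<one> \<ominus> y \<otimes> z) = \<one>" if "y \<in> Z" for y using Z_local[OF z] that by blast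
      \<comment> \<open>Otherwise \<open>a z e v = e v\<close> for some \<open>a\<close>. With
        \<open>y\<close> the scalar part of \<open>a\<close>, the element
        \<open>(\<one> - y z) e v\<close> is in \<open>J\<close>, and cancelling the unit
        \<open>\<one> - y z\<close> would put \<open>e v\<close> into \<open>J\<close>.\<close>
      have "z \<otimes> e v \<in> J" if v: "v \<in> V" for v
      proof (rule ccontr)
        assume n: "z \<otimes> e v \<notin> J"
        note ev' = ev(1)[OF v]
        have ze: "z \<otimes> e v \<in> carrier A" using z ev' by simp
        have "z \<otimes> e v \<in> carrier A #> e v" using z by (intro r_cosetI) simp
        then have "e v \<in> carrier A #> (z \<otimes> e v)"
          by (intro extend[OF v principal_left_ideal[OF ze] principal_least[OF ev(2)[OF v]]])
            (use principal_self[OF ze] n in blast)+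
        then obtain a where a: "a \<in> carrier A" "e v = a \<otimes> (z \<otimes> e v)" by (auto simp: mem_r_coset_iff)
        obtain y j where y: "y \<in> Z" "j \<in> J" "a \<otimes> e v = y \<otimes> e v \<oplus> j"
          using scalar_part[OF a(1) v] by blast
        have "e v = z \<otimes> (y \<otimes> e v \<oplus> j)" using Z_lcomm[OF z a(1) ev'] a(2) y(3) by simp
        also have "\<dots> = y \<otimes> z \<otimes> e v \<oplus> z \<otimes> j"
          using z y ev' Z_central[OF z, of y] by (simp add: r_distr m_assoc[symmetric])
        finally have e1: "e v = y \<otimes> z \<otimes> e v \<oplus> z \<otimes> j" .
        obtain z' where z': "z' \<in> Z" "z' \<otimes> (\<one> \<ominus> y \<otimes> z) = \<one>" using unit[OF y(1)] by blast
        have zj: "z \<otimes> j \<in> J" using zsubD(4)[OF zsub_J z y(2)] .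
        have "(\<one> \<ominus> y \<otimes> z) \<otimes> e v = e v \<ominus> y \<otimes> z \<otimes> e v"
          using y z ev' by (simp add: minus_eq l_distr l_minus)
        also have "\<dots> = z \<otimes> j"
        proof -
          define p where "p = y \<otimes> z \<otimes> e v"
          have pc: "p \<in> carrier A" "z \<otimes> j \<in> carrier A" unfolding p_def using y z ev' by auto
          have "e v = p \<oplus> z \<otimes> j" using e1 unfolding p_def .
          then show ?thesis unfolding p_def[symmetric] using pc by (simp add: minus_eq a_ac r_neg r_neg1 r_neg2)
        qed
        finally have "z' \<otimes> ((\<one> \<ominus> y \<otimes> z) \<otimes> e v) \<in> J" using zsubD(4)[OF zsub_J z'(1) zj] by simp
        moreover have "z' \<otimes> ((\<one> \<ominus> y \<otimes> z) \<otimes> e v) = z' \<otimes> (\<one> \<ominus> y \<otimes> z) \<otimes> e v"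
          using z'(1) y(1) z ev' by (intro m_assoc[symmetric]) auto
        ultimately show False using z'(2) ev' e_notin[OF v] by simp
      qed
      then have "(\<Oplus>v\<in>V. z \<otimes> e v) \<in> J" by (rule zsub_finsum[OF zsub_J])
      then show "z \<in> J" using sum_mult_e z by simp
    qed
  qed
qed

end

section \<open>Quotients of path algebras\<close>

lemma acc_module_commutative_noetherian:
  assumes "cring R" "noetherian_ring R"
  shows "acc_module R (regular_module R)"
proof -
  interpret cring R by (rule assms(1))
  interpret N: noetherian_ring R by (rule assms(2))
  interpret M: left_module R "regular_module R" by (rule left_module_regular[OF ring_axioms])
  have ideal: "ideal L R" if L: "submodule L R (regular_module R)" for L
  proof (rule idealI[OF ring_axioms])
    note D = M.submoduleD[OF L]
    show "subgroup L (add_monoid R)"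
    proof (rule add.subgroupI)
      show "\<ominus>\<^bsub>R\<^esub> a \<in> L" if "a \<in> L" for a
      proof -
        have "a \<in> carrier R" using D(1) that by auto
        then have "\<ominus>\<^bsub>R\<^esub> a = \<ominus>\<^bsub>R\<^esub> \<one>\<^bsub>R\<^esub> \<otimes>\<^bsub>R\<^esub> a" by (simp add: l_minus)
        then show ?thesis using D(4)[of "\<ominus>\<^bsub>R\<^esub> \<one>\<^bsub>R\<^esub>" a] that by simp
      qed
    qed (use D in auto)
    show "x \<otimes>\<^bsub>R\<^esub> a \<in> L" if "a \<in> L" "x \<in> carrier R" for a x using D(4)[OF that(2,1)] by simp
    then show "a \<otimes>\<^bsub>R\<^esub> x \<in> L" if "a \<in> L" "x \<in> carrier R" for a x
      using that D(1) m_comm[of a x] by auto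
  qed
  show ?thesis
    unfolding acc_module_def
  proof (intro allI impI)
    fix C :: "nat \<Rightarrow> _" assume C: "\<forall>i. submodule (C i) R (regular_module R) \<and> C i \<subseteq> C (Suc i)"
    have mono: "C i \<subseteq> C j" if "i \<le> j" for i j using lift_Suc_mono_le[of C i j] C that by blast
    have "C i \<subseteq> C j \<or> C j \<subseteq> C i" for i j using mono nat_le_linear by blast
    then have "subset.chain {I. ideal I R} (range C)"
      using ideal C unfolding subset_chain_def by blast
    then have "\<Union>(range C) \<in> range C" by (intro N.ideal_chain_is_trivial) auto
    then obtain n where n: "\<Union>(range C) = C n" by blast
    have "C i = C n" if "i \<ge> n" for i using mono[OF that] n by blast
    then show "\<exists>n. \<forall>i \<ge> n. C i = C n" by blast
  qed
qed

text \<open>Every nonunit lies in the only maximal ideal, so \<open>s r\<close> does; if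
  \<open>\<one> - s r\<close> were a nonunit as well, their sum \<open>\<one>\<close> would lie
  there too.\<close>

lemma local_ring_unit:
  assumes R: "noetherian_local_ring R \<mm>" and r: "r \<in> carrier R" "r \<notin> Units R" and s: "s \<in> carrier R"
  shows "\<one>\<^bsub>R\<^esub> \<ominus>\<^bsub>R\<^esub> s \<otimes>\<^bsub>R\<^esub> r \<in> Units R"
proof (rule ccontr)
  assume n: "\<one>\<^bsub>R\<^esub> \<ominus>\<^bsub>R\<^esub> s \<otimes>\<^bsub>R\<^esub> r \<notin> Units R"
  have cr: "cring R" "noetherian_ring R" and m: "\<And>M. maximalideal M R \<longleftrightarrow> M = \<mm>"
    using R unfolding noetherian_local_ring_def by auto
  interpret cring R by (rule cr(1))
  interpret M: left_module R "regular_module R" by (rule left_module_regular[OF ring_axioms])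
  have max: "maximalideal \<mm> R" using m by blast
  interpret max: maximalideal \<mm> R by (rule max)
  have mem: "x \<in> \<mm>" if x: "x \<in> carrier R" "x \<notin> Units R" for x
  proof -
    let ?F = "{K. ideal K R \<and> x \<in> K \<and> \<one>\<^bsub>R\<^esub> \<notin> K}"
    have sub: "submodule K R (regular_module R)" if "ideal K R" for K
    proof -
      interpret K: ideal K R by (rule that)
      show ?thesis
        using K.a_subset K.zero_closed K.a_closed K.I_l_closed unfolding M.submodule_iff by auto
    qed
    have "PIdl\<^bsub>R\<^esub> x \<in> ?F"
    proof -
      have "\<one>\<^bsub>R\<^esub> \<notin> PIdl\<^bsub>R\<^esub> x"
      proof
        assume "\<one>\<^bsub>R\<^esub> \<in> PIdl\<^bsub>R\<^esub> x"
        then obtain y where "y \<in> carrier R" "\<one>\<^bsub>R\<^esub> = y \<otimes>\<^bsub>R\<^esub> x" unfolding cgenideal_def by blast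
        then have "x \<in> Units R" using x(1) m_comm[of x y] unfolding Units_def by auto
        then show False using x by simp
      qed
      then show ?thesis using cgenideal_ideal[OF x(1)] cgenideal_self[OF x(1)] by blast
    qed
    then obtain K where K: "K \<in> ?F" "\<And>L. L \<in> ?F \<Longrightarrow> K \<subseteq> L \<Longrightarrow> L = K"
      using acc_module_maximal[OF acc_module_commutative_noetherian[OF cr], of ?F] sub by blast
    have "maximalideal K R"
    proof (rule maximalidealI)
      show "ideal K R" using K by blast
      show "carrier R \<noteq> K" using K by auto
      fix L assume L: "ideal L R" "K \<subseteq> L" "L \<subseteq> carrier R"
      show "L = K \<or> L = carrier R"
      proof (cases "\<one>\<^bsub>R\<^esub> \<in> L")
        case True
        then show ?thesis using ideal.one_imp_carrier[OF L(1)] by blast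
      next
        case False
        then have "L \<in> ?F" using L K(1) by blast
        then show ?thesis using K(2) L(2) by blast
      qed
    qed
    then have "K = \<mm>" using m by blast
    then show ?thesis using K(1) by blast
  qed
  have "s \<otimes>\<^bsub>R\<^esub> r \<in> \<mm>" using mem[OF r] s max.I_l_closed by blast
  moreover have "\<one>\<^bsub>R\<^esub> \<ominus>\<^bsub>R\<^esub> s \<otimes>\<^bsub>R\<^esub> r \<in> \<mm>" using mem[OF _ n] r s by simp
  ultimately have "(\<one>\<^bsub>R\<^esub> \<ominus>\<^bsub>R\<^esub> s \<otimes>\<^bsub>R\<^esub> r) \<oplus>\<^bsub>R\<^esub> s \<otimes>\<^bsub>R\<^esub> r \<in> \<mm>" by (intro max.a_closed)
  then have "\<one>\<^bsub>R\<^esub> \<in> \<mm>" using r s by (simp add: minus_eq a_assoc l_neg)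
  then show False using max.one_imp_carrier max.I_notcarr by blast
qed

text \<open>\<open>path_quotient\<close> carries a scalar multiplication and is a different record
  from \<open>PA Quot I\<close>; only the ring fields are compared.\<close>

lemma ring_record_cong:
  assumes "ring A" "carrier B = carrier A" "monoid.mult B = monoid.mult A" "\<one>\<^bsub>B\<^esub> = \<one>\<^bsub>A\<^esub>"
    "\<zero>\<^bsub>B\<^esub> = \<zero>\<^bsub>A\<^esub>" "ring.add B = ring.add A"
  shows "ring B"
proof -
  interpret ring A by (rule assms(1))
  show ?thesis
    by (intro ringI abelian_groupI monoidI)
      (auto simp: assms(2-) m_assoc l_distr r_distr a_assoc intro: a_comm l_neg
        bexI[of _ "\<ominus>\<^bsub>A\<^esub> _"])
qed

locale path_algebra_quotient =
  fixes R :: "('r, 'c) ring_scheme" (structure) and Q :: "('v, 'e) pre_digraph"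
    and I :: "(('v, 'e) quiver_path \<Rightarrow> 'r) set"
  assumes R: "cring R" and Q: "fin_digraph Q" and I: "ideal I (path_algebra R Q)"
begin

sublocale R: cring R by (rule R)
sublocale Q: fin_digraph Q by (rule Q)

abbreviation "PA \<equiv> path_algebra R Q"
abbreviation "\<Lambda> \<equiv> path_quotient R Q I"
abbreviation "pe \<equiv> path_elt R"
abbreviation "\<kappa> f \<equiv> I +>\<^bsub>PA\<^esub> f"

text \<open>The locale \<open>ideal\<close> contains \<open>ring\<close>, so this also supplies the
  ring laws of the path algebra.\<close>

sublocale I: ideal I PA by (rule I)

section \<open>The path algebra\<close>

lemma PA_simps:
  "f \<in> carrier PA \<longleftrightarrow> (\<forall>p \<in> paths Q. f p \<in> carrier R) \<and> (\<forall>p. p \<notin> paths Q \<longrightarrow> f p = \<zero>) \<and>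
     finite {p. f p \<noteq> \<zero>}"
  "\<one>\<^bsub>PA\<^esub> = (\<lambda>p. if p \<in> Triv ` verts Q then \<one> else \<zero>)" "\<zero>\<^bsub>PA\<^esub> = (\<lambda>p. \<zero>)"
  "f \<oplus>\<^bsub>PA\<^esub> g = (\<lambda>p. f p \<oplus> g p)" "c \<odot>\<^bsub>PA\<^esub> f = (\<lambda>p. c \<otimes> f p)"
  by (auto simp: path_algebra_def)

definition factorizations :: "('v, 'e) quiver_path \<Rightarrow> (('v, 'e) quiver_path \<times> ('v, 'e) quiver_path) set" where
  "factorizations r = {(p, q). p \<in> paths Q \<and> q \<in> paths Q \<and> path_tail Q p = path_head Q q \<and> path_comp p q = r}"

lemma PA_mult: "(f \<otimes>\<^bsub>PA\<^esub> g) r = finsum R (\<lambda>(p, q). f p \<otimes> g q) (factorizations r)"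
  by (simp add: path_algebra_def factorizations_def)

text \<open>A factorization either has a trivial factor or cuts the list of arrows in two. The
  bounding set contains pairs that are not factorizations, but it is finite.\<close>

lemma finite_factorizations: "finite (factorizations r)"
proof -
  let ?F = "(\<lambda>v. (Triv v, r)) ` verts Q \<union> (\<lambda>v. (r, Triv v)) ` verts Q \<union>
    (\<lambda>n. (Arrows (take n (arrows r)), Arrows (drop n (arrows r)))) ` {..length (arrows r)}"
  have "factorizations r \<subseteq> ?F"
  proof
    fix x assume "x \<in> factorizations r"
    then obtain p q where x: "x = (p, q)" "p \<in> paths Q" "q \<in> paths Q" "path_comp p q = r"
      unfolding factorizations_def by blast
    show "x \<in> ?F"
    proof (cases p)
      case (Triv v)
      then have "v \<in> verts Q" using x(2) unfolding paths_def by auto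
      then show ?thesis using Triv x by auto
    next
      case p: (Arrows as)
      show ?thesis
      proof (cases q)
        case (Triv v)
        then have "v \<in> verts Q" using x(3) unfolding paths_def by auto
        then show ?thesis using p Triv x by auto
      next
        case (Arrows bs)
        then have "arrows r = as @ bs" using p x by auto
        then have "x = (Arrows (take (length as) (arrows r)), Arrows (drop (length as) (arrows r)))"
          "length as \<in> {..length (arrows r)}" using p Arrows x(1) by auto
        then show ?thesis by blast
      qed
    qed
  qed
  then show ?thesis by (rule finite_subset) simp
qed

lemma PA_closed_at: "f \<in> carrier PA \<Longrightarrow> f p \<in> carrier R"
  by (cases "p \<in> paths Q") (auto simp: PA_simps)

lemma PA_smult_closed: "r \<in> carrier R \<Longrightarrow> f \<in> carrier PA \<Longrightarrow> r \<odot>\<^bsub>PA\<^esub> f \<in> carrier PA"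
proof -
  assume rf: "r \<in> carrier R" "f \<in> carrier PA"
  have "{p. r \<otimes> f p \<noteq> \<zero>} \<subseteq> {p. f p \<noteq> \<zero>}" using rf by auto
  then have "finite {p. r \<otimes> f p \<noteq> \<zero>}" using rf(2) finite_subset unfolding PA_simps by blast
  then show ?thesis using rf unfolding PA_simps by auto
qed

lemma PA_smult_mult:
  assumes "r \<in> carrier R" "f \<in> carrier PA" "g \<in> carrier PA"
  shows "(r \<odot>\<^bsub>PA\<^esub> f) \<otimes>\<^bsub>PA\<^esub> g = r \<odot>\<^bsub>PA\<^esub> (f \<otimes>\<^bsub>PA\<^esub> g)" "f \<otimes>\<^bsub>PA\<^esub> (r \<odot>\<^bsub>PA\<^esub> g) = r \<odot>\<^bsub>PA\<^esub> (f \<otimes>\<^bsub>PA\<^esub> g)"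
proof -
  have c: "f p \<in> carrier R" "g p \<in> carrier R" for p using PA_closed_at assms by auto
  have *: "r \<otimes> finsum R (\<lambda>(p, q). f p \<otimes> g q) (factorizations s) =
      finsum R (\<lambda>(p, q). r \<otimes> (f p \<otimes> g q)) (factorizations s)" for s
  proof -
    have "r \<otimes> finsum R (\<lambda>(p, q). f p \<otimes> g q) (factorizations s) =
      finsum R (\<lambda>x. r \<otimes> (case x of (p, q) \<Rightarrow> f p \<otimes> g q)) (factorizations s)"
      by (rule R.finsum_rdistr[OF finite_factorizations assms(1)]) (use c in auto)
    also have "\<dots> = finsum R (\<lambda>(p, q). r \<otimes> (f p \<otimes> g q)) (factorizations s)"
      by (rule R.finsum_cong') (use c assms in auto)
    finally show ?thesis .
  qed
  show "(r \<odot>\<^bsub>PA\<^esub> f) \<otimes>\<^bsub>PA\<^esub> g = r \<odot>\<^bsub>PA\<^esub> (f \<otimes>\<^bsub>PA\<^esub> g)"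
  proof
    fix s
    have "((r \<odot>\<^bsub>PA\<^esub> f) \<otimes>\<^bsub>PA\<^esub> g) s = finsum R (\<lambda>(p, q). r \<otimes> (f p \<otimes> g q)) (factorizations s)"
      unfolding PA_mult PA_simps by (rule R.finsum_cong') (use c assms in \<open>auto simp: R.m_assoc\<close>)
    then show "((r \<odot>\<^bsub>PA\<^esub> f) \<otimes>\<^bsub>PA\<^esub> g) s = (r \<odot>\<^bsub>PA\<^esub> (f \<otimes>\<^bsub>PA\<^esub> g)) s"
      using *[of s] unfolding PA_simps PA_mult by simp
  qed
  show "f \<otimes>\<^bsub>PA\<^esub> (r \<odot>\<^bsub>PA\<^esub> g) = r \<odot>\<^bsub>PA\<^esub> (f \<otimes>\<^bsub>PA\<^esub> g)"
  proof
    fix s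
    have "(f \<otimes>\<^bsub>PA\<^esub> (r \<odot>\<^bsub>PA\<^esub> g)) s = finsum R (\<lambda>(p, q). r \<otimes> (f p \<otimes> g q)) (factorizations s)"
      unfolding PA_mult PA_simps by (rule R.finsum_cong') (use c assms in \<open>auto simp: R.m_lcomm\<close>)
    then show "(f \<otimes>\<^bsub>PA\<^esub> (r \<odot>\<^bsub>PA\<^esub> g)) s = (r \<odot>\<^bsub>PA\<^esub> (f \<otimes>\<^bsub>PA\<^esub> g)) s"
      using *[of s] unfolding PA_simps PA_mult by simp
  qed
qed

lemma pe_closed: "p \<in> paths Q \<Longrightarrow> pe p \<in> carrier PA"
  unfolding PA_simps path_elt_def by (auto intro: finite_subset[of _ "{p}"])

text \<open>Among the factorizations of a path only the pair \<open>(p, q)\<close> itself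
  contributes to the sum.\<close>

lemma pe_mult:
  assumes p: "p \<in> paths Q" and q: "q \<in> paths Q"
  shows "pe p \<otimes>\<^bsub>PA\<^esub> pe q = (if path_tail Q p = path_head Q q then pe (path_comp p q) else \<zero>\<^bsub>PA\<^esub>)"
proof
  fix r
  have c: "pe p s \<in> carrier R" for p s by (simp add: path_elt_def)
  have *: "(pe p \<otimes>\<^bsub>PA\<^esub> pe q) r = finsum R (\<lambda>x. if (p, q) = x then \<one> else \<zero>) (factorizations r)"
    unfolding PA_mult by (rule R.finsum_cong') (auto simp: path_elt_def split: if_split_asm)
  show "(pe p \<otimes>\<^bsub>PA\<^esub> pe q) r = (if path_tail Q p = path_head Q q then pe (path_comp p q) else \<zero>\<^bsub>PA\<^esub>) r"
  proof (cases "(p, q) \<in> factorizations r")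
    case True
    have "finsum R (\<lambda>x. if (p, q) = x then \<one> else \<zero>) (factorizations r) = \<one>"
      by (rule R.finsum_singleton[OF True finite_factorizations, of "\<lambda>_. \<one>"]) simp
    then show ?thesis using * True unfolding factorizations_def by (auto simp: path_elt_def)
  next
    case False
    have "finsum R (\<lambda>x. if (p, q) = x then \<one> else \<zero>) (factorizations r) = finsum R (\<lambda>_. \<zero>) (factorizations r)"
      by (rule R.finsum_cong') (use False in auto)
    then show ?thesis using * False p q unfolding factorizations_def by (auto simp: path_elt_def PA_simps)
  qed
qed

lemma pe_sum: "finsum PA (\<lambda>v. pe (Triv v)) (verts Q) = \<one>\<^bsub>PA\<^esub>"
proof -
  have "finsum PA (\<lambda>v. pe (Triv v)) S = (\<lambda>p. if p \<in> Triv ` S then \<one> else \<zero>)"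
    if "finite S" "S \<subseteq> verts Q" for S
    using that
  proof (induction S rule: finite_induct)
    case empty
    then show ?case by (simp add: PA_simps)
  next
    case (insert v S)
    have "Triv w \<in> paths Q" if "w \<in> verts Q" for w using that by (simp add: paths_def)
    then have "(\<lambda>v. pe (Triv v)) \<in> S \<rightarrow> carrier PA" "pe (Triv v) \<in> carrier PA"
      using insert.prems pe_closed by auto
    then have "finsum PA (\<lambda>v. pe (Triv v)) (insert v S) = pe (Triv v) \<oplus>\<^bsub>PA\<^esub> finsum PA (\<lambda>v. pe (Triv v)) S"
      using insert.hyps by (intro I.finsum_insert)
    then show ?case using insert by (auto simp: PA_simps path_elt_def fun_eq_iff)
  qed
  then show ?thesis using Q.finite_verts by (simp add: PA_simps)
qed

lemma PA_induct:
  assumes "\<zero>\<^bsub>PA\<^esub> \<in> N" "\<And>f g. f \<in> N \<Longrightarrow> g \<in> N \<Longrightarrow> f \<oplus>\<^bsub>PA\<^esub> g \<in> N"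
    and "\<And>r p. r \<in> carrier R \<Longrightarrow> p \<in> paths Q \<Longrightarrow> r \<odot>\<^bsub>PA\<^esub> pe p \<in> N"
  shows "carrier PA \<subseteq> N"
proof
  fix f assume f: "f \<in> carrier PA"
  have "f \<in> N" if "finite S" "{p. f p \<noteq> \<zero>} \<subseteq> S" "f \<in> carrier PA" for S f
    using that
  proof (induction S arbitrary: f rule: finite_induct)
    case empty
    then have "f = \<zero>\<^bsub>PA\<^esub>" by (auto simp: PA_simps)
    then show ?case using assms(1) by simp
  next
    case (insert p S)
    show ?case
    proof (cases "p \<in> paths Q")
      case False
      then have "f p = \<zero>" using insert.prems(2) unfolding PA_simps by blast
      then have "{p. f p \<noteq> \<zero>} \<subseteq> S" using insert.prems(1) by auto
      then show ?thesis using insert.IH insert.prems(2) by blast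
    next
      case True
      define g where "g = f(p := \<zero>)"
      have s: "{q. g q \<noteq> \<zero>} \<subseteq> S" unfolding g_def using insert.prems(1) by auto
      have "g \<in> carrier PA"
        using insert.prems(2) finite_subset[OF s insert.hyps(1)] unfolding PA_simps
        by (auto simp: g_def)
      then have "g \<in> N" using insert.IH s by blast
      moreover have "f = g \<oplus>\<^bsub>PA\<^esub> (f p \<odot>\<^bsub>PA\<^esub> pe p)"
        using PA_closed_at[OF insert.prems(2)] by (auto simp: PA_simps g_def path_elt_def)
      ultimately show ?thesis
        using assms(2,3) True PA_closed_at[OF insert.prems(2)] by metis
    qed
  qed
  then show "f \<in> N" using f unfolding PA_simps by blast
qed

section \<open>The quotient algebra and its central scalars\<close>

lemma \<Lambda>_simps:
  "carrier \<Lambda> = carrier (PA Quot I)" "monoid.mult \<Lambda> = monoid.mult (PA Quot I)"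
  "\<one>\<^bsub>\<Lambda>\<^esub> = \<one>\<^bsub>PA Quot I\<^esub>" "\<zero>\<^bsub>\<Lambda>\<^esub> = \<zero>\<^bsub>PA Quot I\<^esub>" "ring.add \<Lambda> = ring.add (PA Quot I)"
  by (simp_all add: path_quotient_def quotient_algebra_def)

lemma ring_\<Lambda>: "ring \<Lambda>"
  by (rule ring_record_cong[OF I.quotient_is_ring]) (simp_all add: \<Lambda>_simps)

sublocale \<Lambda>: ring \<Lambda> by (rule ring_\<Lambda>)

lemma carrier_\<Lambda>: "carrier \<Lambda> = \<kappa> ` carrier PA"
  unfolding \<Lambda>_simps by (auto simp: FactRing_def A_RCOSETS_def')

lemma \<kappa>_closed: "f \<in> carrier PA \<Longrightarrow> \<kappa> f \<in> carrier \<Lambda>"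
  by (simp add: carrier_\<Lambda>)

lemma \<kappa>_hom: "\<kappa> \<in> ring_hom PA \<Lambda>"
  using I.rcos_ring_hom unfolding ring_hom_def by (simp add: \<Lambda>_simps)

lemma \<kappa>_add: "f \<in> carrier PA \<Longrightarrow> g \<in> carrier PA \<Longrightarrow> \<kappa> (f \<oplus>\<^bsub>PA\<^esub> g) = \<kappa> f \<oplus>\<^bsub>\<Lambda>\<^esub> \<kappa> g"
  using ring_hom_add[OF \<kappa>_hom] by simp

lemma \<kappa>_mult: "f \<in> carrier PA \<Longrightarrow> g \<in> carrier PA \<Longrightarrow> \<kappa> (f \<otimes>\<^bsub>PA\<^esub> g) = \<kappa> f \<otimes>\<^bsub>\<Lambda>\<^esub> \<kappa> g"
  using ring_hom_mult[OF \<kappa>_hom] by simp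

lemma \<kappa>_one: "\<kappa> \<one>\<^bsub>PA\<^esub> = \<one>\<^bsub>\<Lambda>\<^esub>"
  using ring_hom_one[OF \<kappa>_hom] by simp

lemma \<kappa>_zero: "\<kappa> \<zero>\<^bsub>PA\<^esub> = \<zero>\<^bsub>\<Lambda>\<^esub>"
  by (rule ring_hom_zero[OF \<kappa>_hom I.ring_axioms ring_\<Lambda>])

lemma \<kappa>_eq_zero_iff: "f \<in> carrier PA \<Longrightarrow> \<kappa> f = \<zero>\<^bsub>\<Lambda>\<^esub> \<longleftrightarrow> f \<in> I"
  using I.quotient_eq_iff_same_a_r_cos[OF I, of f "\<zero>\<^bsub>PA\<^esub>"] by (simp add: \<kappa>_zero[symmetric] I.minus_eq)

lemma \<kappa>_finsum:
  assumes "\<And>i. i \<in> S \<Longrightarrow> f i \<in> carrier PA"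
  shows "\<kappa> (finsum PA f S) = finsum \<Lambda> (\<lambda>i. \<kappa> (f i)) S"
  using assms
proof (induction S rule: infinite_finite_induct)
  case (insert i S)
  then have "f \<in> S \<rightarrow> carrier PA" "f i \<in> carrier PA" by auto
  moreover from this have "(\<lambda>i. \<kappa> (f i)) \<in> S \<rightarrow> carrier \<Lambda>" "\<kappa> (f i) \<in> carrier \<Lambda>" using \<kappa>_closed by auto
  ultimately show ?case using insert \<kappa>_add I.finsum_insert \<Lambda>.finsum_insert by simp
qed (simp_all add: \<kappa>_zero)

definition scalar :: "'r \<Rightarrow> (('v, 'e) quiver_path \<Rightarrow> 'r) set" where
  "scalar r = \<kappa> (r \<odot>\<^bsub>PA\<^esub> \<one>\<^bsub>PA\<^esub>)"

abbreviation "Z \<equiv> scalar ` carrier R"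

lemma scalar_mult: "r \<in> carrier R \<Longrightarrow> f \<in> carrier PA \<Longrightarrow> scalar r \<otimes>\<^bsub>\<Lambda>\<^esub> \<kappa> f = \<kappa> (r \<odot>\<^bsub>PA\<^esub> f)"
  "r \<in> carrier R \<Longrightarrow> f \<in> carrier PA \<Longrightarrow> \<kappa> f \<otimes>\<^bsub>\<Lambda>\<^esub> scalar r = \<kappa> (r \<odot>\<^bsub>PA\<^esub> f)"
  using PA_smult_closed[OF _ I.one_closed, of r] PA_smult_mult[of r "\<one>\<^bsub>PA\<^esub>" f] PA_smult_mult[of r f "\<one>\<^bsub>PA\<^esub>"]
    \<kappa>_mult[of "r \<odot>\<^bsub>PA\<^esub> \<one>\<^bsub>PA\<^esub>" f] \<kappa>_mult[of f "r \<odot>\<^bsub>PA\<^esub> \<one>\<^bsub>PA\<^esub>"]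
  unfolding scalar_def by simp_all

lemma scalar_closed: "r \<in> carrier R \<Longrightarrow> scalar r \<in> carrier \<Lambda>"
  unfolding scalar_def using PA_smult_closed[OF _ I.one_closed] \<kappa>_closed by blast

lemma scalar_hom: "scalar \<in> ring_hom R \<Lambda>"
proof (rule ring_hom_memI)
  show "scalar r \<in> carrier \<Lambda>" if "r \<in> carrier R" for r using scalar_closed[OF that] .
  show "scalar (r \<otimes> s) = scalar r \<otimes>\<^bsub>\<Lambda>\<^esub> scalar s" if rs: "r \<in> carrier R" "s \<in> carrier R" for r s
  proof -
    have "scalar r \<otimes>\<^bsub>\<Lambda>\<^esub> scalar s = \<kappa> (r \<odot>\<^bsub>PA\<^esub> (s \<odot>\<^bsub>PA\<^esub> \<one>\<^bsub>PA\<^esub>))"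
      using scalar_mult(1)[OF rs(1) PA_smult_closed[OF rs(2) I.one_closed]] unfolding scalar_def .
    also have "r \<odot>\<^bsub>PA\<^esub> (s \<odot>\<^bsub>PA\<^esub> \<one>\<^bsub>PA\<^esub>) = (r \<otimes> s) \<odot>\<^bsub>PA\<^esub> \<one>\<^bsub>PA\<^esub>"
      using rs by (auto simp: PA_simps R.m_assoc)
    finally show ?thesis unfolding scalar_def by simp
  qed
  show "scalar (r \<oplus> s) = scalar r \<oplus>\<^bsub>\<Lambda>\<^esub> scalar s" if rs: "r \<in> carrier R" "s \<in> carrier R" for r s
  proof -
    have "(r \<oplus> s) \<odot>\<^bsub>PA\<^esub> \<one>\<^bsub>PA\<^esub> = (r \<odot>\<^bsub>PA\<^esub> \<one>\<^bsub>PA\<^esub>) \<oplus>\<^bsub>PA\<^esub> (s \<odot>\<^bsub>PA\<^esub> \<one>\<^bsub>PA\<^esub>)"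
      using rs by (auto simp: PA_simps R.l_distr)
    then show ?thesis
      unfolding scalar_def using \<kappa>_add PA_smult_closed[OF _ I.one_closed] rs by simp
  qed
  have "\<one> \<odot>\<^bsub>PA\<^esub> \<one>\<^bsub>PA\<^esub> = \<one>\<^bsub>PA\<^esub>" by (auto simp: PA_simps)
  then show "scalar \<one> = \<one>\<^bsub>\<Lambda>\<^esub>" unfolding scalar_def using \<kappa>_one by simp
qed

text \<open>Scalar multiplication on the quotient is a union over representatives; all of them give
  the same coset, because the scalar acts as multiplication by a ring element.\<close>

lemma \<Lambda>_smult: "r \<in> carrier R \<Longrightarrow> f \<in> carrier PA \<Longrightarrow> r \<odot>\<^bsub>\<Lambda>\<^esub> \<kappa> f = scalar r \<otimes>\<^bsub>\<Lambda>\<^esub> \<kappa> f"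
proof -
  assume r: "r \<in> carrier R" and f: "f \<in> carrier PA"
  have "\<kappa> (r \<odot>\<^bsub>PA\<^esub> x) = \<kappa> (r \<odot>\<^bsub>PA\<^esub> f)" if x: "x \<in> \<kappa> f" for x
  proof -
    have "x \<in> carrier PA" using x I.a_r_coset_subset_G[OF I.a_subset f] by blast
    moreover have "\<kappa> x = \<kappa> f"
      using I.a_repr_independence'[OF x f] by simp
    ultimately show ?thesis using scalar_mult(1)[OF r] f by metis
  qed
  moreover have "f \<in> \<kappa> f" by (rule I.a_rcos_self[OF f])
  ultimately have "(\<Union>x\<in>\<kappa> f. \<kappa> (r \<odot>\<^bsub>PA\<^esub> x)) = \<kappa> (r \<odot>\<^bsub>PA\<^esub> f)" by blast
  then show ?thesis
    using scalar_mult(1)[OF r f] by (simp add: path_quotient_def quotient_algebra_def)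
qed

abbreviation "ee v \<equiv> \<kappa> (pe (Triv v))"
abbreviation "arr a \<equiv> \<kappa> (pe (Arrows [a]))"

lemma Triv_path: "v \<in> verts Q \<Longrightarrow> Triv v \<in> paths Q"
  by (simp add: paths_def)

lemma Arrow_path: "a \<in> arcs Q \<Longrightarrow> Arrows [a] \<in> paths Q"
  by (auto simp: paths_def)

lemma Arrows_path_iff: "Arrows as \<in> paths Q \<longleftrightarrow>
  as \<noteq> [] \<and> set as \<subseteq> arcs Q \<and> successively (\<lambda>b a. tail Q b = head Q a) as"
  by (auto simp: paths_def)

lemma \<kappa>_pe_mult: "p \<in> paths Q \<Longrightarrow> q \<in> paths Q \<Longrightarrow>
    \<kappa> (pe p) \<otimes>\<^bsub>\<Lambda>\<^esub> \<kappa> (pe q) = (if path_tail Q p = path_head Q q then \<kappa> (pe (path_comp p q)) else \<zero>\<^bsub>\<Lambda>\<^esub>)"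
proof -
  assume "p \<in> paths Q" "q \<in> paths Q"
  then show ?thesis
    using \<kappa>_mult[OF pe_closed pe_closed, of p q] pe_mult[of p q] \<kappa>_zero
    by (cases "path_tail Q p = path_head Q q") simp_all
qed

lemma arrow_word_\<Lambda>:
  assumes "as \<noteq> []" "set as \<subseteq> arcs Q"
  shows "arrow_word \<Lambda> arr as = (if Arrows as \<in> paths Q then \<kappa> (pe (Arrows as)) else \<zero>\<^bsub>\<Lambda>\<^esub>)"
  using assms
proof (induction as)
  case (Cons a as)
  have a: "Arrows [a] \<in> paths Q" "arr a \<in> carrier \<Lambda>"
    using Cons.prems Arrow_path pe_closed \<kappa>_closed by auto
  show ?case
  proof (cases "as = []")
    case True
    then show ?thesis using a by (simp add: arrow_word_def)
  next
    case False
    have "arrow_word \<Lambda> arr (a # as) = arr a \<otimes>\<^bsub>\<Lambda>\<^esub> arrow_word \<Lambda> arr as" by (simp add: arrow_word_def)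
    also have "\<dots> = (if Arrows (a # as) \<in> paths Q then \<kappa> (pe (Arrows (a # as))) else \<zero>\<^bsub>\<Lambda>\<^esub>)"
    proof (cases "Arrows as \<in> paths Q")
      case True
      have "Arrows (a # as) \<in> paths Q \<longleftrightarrow> tail Q a = head Q (List.hd as)"
        using True False Cons.prems unfolding Arrows_path_iff by (cases as) auto
      then show ?thesis using Cons False True \<kappa>_pe_mult[OF a(1) True] by simp
    next
      case no: False
      then have "Arrows (a # as) \<notin> paths Q"
        using False Cons.prems unfolding Arrows_path_iff by (cases as) auto
      then show ?thesis using Cons False no a by simp
    qed
    finally show ?thesis .
  qed
qed simp

lemma scalar_submodule_iff:
  assumes "left_module R \<Lambda>"
  shows "scalar_submodule \<Lambda> Z N \<longleftrightarrow> submodule N R \<Lambda>"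
proof -
  have "r \<odot>\<^bsub>\<Lambda>\<^esub> x = scalar r \<otimes>\<^bsub>\<Lambda>\<^esub> x" if "r \<in> carrier R" "x \<in> carrier \<Lambda>" for r x
    using \<Lambda>_smult that unfolding carrier_\<Lambda> by blast
  then show ?thesis
    unfolding left_module.submodule_iff[OF assms] scalar_submodule_def by (auto simp: subset_iff)
qed

text \<open>Finite generation over the noetherian ground ring enters through \<open>Z_acc\<close>.
  The spanning property holds because a path is a vertex or a nonempty word of arrows.\<close>

lemma quiver_algebra_\<Lambda>:
  assumes noeth: "noetherian_ring R" and fg: "finitely_generated_module R \<Lambda>"
  shows "quiver_algebra \<Lambda> (verts Q) (arcs Q) (head Q) (tail Q) ee arr Z"
proof (intro quiver_algebra.intro quiver_algebra_axioms.intro ring_\<Lambda>)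
  have M: "left_module R \<Lambda>" using fg unfolding finitely_generated_module_def by blast
  show "finite (verts Q)" "finite (arcs Q)" using Q.finite_verts Q.finite_arcs by auto
  show "head Q a \<in> verts Q" "tail Q a \<in> verts Q" if "a \<in> arcs Q" for a using that by auto
  show "ee v \<in> carrier \<Lambda>" if "v \<in> verts Q" for v using \<kappa>_closed pe_closed Triv_path that by blast
  show "ee v \<otimes>\<^bsub>\<Lambda>\<^esub> ee w = (if v = w then ee v else \<zero>\<^bsub>\<Lambda>\<^esub>)" if "v \<in> verts Q" "w \<in> verts Q" for v w
    using \<kappa>_pe_mult[OF Triv_path Triv_path] that by auto
  show "finsum \<Lambda> ee (verts Q) = \<one>\<^bsub>\<Lambda>\<^esub>"
    using \<kappa>_finsum[of "verts Q" "\<lambda>v. pe (Triv v)"] pe_closed Triv_path pe_sum \<kappa>_one by simp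
  show "arr a \<in> carrier \<Lambda>" if "a \<in> arcs Q" for a using \<kappa>_closed pe_closed Arrow_path that by blast
  show "ee (head Q a) \<otimes>\<^bsub>\<Lambda>\<^esub> arr a = arr a" "arr a \<otimes>\<^bsub>\<Lambda>\<^esub> ee (tail Q a) = arr a" if "a \<in> arcs Q" for a
    using \<kappa>_pe_mult[OF Triv_path Arrow_path] \<kappa>_pe_mult[OF Arrow_path Triv_path] that by auto
  show "Z \<subseteq> carrier \<Lambda>" using scalar_closed by blast
  show "\<one>\<^bsub>\<Lambda>\<^esub> \<in> Z" using ring_hom_one[OF scalar_hom] R.one_closed by (metis imageI)
  have "\<ominus>\<^bsub>\<Lambda>\<^esub> \<one>\<^bsub>\<Lambda>\<^esub> = scalar (\<ominus> \<one>)"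
  proof -
    have "scalar (\<ominus> \<one>) \<oplus>\<^bsub>\<Lambda>\<^esub> \<one>\<^bsub>\<Lambda>\<^esub> = scalar (\<ominus> \<one> \<oplus> \<one>)"
      using ring_hom_add[OF scalar_hom, of "\<ominus> \<one>" \<one>] ring_hom_one[OF scalar_hom] by simp
    also have "\<dots> = \<zero>\<^bsub>\<Lambda>\<^esub>" using ring_hom_zero[OF scalar_hom R.ring_axioms ring_\<Lambda>] by (simp add: R.l_neg)
    finally show ?thesis using \<Lambda>.minus_equality scalar_closed by simp
  qed
  then show "\<ominus>\<^bsub>\<Lambda>\<^esub> \<one>\<^bsub>\<Lambda>\<^esub> \<in> Z" by simp
  show "x \<oplus>\<^bsub>\<Lambda>\<^esub> y \<in> Z" "x \<otimes>\<^bsub>\<Lambda>\<^esub> y \<in> Z" if "x \<in> Z" "y \<in> Z" for x y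
    using that ring_hom_add[OF scalar_hom, symmetric] ring_hom_mult[OF scalar_hom, symmetric] by auto
  show "x \<otimes>\<^bsub>\<Lambda>\<^esub> y = y \<otimes>\<^bsub>\<Lambda>\<^esub> x" if "x \<in> Z" "y \<in> carrier \<Lambda>" for x y
    using that scalar_mult unfolding carrier_\<Lambda> by auto
  show "\<exists>n :: nat. \<forall>i \<ge> n. C i = C n"
    if "\<And>i. scalar_submodule \<Lambda> Z (C i)" "\<And>i. C i \<subseteq> C (Suc i)" for C
    using that unfolding scalar_submodule_iff[OF M]
    by (intro acc_moduleD[OF left_module.acc_module_of_finitely_generated[OF M
            acc_module_commutative_noetherian[OF R noeth] fg]])
  fix N assume N: "scalar_submodule \<Lambda> Z N" "\<And>v. v \<in> verts Q \<Longrightarrow> ee v \<in> N"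
    "\<And>as. as \<noteq> [] \<Longrightarrow> set as \<subseteq> arcs Q \<Longrightarrow> arrow_word \<Lambda> arr as \<in> N"
  have "carrier PA \<subseteq> {f \<in> carrier PA. \<kappa> f \<in> N}"
  proof (rule PA_induct)
    show "\<zero>\<^bsub>PA\<^esub> \<in> {f \<in> carrier PA. \<kappa> f \<in> N}"
      using N(1) \<kappa>_zero unfolding scalar_submodule_def by simp
    show "f \<oplus>\<^bsub>PA\<^esub> g \<in> {f \<in> carrier PA. \<kappa> f \<in> N}"
      if "f \<in> {f \<in> carrier PA. \<kappa> f \<in> N}" "g \<in> {f \<in> carrier PA. \<kappa> f \<in> N}" for f g
      using that N(1) \<kappa>_add unfolding scalar_submodule_def by simp
    fix r p assume r: "r \<in> carrier R" and p: "p \<in> paths Q"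
    have "\<kappa> (pe p) \<in> N"
    proof (cases p)
      case (Triv v)
      then show ?thesis using N(2) p unfolding paths_def by auto
    next
      case (Arrows as)
      then have "as \<noteq> []" "set as \<subseteq> arcs Q" using p unfolding Arrows Arrows_path_iff by auto
      then show ?thesis using N(3)[of as] arrow_word_\<Lambda>[of as] p Arrows by simp
    qed
    then have "scalar r \<otimes>\<^bsub>\<Lambda>\<^esub> \<kappa> (pe p) \<in> N" using N(1) r unfolding scalar_submodule_def by blast
    then show "r \<odot>\<^bsub>PA\<^esub> pe p \<in> {f \<in> carrier PA. \<kappa> f \<in> N}"
      using scalar_mult(1)[OF r pe_closed[OF p]] PA_smult_closed[OF r pe_closed[OF p]] by simp
  qed
  then show "carrier \<Lambda> \<subseteq> N" unfolding carrier_\<Lambda> by blast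
qed

end

section \<open>String algebras over a local ring\<close>

lemma direct_sum_of_at_most_mono:
  "direct_sum_of_at_most A n \<C> M \<Longrightarrow> \<C> \<subseteq> \<D> \<Longrightarrow> direct_sum_of_at_most A n \<D> M"
  unfolding direct_sum_of_at_most_def by blast

context path_algebra_quotient
begin

lemma left_path_ideal_eq: "left_path_ideal R Q I p = carrier \<Lambda> #>\<^bsub>\<Lambda>\<^esub> \<kappa> (pe p)"
  by (simp add: left_path_ideal_def path_coset_def)

lemma right_path_ideal_eq: "right_path_ideal R Q I p = \<kappa> (pe p) <#\<^bsub>\<Lambda>\<^esub> carrier \<Lambda>"
  by (simp add: right_path_ideal_def path_coset_def)

lemma scalar_one_minus:
  assumes "r \<in> carrier R"
  shows "scalar (\<one> \<ominus> r) = \<one>\<^bsub>\<Lambda>\<^esub> \<ominus>\<^bsub>\<Lambda>\<^esub> scalar r"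
proof -
  have "scalar (\<one> \<ominus> r) \<oplus>\<^bsub>\<Lambda>\<^esub> scalar r = scalar ((\<one> \<ominus> r) \<oplus> r)"
    using ring_hom_add[OF scalar_hom] assms by simp
  also have "\<dots> = \<one>\<^bsub>\<Lambda>\<^esub>"
    using assms ring_hom_one[OF scalar_hom] by (simp add: R.minus_eq R.a_assoc R.l_neg)
  finally have "\<one>\<^bsub>\<Lambda>\<^esub> \<ominus>\<^bsub>\<Lambda>\<^esub> scalar r = (scalar (\<one> \<ominus> r) \<oplus>\<^bsub>\<Lambda>\<^esub> scalar r) \<ominus>\<^bsub>\<Lambda>\<^esub> scalar r" by simp
  also have "\<dots> = scalar (\<one> \<ominus> r)"
    using assms scalar_closed by (simp add: \<Lambda>.minus_eq \<Lambda>.a_assoc \<Lambda>.r_neg)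
  finally show ?thesis by simp
qed

text \<open>For directness a single other arrow at the vertex is enough, since its ideal lies in the
  sum over all of them.\<close>

lemma string_quiver_algebra_\<Lambda>:
  assumes R: "noetherian_local_ring R \<mm>" and S: "string_algebra R Q I"
  shows "string_quiver_algebra \<Lambda> (verts Q) (arcs Q) (head Q) (tail Q) ee arr Z"
proof -
  have noeth: "noetherian_ring R" and fg: "finitely_generated_module R \<Lambda>"
    and deg: "\<And>v. v \<in> verts Q \<Longrightarrow> in_degree Q v \<le> 2 \<and> out_degree Q v \<le> 2"
    and rad: "arrow_radical R Q I" and dir: "arrow_direct R Q I"
    and per: "permissible R Q I" and spe: "special R Q I"
    using R S unfolding noetherian_local_ring_def string_algebra_def by auto
  interpret qa: quiver_algebra \<Lambda> "verts Q" "arcs Q" "head Q" "tail Q" ee arr Z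
    by (rule quiver_algebra_\<Lambda>[OF noeth fg])
  interpret op: quiver_algebra "opposite_ring \<Lambda>" "verts Q" "arcs Q" "tail Q" "head Q" ee arr Z
    by (rule qa.quiver_algebra_opposite)
  have loc: "local_quiver_algebra \<Lambda> (verts Q) (arcs Q) (head Q) (tail Q) ee arr Z"
  proof (rule qa.local_quiver_algebraI)
    fix v assume v: "v \<in> verts Q"
    show "local_module \<Lambda> (ideal_module \<Lambda> (carrier \<Lambda> #>\<^bsub>\<Lambda>\<^esub> ee v))"
      using rad v unfolding arrow_radical_def Let_def left_path_ideal_eq by blast
    show "module_radical \<Lambda> (ideal_module \<Lambda> (carrier \<Lambda> #>\<^bsub>\<Lambda>\<^esub> ee v)) =
      submodule_sum \<Lambda> (regular_module \<Lambda>) {carrier \<Lambda> #>\<^bsub>\<Lambda>\<^esub> arr a |a. a \<in> arcs Q \<and> tail Q a = v}"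
      using rad v unfolding arrow_radical_def Let_def left_path_ideal_eq by blast
  next
    fix x assume "x \<in> Z"
    then obtain r where r: "r \<in> carrier R" "x = scalar r" by blast
    have inverse: "\<exists>z' \<in> Z. z' \<otimes>\<^bsub>\<Lambda>\<^esub> scalar s = \<one>\<^bsub>\<Lambda>\<^esub>" if s: "s \<in> Units R" for s
    proof -
      have "scalar (inv s) \<otimes>\<^bsub>\<Lambda>\<^esub> scalar s = scalar (inv s \<otimes> s)"
        using ring_hom_mult[OF scalar_hom] R.Units_inv_closed[OF s] R.Units_closed[OF s] by simp
      then show ?thesis using R.Units_l_inv[OF s] ring_hom_one[OF scalar_hom] R.Units_inv_closed[OF s] by auto
    qed
    show "(\<exists>z' \<in> Z. x \<otimes>\<^bsub>\<Lambda>\<^esub> z' = \<one>\<^bsub>\<Lambda>\<^esub>) \<or>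
        (\<forall>y \<in> Z. \<exists>z' \<in> Z. z' \<otimes>\<^bsub>\<Lambda>\<^esub> (\<one>\<^bsub>\<Lambda>\<^esub> \<ominus>\<^bsub>\<Lambda>\<^esub> y \<otimes>\<^bsub>\<Lambda>\<^esub> x) = \<one>\<^bsub>\<Lambda>\<^esub>)"
    proof (cases "r \<in> Units R")
      case True
      then obtain z' where "z' \<in> Z" "z' \<otimes>\<^bsub>\<Lambda>\<^esub> x = \<one>\<^bsub>\<Lambda>\<^esub>" using inverse r by blast
      then show ?thesis using qa.Z_central[of x z'] r scalar_closed by auto
    next
      case False
      have "\<exists>z' \<in> Z. z' \<otimes>\<^bsub>\<Lambda>\<^esub> (\<one>\<^bsub>\<Lambda>\<^esub> \<ominus>\<^bsub>\<Lambda>\<^esub> y \<otimes>\<^bsub>\<Lambda>\<^esub> x) = \<one>\<^bsub>\<Lambda>\<^esub>" if y: "y \<in> Z" for y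
      proof -
        obtain s where s: "s \<in> carrier R" "y = scalar s" using y by blast
        have "\<one>\<^bsub>\<Lambda>\<^esub> \<ominus>\<^bsub>\<Lambda>\<^esub> y \<otimes>\<^bsub>\<Lambda>\<^esub> x = scalar (\<one> \<ominus> s \<otimes> r)"
          using scalar_one_minus[of "s \<otimes> r"] ring_hom_mult[OF scalar_hom s(1) r(1)] s r by simp
        then show ?thesis using inverse[OF local_ring_unit[OF R r(1) False s(1)]] by simp
      qed
      then show ?thesis by blast
    qed
  qed
  \<comment> \<open>A nonzero product of two arrows is the class of a path outside \<open>I\<close>,
    which is the form in which \<open>special\<close> can be used.\<close>
  have pair: "Arrows [a, b] \<in> paths Q \<and> pe (Arrows [a, b]) \<notin> I \<and> tail Q a = head Q b"
    if "a \<in> arcs Q" "b \<in> arcs Q" "arr a \<otimes>\<^bsub>\<Lambda>\<^esub> arr b \<noteq> \<zero>\<^bsub>\<Lambda>\<^esub>" for a b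
  proof -
    have t: "tail Q a = head Q b" "arr a \<otimes>\<^bsub>\<Lambda>\<^esub> arr b = \<kappa> (pe (Arrows [a, b]))"
      using \<kappa>_pe_mult[OF Arrow_path[OF that(1)] Arrow_path[OF that(2)]] that(3)
      by (auto split: if_split_asm)
    have p: "Arrows [a, b] \<in> paths Q" using that t unfolding Arrows_path_iff by auto
    then show ?thesis using t that(3) \<kappa>_eq_zero_iff[OF pe_closed[OF p]] by simp
  qed
  show ?thesis
  proof (intro string_quiver_algebra.intro loc string_quiver_algebra_axioms.intro)
    have zero_mem: "\<zero>\<^bsub>\<Lambda>\<^esub> \<in> carrier \<Lambda> #>\<^bsub>\<Lambda>\<^esub> arr a" "\<zero>\<^bsub>\<Lambda>\<^esub> \<in> arr a <#\<^bsub>\<Lambda>\<^esub> carrier \<Lambda>"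
      if "a \<in> arcs Q" for a
      using qa.left_idealD(2)[OF qa.principal_left_ideal[OF qa.arr_closed[OF that]]]
        op.left_idealD(2)[OF op.principal_left_ideal[OF op.arr_closed[OF that]]] by simp_all
    show "(carrier \<Lambda> #>\<^bsub>\<Lambda>\<^esub> arr a) \<inter> (carrier \<Lambda> #>\<^bsub>\<Lambda>\<^esub> arr b) = {\<zero>\<^bsub>\<Lambda>\<^esub>}"
      if ab: "a \<in> arcs Q" "b \<in> arcs Q" "a \<noteq> b" "tail Q a = tail Q b" for a b
    proof -
      let ?F = "{carrier \<Lambda> #>\<^bsub>\<Lambda>\<^esub> arr b |b. b \<in> arcs Q \<and> b \<noteq> a \<and> tail Q b = tail Q a}"
      have "(carrier \<Lambda> #>\<^bsub>\<Lambda>\<^esub> arr a) \<inter> submodule_sum \<Lambda> (regular_module \<Lambda>) ?F = {\<zero>\<^bsub>\<Lambda>\<^esub>}"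
        using dir ab(1) unfolding arrow_direct_def Let_def left_path_ideal_eq by blast
      moreover have "carrier \<Lambda> #>\<^bsub>\<Lambda>\<^esub> arr b \<subseteq> \<Union>?F" using ab by auto
      then have "carrier \<Lambda> #>\<^bsub>\<Lambda>\<^esub> arr b \<subseteq> submodule_sum \<Lambda> (regular_module \<Lambda>) ?F"
        unfolding submodule_sum_def using qa.reg.submodule_span_superset by (rule subset_trans)
      ultimately show ?thesis using zero_mem(1) ab by blast
    qed
    show "(arr a <#\<^bsub>\<Lambda>\<^esub> carrier \<Lambda>) \<inter> (arr b <#\<^bsub>\<Lambda>\<^esub> carrier \<Lambda>) = {\<zero>\<^bsub>\<Lambda>\<^esub>}"
      if ab: "a \<in> arcs Q" "b \<in> arcs Q" "a \<noteq> b" "head Q a = head Q b" for a b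
    proof -
      let ?F = "{arr b <#\<^bsub>\<Lambda>\<^esub> carrier \<Lambda> |b. b \<in> arcs Q \<and> b \<noteq> a \<and> head Q b = head Q a}"
      let ?op = "opposite_ring \<Lambda>"
      have "(arr a <#\<^bsub>\<Lambda>\<^esub> carrier \<Lambda>) \<inter> submodule_sum ?op (regular_module ?op) ?F = {\<zero>\<^bsub>\<Lambda>\<^esub>}"
        using dir ab(1) unfolding arrow_direct_def Let_def right_path_ideal_eq by blast
      moreover have "arr b <#\<^bsub>\<Lambda>\<^esub> carrier \<Lambda> \<subseteq> \<Union>?F" using ab by auto
      then have "arr b <#\<^bsub>\<Lambda>\<^esub> carrier \<Lambda> \<subseteq> submodule_sum ?op (regular_module ?op) ?F"
        unfolding submodule_sum_def using op.reg.submodule_span_superset by (rule subset_trans)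
      ultimately show ?thesis using zero_mem(2) ab by blast
    qed
    show "card {a \<in> arcs Q. tail Q a = v} \<le> 2" "card {a \<in> arcs Q. head Q a = v} \<le> 2"
      if "v \<in> verts Q" for v
      using deg[OF that] unfolding in_degree_def out_degree_def in_arcs_def out_arcs_def by auto
    show "arr a \<noteq> \<zero>\<^bsub>\<Lambda>\<^esub>" if a: "a \<in> arcs Q" for a
      using per a \<kappa>_eq_zero_iff[OF pe_closed[OF Arrow_path[OF a]]] unfolding permissible_def by auto
    show "a = a'" if a: "a \<in> arcs Q" "a' \<in> arcs Q" "b \<in> arcs Q"
      "arr a \<otimes>\<^bsub>\<Lambda>\<^esub> arr b \<noteq> \<zero>\<^bsub>\<Lambda>\<^esub>" "arr a' \<otimes>\<^bsub>\<Lambda>\<^esub> arr b \<noteq> \<zero>\<^bsub>\<Lambda>\<^esub>" for a a' b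
      using spe a pair[of a b] pair[of a' b] unfolding special_def Uniq_def by blast
    show "a = a'" if a: "a \<in> arcs Q" "a' \<in> arcs Q" "b \<in> arcs Q"
      "arr b \<otimes>\<^bsub>\<Lambda>\<^esub> arr a \<noteq> \<zero>\<^bsub>\<Lambda>\<^esub>" "arr b \<otimes>\<^bsub>\<Lambda>\<^esub> arr a' \<noteq> \<zero>\<^bsub>\<Lambda>\<^esub>" for a a' b
      using spe a pair[of b a] pair[of b a'] unfolding special_def Uniq_def by metis
  qed
qed

end

text \<open>The hypothesis is the conclusion of \<open>string_quiver_algebra_\<Lambda>\<close>; as a
  locale it makes the algebra \<open>S\<close> and its opposite \<open>op\<close> available side by
  side.\<close>

locale string_path_algebra = path_algebra_quotient R Q I
  for R :: "('r, 'c) ring_scheme" (structure) and Q :: "('v, 'e) pre_digraph"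
    and I :: "(('v, 'e) quiver_path \<Rightarrow> 'r) set" +
  assumes string: "string_quiver_algebra (path_quotient R Q I) (verts Q) (arcs Q) (head Q) (tail Q)
    (\<lambda>v. path_coset R Q I (Triv v)) (\<lambda>a. path_coset R Q I (Arrows [a]))
    (path_algebra_quotient.scalar R Q I ` carrier R)"
begin

sublocale S: string_quiver_algebra \<Lambda> "verts Q" "arcs Q" "head Q" "tail Q" ee arr Z
  using string unfolding path_coset_def .

sublocale op: string_quiver_algebra "opposite_ring \<Lambda>" "verts Q" "arcs Q" "tail Q" "head Q" ee arr Z
  by (rule S.string_quiver_algebra_opposite)

section \<open>Translation between words and paths\<close>

lemma op_word: "set as \<subseteq> arcs Q \<Longrightarrow> op.word as = S.word (rev as)"
  by (rule S.arrow_word_opposite)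

lemma word_nonzero_iff:
  assumes "as \<noteq> []" "set as \<subseteq> arcs Q"
  shows "S.word as \<noteq> \<zero>\<^bsub>\<Lambda>\<^esub> \<longleftrightarrow> admissible_path R Q I (Arrows as)"
  using arrow_word_\<Lambda>[OF assms] \<kappa>_eq_zero_iff[OF pe_closed] unfolding admissible_path_def by auto

lemma word_eq:
  assumes "as \<noteq> []" "set as \<subseteq> arcs Q" "S.word as \<noteq> \<zero>\<^bsub>\<Lambda>\<^esub>"
  shows "S.word as = \<kappa> (pe (Arrows as))" "Arrows as \<in> paths Q"
  using arrow_word_\<Lambda>[OF assms(1,2)] assms(3) by (auto split: if_split_asm)

lemma append_path:
  assumes "Arrows as \<in> paths Q" "Arrows bs \<in> paths Q" "tail Q (last as) = head Q (List.hd bs)"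
  shows "Arrows (as @ bs) \<in> paths Q"
  using assms unfolding Arrows_path_iff by (auto simp: successively_append_iff)

text \<open>A shorter right factor of \<open>q\<close> is trivial, and then the admissibility of the
  given path decides, or it is a nonempty word, and then the minimality in
  \<open>annihilating_word\<close> does.\<close>

lemma minimal_left_annihilating_path_word:
  assumes p: "as \<noteq> []" "set as \<subseteq> arcs Q" "S.word as \<noteq> \<zero>\<^bsub>\<Lambda>\<^esub>" and q: "S.annihilating_word as q"
  shows "minimal_left_annihilating_path R Q I (Arrows as) (Arrows q)"
proof -
  have q: "q \<noteq> []" "set q \<subseteq> arcs Q" "S.word q \<noteq> \<zero>\<^bsub>\<Lambda>\<^esub>" "tail Q (last q) = head Q (List.hd as)"
    "S.word q \<otimes>\<^bsub>\<Lambda>\<^esub> S.word as = \<zero>\<^bsub>\<Lambda>\<^esub>"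
    and min: "\<And>r s. q = r @ s \<Longrightarrow> r \<noteq> [] \<Longrightarrow> s \<noteq> [] \<Longrightarrow> S.word s \<otimes>\<^bsub>\<Lambda>\<^esub> S.word as \<noteq> \<zero>\<^bsub>\<Lambda>\<^esub>"
    using q unfolding S.annihilating_word_def by auto
  have P: "Arrows as \<in> paths Q" "Arrows q \<in> paths Q" using word_eq(2) p q by auto
  have qa: "Arrows (q @ as) \<in> paths Q" by (rule append_path[OF P(2,1) q(4)])
  have "S.word (q @ as) = \<zero>\<^bsub>\<Lambda>\<^esub>" using q p S.word_append by simp
  then have "pe (Arrows (q @ as)) \<in> I"
    using word_nonzero_iff[of "q @ as"] p q qa unfolding admissible_path_def by simp
  then have inadm: "inadmissible_path R Q I (path_comp (Arrows q) (Arrows as))"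
    using qa unfolding inadmissible_path_def by simp
  have "\<not> inadmissible_path R Q I (path_comp q' (Arrows as))"
    if r: "r \<in> paths Q" "q' \<in> paths Q" "path_tail Q r = path_head Q q'" "path_comp r q' = Arrows q"
      "path_length q' < path_length (Arrows q)" for r q'
  proof (cases q')
    case (Triv v)
    then show ?thesis
      using word_nonzero_iff[OF p(1,2)] p(3) unfolding admissible_path_def inadmissible_path_def by simp
  next
    case s: (Arrows s)
    then obtain rs where rs: "r = Arrows rs" using r(4,5) by (cases r) auto
    have qs: "q = rs @ s" using r(4) s rs by simp
    have n: "rs \<noteq> []" "s \<noteq> []" "set s \<subseteq> arcs Q" using r(1,2) s rs Arrows_path_iff[of rs] Arrows_path_iff[of s] by auto
    have "S.word (s @ as) \<noteq> \<zero>\<^bsub>\<Lambda>\<^esub>" using min[OF qs n(1,2)] n p S.word_append by simp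
    then show ?thesis
      using word_nonzero_iff[of "s @ as"] n p s unfolding admissible_path_def inadmissible_path_def by simp
  qed
  then show ?thesis
    using word_nonzero_iff[OF q(1,2)] q(3,4) inadm unfolding minimal_left_annihilating_path_def by simp
qed

text \<open>Words of the opposite algebra are read backwards, so both lists are reversed.\<close>

lemma minimal_right_annihilating_path_word:
  assumes p: "as \<noteq> []" "set as \<subseteq> arcs Q" "S.word as \<noteq> \<zero>\<^bsub>\<Lambda>\<^esub>" and q: "op.annihilating_word (rev as) (rev q)"
  shows "minimal_right_annihilating_path R Q I (Arrows as) (Arrows q)"
proof -
  have q: "q \<noteq> []" "set q \<subseteq> arcs Q" "S.word q \<noteq> \<zero>\<^bsub>\<Lambda>\<^esub>" "tail Q (last as) = head Q (List.hd q)"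
    "S.word as \<otimes>\<^bsub>\<Lambda>\<^esub> S.word q = \<zero>\<^bsub>\<Lambda>\<^esub>"
    and min': "\<And>r s. rev q = r @ s \<Longrightarrow> r \<noteq> [] \<Longrightarrow> s \<noteq> [] \<Longrightarrow> S.word as \<otimes>\<^bsub>\<Lambda>\<^esub> op.word s \<noteq> \<zero>\<^bsub>\<Lambda>\<^esub>"
    using q p op_word[of "rev as"] op_word[of "rev q"] unfolding op.annihilating_word_def
    by (auto simp: last_rev hd_rev)
  have min: "S.word as \<otimes>\<^bsub>\<Lambda>\<^esub> S.word s \<noteq> \<zero>\<^bsub>\<Lambda>\<^esub>" if "q = s @ r" "r \<noteq> []" "s \<noteq> []" for r s
    using min'[of "rev r" "rev s"] op_word[of "rev s"] that q(2) by auto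
  have P: "Arrows as \<in> paths Q" "Arrows q \<in> paths Q" using word_eq(2) p q by auto
  have qa: "Arrows (as @ q) \<in> paths Q" by (rule append_path[OF P q(4)])
  have "S.word (as @ q) = \<zero>\<^bsub>\<Lambda>\<^esub>" using q p S.word_append by simp
  then have "pe (Arrows (as @ q)) \<in> I"
    using word_nonzero_iff[of "as @ q"] p q qa unfolding admissible_path_def by simp
  then have inadm: "inadmissible_path R Q I (path_comp (Arrows as) (Arrows q))"
    using qa unfolding inadmissible_path_def by simp
  have "\<not> inadmissible_path R Q I (path_comp (Arrows as) q')"
    if r: "r \<in> paths Q" "q' \<in> paths Q" "path_tail Q q' = path_head Q r" "path_comp q' r = Arrows q"
      "path_length q' < path_length (Arrows q)" for r q'
  proof (cases q')
    case (Triv v)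
    then show ?thesis
      using word_nonzero_iff[OF p(1,2)] p(3) unfolding admissible_path_def inadmissible_path_def by simp
  next
    case s: (Arrows s)
    then obtain rs where rs: "r = Arrows rs" using r(4,5) by (cases r) auto
    have qs: "q = s @ rs" using r(4) s rs by simp
    have n: "rs \<noteq> []" "s \<noteq> []" "set s \<subseteq> arcs Q" using r(1,2) s rs Arrows_path_iff[of rs] Arrows_path_iff[of s] by auto
    have "S.word (as @ s) \<noteq> \<zero>\<^bsub>\<Lambda>\<^esub>" using min[OF qs n(1,2)] n p S.word_append by simp
    then show ?thesis
      using word_nonzero_iff[of "as @ s"] n p s unfolding admissible_path_def inadmissible_path_def by simp
  qed
  then show ?thesis
    using word_nonzero_iff[OF q(1,2)] q(3,4) inadm unfolding minimal_right_annihilating_path_def by simp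
qed

context
  fixes p assumes p: "admissible_path R Q I p" "arrows p \<noteq> []"
begin

lemma admissible_arrows:
  "p = Arrows (arrows p)" "set (arrows p) \<subseteq> arcs Q" "S.word (arrows p) \<noteq> \<zero>\<^bsub>\<Lambda>\<^esub>"
  "S.word (arrows p) = \<kappa> (pe p)"
proof -
  show 1: "p = Arrows (arrows p)" using p(2) by (cases p) auto
  have "Arrows (arrows p) \<in> paths Q" using p 1 unfolding admissible_path_def by simp
  then show 2: "set (arrows p) \<subseteq> arcs Q" unfolding Arrows_path_iff by auto
  show 3: "S.word (arrows p) \<noteq> \<zero>\<^bsub>\<Lambda>\<^esub>" using word_nonzero_iff[OF p(2) 2] 1 p(1) by simp
  show "S.word (arrows p) = \<kappa> (pe p)" using word_eq(1)[OF p(2) 2 3] 1 by simp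
qed

lemma op_word_arrows: "op.word (rev (arrows p)) = \<kappa> (pe p)"
  using op_word[of "rev (arrows p)"] admissible_arrows by simp

lemma radical_Int_right:
  "(S.J #>\<^bsub>\<Lambda>\<^esub> \<kappa> (pe p)) \<inter> (arr (left_arrow p) <#\<^bsub>\<Lambda>\<^esub> carrier \<Lambda>) \<subseteq> \<kappa> (pe p) <#\<^bsub>\<Lambda>\<^esub> S.J"
  using S.J_word_Int_right[OF p(2) admissible_arrows(2,3) refl] admissible_arrows(4)
  unfolding left_arrow_def by simp

text \<open>The right arrow of \<open>p\<close> is the left arrow of the reversed word, so this is
  the inclusion for left arrows in the opposite algebra.\<close>

lemma radical_Int_left:
  "(\<kappa> (pe p) <#\<^bsub>\<Lambda>\<^esub> S.J) \<inter> (carrier \<Lambda> #>\<^bsub>\<Lambda>\<^esub> arr (right_arrow p)) \<subseteq> S.J #>\<^bsub>\<Lambda>\<^esub> \<kappa> (pe p)"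
  using op.J_word_Int_right[of "rev (arrows p)", OF _ _ _ refl] p(2) admissible_arrows(2-4)
  by (simp add: op_word_arrows S.arrow_ideal_opposite right_arrow_def hd_rev)

lemma left_cover_exists:
  "\<exists>(P :: (_, (('v, 'e) quiver_path \<Rightarrow> 'r) set) module) \<pi>.
     projective_cover \<Lambda> P \<pi> (ideal_module \<Lambda> (left_path_ideal R Q I p))"
  using S.projective_cover_exists[OF p(2) admissible_arrows(2,3)] admissible_arrows(4)
  unfolding left_path_ideal_eq by simp

lemma right_cover_exists:
  "\<exists>(P :: (_, (('v, 'e) quiver_path \<Rightarrow> 'r) set) module) \<pi>.
     projective_cover (opposite_ring \<Lambda>) P \<pi> (ideal_module (opposite_ring \<Lambda>) (right_path_ideal R Q I p))"
  using op.projective_cover_exists[of "rev (arrows p)"] p(2) admissible_arrows(2-4)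
  unfolding right_path_ideal_eq by (simp add: op_word_arrows)

lemma left_cover_kernel:
  assumes "projective_cover \<Lambda> P \<pi> (ideal_module \<Lambda> (left_path_ideal R Q I p))"
  shows "direct_sum_of_at_most \<Lambda> 2
    {ideal_module \<Lambda> (left_path_ideal R Q I q) | q. minimal_left_annihilating_path R Q I p q}
    (P\<lparr>carrier := a_kernel P (ideal_module \<Lambda> (left_path_ideal R Q I p)) \<pi>\<rparr>)"
proof -
  have "direct_sum_of_at_most \<Lambda> 2
      {ideal_module \<Lambda> (carrier \<Lambda> #>\<^bsub>\<Lambda>\<^esub> S.word q) | q. S.annihilating_word (arrows p) q}
      (P\<lparr>carrier := a_kernel P (ideal_module \<Lambda> (left_path_ideal R Q I p)) \<pi>\<rparr>)"
    using S.projective_cover_kernel[OF p(2) admissible_arrows(2,3), of P \<pi>] assms admissible_arrows(4)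
    unfolding left_path_ideal_eq by simp
  then show ?thesis
  proof (rule direct_sum_of_at_most_mono)
    have "carrier \<Lambda> #>\<^bsub>\<Lambda>\<^esub> S.word q = left_path_ideal R Q I (Arrows q) \<and>
      minimal_left_annihilating_path R Q I p (Arrows q)" if q: "S.annihilating_word (arrows p) q" for q
      using minimal_left_annihilating_path_word[OF p(2) admissible_arrows(2,3) q] admissible_arrows(1)
        word_eq(1)[of q] q unfolding S.annihilating_word_def left_path_ideal_eq by simp
    then show "{ideal_module \<Lambda> (carrier \<Lambda> #>\<^bsub>\<Lambda>\<^esub> S.word q) | q. S.annihilating_word (arrows p) q} \<subseteq>
      {ideal_module \<Lambda> (left_path_ideal R Q I q) | q. minimal_left_annihilating_path R Q I p q}"
      by auto
  qed
qed

lemma right_cover_kernel: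
  assumes "projective_cover (opposite_ring \<Lambda>) P \<pi>
    (ideal_module (opposite_ring \<Lambda>) (right_path_ideal R Q I p))"
  shows "direct_sum_of_at_most (opposite_ring \<Lambda>) 2
    {ideal_module (opposite_ring \<Lambda>) (right_path_ideal R Q I q) | q. minimal_right_annihilating_path R Q I p q}
    (P\<lparr>carrier := a_kernel P (ideal_module (opposite_ring \<Lambda>) (right_path_ideal R Q I p)) \<pi>\<rparr>)"
proof -
  have "direct_sum_of_at_most (opposite_ring \<Lambda>) 2
      {ideal_module (opposite_ring \<Lambda>) (op.word q <#\<^bsub>\<Lambda>\<^esub> carrier \<Lambda>) | q. op.annihilating_word (rev (arrows p)) q}
      (P\<lparr>carrier := a_kernel P (ideal_module (opposite_ring \<Lambda>) (right_path_ideal R Q I p)) \<pi>\<rparr>)"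
    using op.projective_cover_kernel[of "rev (arrows p)" P \<pi>] assms p(2) admissible_arrows(2-4)
    unfolding right_path_ideal_eq by (simp add: op_word_arrows)
  then show ?thesis
  proof (rule direct_sum_of_at_most_mono)
    have "op.word q <#\<^bsub>\<Lambda>\<^esub> carrier \<Lambda> = right_path_ideal R Q I (Arrows (rev q)) \<and>
      minimal_right_annihilating_path R Q I p (Arrows (rev q))"
      if q: "op.annihilating_word (rev (arrows p)) q" for q
    proof -
      have "q \<noteq> []" "set q \<subseteq> arcs Q" "op.word q \<noteq> \<zero>\<^bsub>\<Lambda>\<^esub>"
        using q unfolding op.annihilating_word_def by simp_all
      then have "op.word q = \<kappa> (pe (Arrows (rev q)))"
        using word_eq(1)[of "rev q"] op_word[of q] by simp
      then show ?thesis
        using minimal_right_annihilating_path_word[OF p(2) admissible_arrows(2,3), of "rev q"] q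
          admissible_arrows(1) unfolding right_path_ideal_eq by simp
    qed
    then show "{ideal_module (opposite_ring \<Lambda>) (op.word q <#\<^bsub>\<Lambda>\<^esub> carrier \<Lambda>) | q.
        op.annihilating_word (rev (arrows p)) q} \<subseteq>
      {ideal_module (opposite_ring \<Lambda>) (right_path_ideal R Q I q) | q. minimal_right_annihilating_path R Q I p q}"
      by auto
  qed
qed

end

end

text \<open>Existence of a cover is asserted with elements of the type of the algebra, where a
  one-sided ideal serves; the kernel is described for every cover whose elements have an arbitrary
  type.\<close>

theorem theorem1p5:
  fixes R :: "('r, 'c) ring_scheme" and \<mm> :: "'r set"
    and Q :: "('v, 'e) pre_digraph"
    and I :: "(('v, 'e) quiver_path \<Rightarrow> 'r) set"
    and \<Lambda> :: "('r, (('v, 'e) quiver_path \<Rightarrow> 'r) set) module"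
    and J :: "(('v, 'e) quiver_path \<Rightarrow> 'r) set set"
  assumes "noetherian_local_ring R \<mm>"
    and "string_algebra R Q I"
    and "\<Lambda> = path_quotient R Q I"
    and "J = jacobson_radical \<Lambda>"
  shows "biserial_ring TYPE('m) \<Lambda> \<and>
    (\<forall>p. admissible_path R Q I p \<and> arrows p \<noteq> [] \<longrightarrow>
      (\<forall>a b. left_arrow p = b \<and> right_arrow p = a \<longrightarrow>
        (J #>\<^bsub>\<Lambda>\<^esub> path_coset R Q I p) \<inter> right_path_ideal R Q I (Arrows [b])
          \<subseteq> path_coset R Q I p <#\<^bsub>\<Lambda>\<^esub> J \<and>
        (path_coset R Q I p <#\<^bsub>\<Lambda>\<^esub> J) \<inter> left_path_ideal R Q I (Arrows [a])
          \<subseteq> J #>\<^bsub>\<Lambda>\<^esub> path_coset R Q I p) \<and>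
      (let \<Lambda>p = ideal_module \<Lambda> (left_path_ideal R Q I p) in
        (\<exists>(P :: (_, (('v, 'e) quiver_path \<Rightarrow> 'r) set) module) \<pi>. projective_cover \<Lambda> P \<pi> \<Lambda>p) \<and>
        (\<forall>(P :: (_, 'm) module) \<pi>. projective_cover \<Lambda> P \<pi> \<Lambda>p \<longrightarrow>
          direct_sum_of_at_most \<Lambda> 2
            {ideal_module \<Lambda> (left_path_ideal R Q I q) | q. minimal_left_annihilating_path R Q I p q}
            (P\<lparr>carrier := a_kernel P \<Lambda>p \<pi>\<rparr>))) \<and>
      (let \<Lambda>op = opposite_ring \<Lambda>; p\<Lambda> = ideal_module \<Lambda>op (right_path_ideal R Q I p) in
        (\<exists>(P :: (_, (('v, 'e) quiver_path \<Rightarrow> 'r) set) module) \<pi>. projective_cover \<Lambda>op P \<pi> p\<Lambda>) \<and>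
        (\<forall>(P :: (_, 'm) module) \<pi>. projective_cover \<Lambda>op P \<pi> p\<Lambda> \<longrightarrow>
          direct_sum_of_at_most \<Lambda>op 2
            {ideal_module \<Lambda>op (right_path_ideal R Q I q) | q. minimal_right_annihilating_path R Q I p q}
            (P\<lparr>carrier := a_kernel P p\<Lambda> \<pi>\<rparr>))))"
proof -
  interpret PQ: path_algebra_quotient R Q I
    using assms(2) unfolding string_algebra_def path_algebra_quotient_def by blast
  interpret SP: string_path_algebra R Q I
    by (intro string_path_algebra.intro string_path_algebra_axioms.intro PQ.path_algebra_quotient_axioms)
      (use PQ.string_quiver_algebra_\<Lambda>[OF assms(1,2)] in \<open>unfold path_coset_def\<close>)
  have J: "J = SP.S.J" using assms(3,4) SP.S.jacobson_radical_eq by simp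
  show ?thesis
    unfolding assms(3) J Let_def path_coset_def PQ.right_path_ideal_eq[of "Arrows [_]"]
      PQ.left_path_ideal_eq[of "Arrows [_]"]
    using SP.S.biserial SP.radical_Int_right SP.radical_Int_left SP.left_cover_exists
      SP.right_cover_exists SP.left_cover_kernel SP.right_cover_kernel
    by blast
qed

end
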